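(* Let $\alpha>\beta>0$ be constants with $\sqrt{\alpha}-\sqrt{\beta}>\sqrt{2}$. Let $A$ be the adjacency matrix of a random graph generated according to the binary symmetric stochastic block model with parameters $(n,p,q)$ and label $x^*$, where $p=\alpha\log n/n$ and $q=\beta\log n/n$. Then there is a choice of the input parameter $N=\Theta(\log n/\log\log n)$ (depending only on $n,\alpha,\beta$) such that, for all sufficiently large $n$, with probability at least $1-n^{-\Omega(1)}$ the Algorithm described in the context, run on input $(A,N)$, takes $\mathcal{O}(\log n/\log\log n)$ orthogonal iterations and $\mathcal{O}(\log n/\log\log n)$ projected power iterations to output $x^*$ or $-x^*$. Here the probability is taken with respect to the random choices in $A$ and in the Algorithm.
   Context: **Model.** $n\ge 2$ is an even integer, $\log$ is the natural logarithm, $p,q\in[0,1]$, $p>q$, and $x^*\in\{-1,+1\}^n$ is a label vector with $\mathbf{1}^Tx^*=0$, where $\mathbf{1}$ is the all-one vector. A random graph on vertex set $[n]=\{1,\dots,n\}$ is generated according to the binary symmetric stochastic block model with parameters $(n,p,q)$ and label $x^*$ if the entries $\{a_{ij}\}_{1\le i\le j\le n}$ of its (symmetric) adjacency matrix $A$ are independent with $a_{ij}\sim\mathrm{Bern}(p)$ if $x_i^*x_j^*=1$ and $a_{ij}\sim\mathrm{Bern}(q)$ if $x_i^*x_j^*=-1$ (self-loops allowed). **Projection.** $\mathcal{F}=\{x\in\mathbb{R}^n:\mathbf{1}^Tx=0,\ x_i\in\{\pm1\}\ \forall i\in[n]\}$, and for $c\in\mathbb{R}^n$, $\mathcal{P}(c)$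 denotes the set of minimizers of $\|u-c\|_2^2$ over $u\in\mathcal{F}$. **Algorithm** (input: $A$ and a positive integer $N$). Draw $Y\in\mathbb{R}^{n\times 2}$ with i.i.d. standard normal entries, independent of $A$. Stage 1 (orthogonal iterations with Ritz acceleration): set $Q^{(0)}=Y(Y^TY)^{-1/2}$. For $k=1,\dots,N$, compute a QR decomposition $AQ^{(k-1)}=Q^{(k)}R^{(k)}$, where $Q^{(k)}\in\mathbb{R}^{n\times2}$ has orthonormal columns and $R^{(k)}\in\mathbb{R}^{2\times 2}$ is upper triangular (one such step is one orthogonal iteration). Compute an eigendecomposition $Q^{(N)T}AQ^{(N)}=H^{(N)}D^{(N)}H^{(N)T}$ with $H^{(N)}$ orthogonal and $D^{(N)}=\mathrm{diag}(d_1^{(N)},d_2^{(N)})$, $|d_1^{(N)}|\ge|d_2^{(N)}|$; set $\bar Q^{(N)}=Q^{(N)}H^{(N)}$; let $\tilde y$ be the $i^*$-th column of $\bar Q^{(N)}$, where $i^*=\arg\min_{i\in\{1,2\}}d_i^{(N)}$; set $y=\tilde y-(\mathbf{1}^T\tilde y/n)\mathbf{1}$. Stage 2 (projected power iterations): set $x^{(0)}=\sqrt n\,y/\|y\|_2$. For $k=1,2,\dots$, choose $x^{(k)}\in\mathcal{P}(Ax^{(k-1)})$ (one such step is one projected power iteration); if $x^{(k)}=x^{(k-1)}$, terminate and output $x^{(k)}$. **Convention.** "Probability at least $1-n^{-\Omega(1)}$" means probability at least $1-n^{-c}$ for all sufficiently large $n$, for some constant $c>0$ independent of $n$. Implied constants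 may depend on $\alpha,\beta$ only. *)

theory Defs
  imports
    "HOL-Probability.Probability"
    "HOL-Library.Landau_Symbols"
    "Jordan_Normal_Form.Matrix"
begin

unbundle no vec_syntax
no_notation inner (infix "\<bullet>" 70)
hide_type (open) Finite_Cartesian_Product.vec
hide_const (open) Finite_Cartesian_Product.vec Finite_Cartesian_Product.mat
  Finite_Cartesian_Product.row Finite_Cartesian_Product.column

(* The dimension n varies inside the asymptotic statement, so vectors and matrices are those of
   Jordan_Normal_Form, with explicit dimensions; rows and columns are numbered from 0. *)

definition ones :: "nat \<Rightarrow> real vec" where
  "ones n = vec n (\<lambda>_. 1)"

definition l2_norm :: "real vec \<Rightarrow> real" where
  "l2_norm v = sqrt (v \<bullet> v)"

definition balanced_labels :: "nat \<Rightarrow> real vec set" where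
  "balanced_labels n = {x \<in> carrier_vec n. ones n \<bullet> x = 0 \<and> (\<forall>i<n. x $ i \<in> {-1, 1})}"

definition projections :: "nat \<Rightarrow> real vec \<Rightarrow> real vec set" where
  "projections n c =
     {u. is_arg_min (\<lambda>u. (l2_norm (u - c))\<^sup>2) (\<lambda>u. u \<in> balanced_labels n) u}"


(* The law of the adjacency matrix. Only the entries on or above the diagonal are drawn, and the
   lower half is filled in by symmetry; diagonal entries have x_i x_i = 1, hence parameter p.
   Outside [0,1], bernoulli_pmf truncates its parameter. *)

definition sbm_pmf :: "nat \<Rightarrow> real \<Rightarrow> real \<Rightarrow> real vec \<Rightarrow> real mat pmf" where
  "sbm_pmf n p q x =
     map_pmf (\<lambda>a. mat n n (\<lambda>(i, j). of_bool (a (min i j, max i j))))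
       (Pi_pmf {(i, j). i \<le> j \<and> j < n} False
         (\<lambda>(i, j). bernoulli_pmf (if x $ i * x $ j = 1 then p else q)))"

(* The entries of Y, indexed by (row, column). *)

definition gaussian_entries :: "nat \<Rightarrow> (nat \<times> nat \<Rightarrow> real) measure" where
  "gaussian_entries n = PiM ({..<n} \<times> {..<2}) (\<lambda>_. density lborel std_normal_density)"

(* The joint law of A and of the random draw made by the algorithm. *)

definition sbm_gaussian ::
  "nat \<Rightarrow> real \<Rightarrow> real \<Rightarrow> real vec \<Rightarrow> (real mat \<times> (nat \<times> nat \<Rightarrow> real)) measure" where
  "sbm_gaussian n p q x = measure_pmf (sbm_pmf n p q x) \<Otimes>\<^sub>M gaussian_entries n"


(* S = G^(-1/2): the symmetric positive definite S with S^2 = G^(-1), for a 2 x 2 matrix G.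
   It is unique, and for G = Y^T Y it exists iff G is invertible. *)

definition is_inverse_sqrt :: "real mat \<Rightarrow> real mat \<Rightarrow> bool" where
  "is_inverse_sqrt G S \<longleftrightarrow>
     S \<in> carrier_mat 2 2 \<and> transpose_mat S = S \<and>
     (\<forall>v \<in> carrier_vec 2. v \<noteq> 0\<^sub>v 2 \<longrightarrow> 0 < v \<bullet> (S *\<^sub>v v)) \<and>
     inverts_mat (S * S) G \<and> inverts_mat G (S * S)"

definition is_qr_decomposition :: "nat \<Rightarrow> real mat \<Rightarrow> real mat \<Rightarrow> real mat \<Rightarrow> bool" where
  "is_qr_decomposition n B Q R \<longleftrightarrow>
     Q \<in> carrier_mat n 2 \<and> R \<in> carrier_mat 2 2 \<and>
     transpose_mat Q * Q = 1\<^sub>m 2 \<and> upper_triangular R \<and> B = Q * R"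

definition orthogonal_iterations ::
  "nat \<Rightarrow> real mat \<Rightarrow> real mat \<Rightarrow> nat \<Rightarrow> (nat \<Rightarrow> real mat) \<Rightarrow> bool" where
  "orthogonal_iterations n A Y N Q \<longleftrightarrow>
     (\<exists>S. is_inverse_sqrt (transpose_mat Y * Y) S \<and> Q 0 = Y * S) \<and>
     (\<forall>k<N. \<exists>R. is_qr_decomposition n (A * Q k) (Q (Suc k)) R)"

(* The matrix H and the diagonal d of an admissible eigendecomposition M = H diag(d) H^T
   of a 2 x 2 matrix M. *)

definition is_eigendecomposition :: "real mat \<Rightarrow> real mat \<Rightarrow> (nat \<Rightarrow> real) \<Rightarrow> bool" where
  "is_eigendecomposition M H d \<longleftrightarrow>
     H \<in> carrier_mat 2 2 \<and> transpose_mat H * H = 1\<^sub>m 2 \<and> H * transpose_mat H = 1\<^sub>m 2 \<and>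
     M = H * mat_diag 2 d * transpose_mat H \<and> \<bar>d 0\<bar> \<ge> \<bar>d 1\<bar>"

(* QR decompositions, eigendecompositions and minimizers are not unique, so both stages are
   modelled as relations that allow every admissible choice. *)

definition stage1_output :: "nat \<Rightarrow> real mat \<Rightarrow> real mat \<Rightarrow> nat \<Rightarrow> real vec \<Rightarrow> bool" where
  "stage1_output n A Y N y \<longleftrightarrow>
     (\<exists>Q H d i. orthogonal_iterations n A Y N Q \<and>
        is_eigendecomposition (transpose_mat (Q N) * A * Q N) H d \<and>
        is_arg_min d (\<lambda>i. i < 2) i \<and>
        (let y' = col (Q N * H) i
         in y = y' - ((ones n \<bullet> y') / real n) \<cdot>\<^sub>v ones n))"

definition terminates_at :: "(nat \<Rightarrow> 'a) \<Rightarrow> nat \<Rightarrow> bool" where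
  "terminates_at x k \<longleftrightarrow>
     k \<ge> 1 \<and> x k = x (k - 1) \<and> (\<forall>j. 1 \<le> j \<and> j < k \<longrightarrow> x j \<noteq> x (j - 1))"

(* An execution of stage 2 started from y. The values of x after termination are unconstrained. *)

definition projected_power_iterations ::
  "nat \<Rightarrow> real mat \<Rightarrow> real vec \<Rightarrow> (nat \<Rightarrow> real vec) \<Rightarrow> bool" where
  "projected_power_iterations n A y x \<longleftrightarrow>
     x 0 = (sqrt (real n) / l2_norm y) \<cdot>\<^sub>v y \<and>
     (\<forall>k. (\<forall>j\<le>k. \<not> terminates_at x j) \<longrightarrow> x (Suc k) \<in> projections n (A *\<^sub>v x k))"

(* For given A and Y, every execution of the algorithm with N orthogonal iterations is well
   defined (so Y^T Y is invertible and the division by the norm of y is legitimate) and terminates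
   after at most K projected power iterations with an output in T. The existence clauses exclude
   vacuous truth. *)

definition algorithm_outputs_within ::
  "nat \<Rightarrow> real mat \<Rightarrow> real mat \<Rightarrow> nat \<Rightarrow> real \<Rightarrow> real vec set \<Rightarrow> bool" where
  "algorithm_outputs_within n A Y N K T \<longleftrightarrow>
     (\<exists>y. stage1_output n A Y N y) \<and>
     (\<forall>y. stage1_output n A Y N y \<longrightarrow>
        y \<noteq> 0\<^sub>v n \<and>
        (\<exists>x. projected_power_iterations n A y x) \<and>
        (\<forall>x. projected_power_iterations n A y x \<longrightarrow>
           (\<exists>k. terminates_at x k \<and> real k \<le> K \<and> x k \<in> T)))"

end

theory Submission
  imports Defs "Jordan_Normal_Form.Determinant" "HOL-Real_Asymp.Real_Asymp"
begin

text \<open>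
  Let \<open>L = ln n\<close> and \<open>z = xstar\<close>. The mean of \<open>A\<close> is \<open>a/n 1 1\<^sup>T + b/n z z\<^sup>T\<close> with \<open>a = (\<alpha> + \<beta>) L / 2\<close>
  and \<open>b = (\<alpha> - \<beta>) L / 2\<close>. With high probability the deviation \<open>B\<close> from the mean has operator norm at most
  \<open>e = L\<^sup>7\<^sup>/\<^sup>8\<close>: Chernoff bounds control \<open>B\<close> on all combinatorial rectangles, and a lemma of Bilu and Linial turns
  this into a norm bound. A gain of a power of \<open>L\<close> over the eigenvalues \<open>a\<close> and \<open>b\<close> suffices, so the sharp
  order \<open>sqrt L\<close> is not needed.

  Stage 1. No spectral theorem is used. The sequence \<open>\<parallel>A\<^sup>k w\<parallel>\<close> is log-convex, so its last ratio is at least its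
  geometric mean. For \<open>w\<close> in the range of \<open>Y\<close> one has \<open>\<parallel>A\<^sup>N w\<parallel> \<ge> n\<^sup>-\<^sup>C (b/2)\<^sup>2\<^sup>N (3a)\<^sup>-\<^sup>N \<parallel>w\<parallel>\<close>, because the 2 by 2 determinant
  of \<open>Y\<^sup>T A\<^sup>N [1 z]\<close> is a bi-affine form in the Gaussian entries and hence not too small. For
  \<open>N\<close> of order \<open>L / ln L\<close> the last ratio exceeds \<open>r = L\<^sup>1\<^sup>5\<^sup>/\<^sup>1\<^sup>6\<close>, so \<open>A\<^sup>N w\<close> is within relative distance \<open>e / r\<close> of
  the span of \<open>1\<close> and \<open>z\<close>, and the Ritz step separates \<open>z\<close> from \<open>1\<close> since \<open>b < a\<close>.

  Stage 2. Since \<open>sqrt \<alpha> - sqrt \<beta> > sqrt 2\<close>, the entries of \<open>A z\<close> have the sign of \<open>z\<close> with margin \<open>\<epsilon> L\<close>. Comparing a projection \<open>x'\<close>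
  of \<open>A x\<close> with the competitor \<open>z\<close> gives \<open>\<parallel>x' - z\<parallel> \<le> 4 e / (\<epsilon> L) \<parallel>x - z\<parallel>\<close>, and two distinct labels have
  distance at least 2, so \<open>O(L / ln L)\<close> steps reach \<open>z\<close> exactly.
\<close>

section \<open>From discrepancy to the operator norm\<close>

text \<open>The iteration count dictates the precision. A Gaussian start overlaps the signal only
  polynomially in \<open>n\<close>, so a constant gain per step would cost of order
  \<open>ln n\<close> steps; order \<open>ln n / ln (ln n)\<close> asks for a gain by a power of
  \<open>L\<close> in both stages, although the mean degree itself is only of order
  \<open>L\<close>. The exponents follow a chain: rectangles have normalised discrepancy of order
  \<open>L\<close> to the 3/4, passing to the norm costs a factor logarithmic in \<open>L\<close>,
  and 7/8 absorbs it; \<open>r\<close> lies strictly between the noise 7/8 and the signal 1, and a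
  step of stage 1 then gains about \<open>b^2 / (a r)\<close>, a small power of \<open>L\<close>.
  The vectors produced by the QR and Ritz steps depend on \<open>A\<close> and on choices that are
  left open, so an estimate for one fixed vector is of no use. The determinant of the start serves
  all combinations of its two columns at once, and the QR factors matter only through the space that
  they span. Exact output is reached because the projections take values in a discrete set.\<close>

lemma sum_mult_le_positive_part:
  fixes x c :: "'a \<Rightarrow> real"
  assumes "finite S" and "\<And>i. i \<in> S \<Longrightarrow> 0 \<le> x i \<and> x i \<le> X"
  shows "(\<Sum>i\<in>S. x i * c i) \<le> X * (\<Sum>i | i \<in> S \<and> 0 < c i. c i)"
proof -
  have "(\<Sum>i\<in>S. x i * c i) \<le> (\<Sum>i\<in>S. if 0 < c i then X * c i else 0)"
    by (rule sum_mono) (use assms(2) in \<open>auto simp: mult_right_mono mult_nonneg_nonpos\<close>)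
  also have "\<dots> = X * (\<Sum>i | i \<in> S \<and> 0 < c i. c i)"
    by (simp add: sum_distrib_left sum.inter_filter[OF assms(1)] if_distrib cong: if_cong)
  finally show ?thesis .
qed

text \<open>A form that is linear in each argument is maximal at corners of the boxes:
  \<open>x\<close> is rounded first with \<open>z\<close> fixed, then \<open>z\<close> with the
  rounded \<open>x\<close> fixed. Corners are multiples of indicators of \<open>S'\<close> and
  \<open>T'\<close>, so only rectangle sums of \<open>B\<close> remain.\<close>

lemma bilinear_le_on_box:
  fixes B :: "'a \<Rightarrow> 'b \<Rightarrow> real"
  assumes fin: "finite S" "finite T" and nonneg: "0 \<le> X" "0 \<le> Z"
    and x: "\<And>i. i \<in> S \<Longrightarrow> 0 \<le> x i \<and> x i \<le> X"
    and z: "\<And>j. j \<in> T \<Longrightarrow> 0 \<le> z j \<and> z j \<le> Z"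
    and M: "\<And>S' T'. S' \<subseteq> S \<Longrightarrow> T' \<subseteq> T \<Longrightarrow> (\<Sum>i\<in>S'. \<Sum>j\<in>T'. B i j) \<le> M"
  shows "(\<Sum>i\<in>S. \<Sum>j\<in>T. x i * B i j * z j) \<le> X * Z * M"
proof -
  define c where "c = (\<lambda>i. \<Sum>j\<in>T. B i j * z j)"
  define S' where "S' = {i \<in> S. 0 < c i}"
  define c' where "c' = (\<lambda>j. \<Sum>i\<in>S'. B i j)"
  define T' where "T' = {j \<in> T. 0 < c' j}"
  have "(\<Sum>i\<in>S. \<Sum>j\<in>T. x i * B i j * z j) = (\<Sum>i\<in>S. x i * c i)"
    by (simp add: c_def sum_distrib_left mult.assoc)
  also have "\<dots> \<le> X * (\<Sum>i\<in>S'. c i)"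
    unfolding S'_def by (rule sum_mult_le_positive_part[OF fin(1) x])
  also have "(\<Sum>i\<in>S'. c i) = (\<Sum>j\<in>T. z j * c' j)"
    unfolding c_def c'_def by (subst sum.swap) (simp add: sum_distrib_left mult.commute)
  also have "X * \<dots> \<le> X * (Z * (\<Sum>j\<in>T'. c' j))"
    unfolding T'_def
    by (intro mult_left_mono sum_mult_le_positive_part[OF fin(2) z] nonneg)
  also have "(\<Sum>j\<in>T'. c' j) = (\<Sum>i\<in>S'. \<Sum>j\<in>T'. B i j)"
    unfolding c'_def by (rule sum.swap)
  also have "X * (Z * \<dots>) \<le> X * (Z * M)"
    by (intro mult_left_mono M nonneg) (auto simp: S'_def T'_def)
  finally show ?thesis by (simp add: mult.assoc)
qed

section \<open>Dyadic decomposition of the entries\<close>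

definition dyadic_level :: "real \<Rightarrow> int" where
  "dyadic_level x = \<lfloor>log 2 x\<rfloor>"

lemma dyadic_level_bounds:
  assumes "x > 0"
  shows "2 powr real_of_int (dyadic_level x) \<le> x" "x \<le> 2 * 2 powr real_of_int (dyadic_level x)"
proof -
  have l: "of_int (dyadic_level x) \<le> log 2 x" "log 2 x \<le> of_int (dyadic_level x) + 1"
    unfolding dyadic_level_def by linarith+
  have x: "x = 2 powr (log 2 x)" using assms by simp
  show "2 powr real_of_int (dyadic_level x) \<le> x"
    by (subst x, rule powr_mono) (use l in auto)
  have "2 powr (log 2 x) \<le> 2 powr (of_int (dyadic_level x) + 1)"
    by (rule powr_mono) (use l in auto)
  thus "x \<le> 2 * 2 powr real_of_int (dyadic_level x)" using x by (simp add: powr_add)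
qed

text \<open>The strict inequality between the levels is worth one further level, which pays for the
  factor 2 lost by rounding \<open>z\<close> down.\<close>

lemma dyadic_far:
  assumes "x > 0" "z > 0" "dyadic_level z + int g < dyadic_level x"
  shows "z \<le> (1/2)^g * x"
proof -
  have "z \<le> 2 * 2 powr real_of_int (dyadic_level z)" using dyadic_level_bounds[OF assms(2)] by simp
  also have "\<dots> = 2 powr (real_of_int (dyadic_level z) + 1)" by (simp add: powr_add)
  also have "\<dots> \<le> 2 powr (real_of_int (dyadic_level x) - real g)"
    using assms(3) by (intro powr_mono) (linarith, simp)
  also have "\<dots> = 2 powr real_of_int (dyadic_level x) * (1/2)^g"
    by (simp add: powr_diff powr_realpow power_divide)
  also have "\<dots> \<le> x * (1/2)^g"
    using dyadic_level_bounds[OF assms(1)] by (intro mult_right_mono) auto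
  finally show ?thesis by (simp add: mult.commute)
qed

text \<open>A level has at most \<open>2 * g + 1\<close> levels near it, so the total number of
  occupied levels, which depends on the vectors, does not enter.\<close>

lemma near_levels_sum:
  fixes f :: "int \<Rightarrow> real"
  assumes "finite K" "finite L" "\<And>k. k \<in> K \<Longrightarrow> 0 \<le> f k"
  shows "(\<Sum>k\<in>K. \<Sum>l\<in>L. if \<bar>k - l\<bar> \<le> int g then f k else 0) \<le> (2 * real g + 1) * (\<Sum>k\<in>K. f k)"
proof -
  have "(\<Sum>l\<in>L. if \<bar>k - l\<bar> \<le> int g then f k else 0) \<le> (2 * real g + 1) * f k" if "k \<in> K" for k
  proof -
    have "(\<Sum>l\<in>L. if \<bar>k - l\<bar> \<le> int g then f k else 0) = (\<Sum>l\<in>{l\<in>L. \<bar>k - l\<bar> \<le> int g}. f k)"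
      by (rule sum.inter_filter[symmetric, OF assms(2)])
    also have "\<dots> = real (card {l\<in>L. \<bar>k - l\<bar> \<le> int g}) * f k" by simp
    also have "\<dots> \<le> (2 * real g + 1) * f k"
    proof (rule mult_right_mono)
      have "card {l\<in>L. \<bar>k - l\<bar> \<le> int g} \<le> card {k - int g..k + int g}"
        by (rule card_mono) auto
      thus "real (card {l\<in>L. \<bar>k - l\<bar> \<le> int g}) \<le> 2 * real g + 1" by simp
    qed (rule assms(3)[OF that])
    finally show ?thesis .
  qed
  thus ?thesis unfolding sum_distrib_left by (rule sum_mono)
qed

lemma sum_levels_le:
  fixes x :: "'a \<Rightarrow> real"
  assumes "finite P" "\<And>i. i \<in> P \<Longrightarrow> 0 < x i"
  defines "S \<equiv> \<lambda>k. {i \<in> P. dyadic_level (x i) = k}"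
  shows "(\<Sum>k\<in>(\<lambda>i. dyadic_level (x i)) ` P. (2 powr real_of_int k)\<^sup>2 * real (card (S k))) \<le> (\<Sum>i\<in>P. (x i)\<^sup>2)"
proof -
  have "(2 powr real_of_int k)\<^sup>2 * real (card (S k)) \<le> (\<Sum>i\<in>S k. (x i)\<^sup>2)" for k
  proof -
    have "(2 powr real_of_int k)\<^sup>2 * real (card (S k)) = (\<Sum>i\<in>S k. (2 powr real_of_int k)\<^sup>2)" by simp
    also have "\<dots> \<le> (\<Sum>i\<in>S k. (x i)\<^sup>2)"
    proof (rule sum_mono)
      fix i assume "i \<in> S k"
      hence "0 < x i" "dyadic_level (x i) = k" using assms(2) by (auto simp: S_def)
      thus "(2 powr real_of_int k)\<^sup>2 \<le> (x i)\<^sup>2"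
        using dyadic_level_bounds(1)[of "x i"] by (intro power_mono) auto
    qed
    finally show ?thesis .
  qed
  hence "(\<Sum>k\<in>(\<lambda>i. dyadic_level (x i)) ` P. (2 powr real_of_int k)\<^sup>2 * real (card (S k)))
     \<le> (\<Sum>k\<in>(\<lambda>i. dyadic_level (x i)) ` P. \<Sum>i\<in>S k. (x i)\<^sup>2)" by (intro sum_mono)
  also have "\<dots> = (\<Sum>i\<in>P. (x i)\<^sup>2)"
    unfolding S_def by (rule sum.group) (use assms(1) in auto)
  finally show ?thesis .
qed

text \<open>Pairs of levels are split at distance \<open>g\<close>. On a near pair the entries are
  constant up to a factor 2 and the discrepancy bound applies to the block. On a far pair one entry
  is smaller by \<open>(1/2)^g\<close>, and absolute row and column sums suffice. The free parameter
  \<open>g\<close> balances the two losses.\<close>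

lemma bilinear_le_discrepancy_pos:
  fixes B :: "'a \<Rightarrow> 'a \<Rightarrow> real"
  assumes finP: "finite P" and finQ: "finite Q" and a: "0 \<le> a" and d: "0 \<le> d"
    and disc: "\<And>S T. S \<subseteq> P \<Longrightarrow> T \<subseteq> Q \<Longrightarrow>
        (\<Sum>i\<in>S. \<Sum>j\<in>T. B i j) \<le> a * sqrt (real (card S) * real (card T))"
    and row: "\<And>i. i \<in> P \<Longrightarrow> (\<Sum>j\<in>Q. \<bar>B i j\<bar>) \<le> d"
    and col: "\<And>j. j \<in> Q \<Longrightarrow> (\<Sum>i\<in>P. \<bar>B i j\<bar>) \<le> d"
    and x: "\<And>i. i \<in> P \<Longrightarrow> 0 < x i" and z: "\<And>j. j \<in> Q \<Longrightarrow> 0 < z j"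
  shows "(\<Sum>i\<in>P. \<Sum>j\<in>Q. x i * B i j * z j)
     \<le> (2 * a * (2 * real g + 1) + (1/2)^g * d) * ((\<Sum>i\<in>P. (x i)\<^sup>2) + (\<Sum>j\<in>Q. (z j)\<^sup>2))"
proof -
  define near where "near = (\<lambda>k l. \<bar>k - l\<bar> \<le> int g)"
  define lx where "lx = (\<lambda>i. dyadic_level (x i))"
  define lz where "lz = (\<lambda>j. dyadic_level (z j))"
  define S where "S = (\<lambda>k. {i \<in> P. lx i = k})"
  define T where "T = (\<lambda>l. {j \<in> Q. lz j = l})"
  define w where "w = (\<lambda>k::int. 2 powr real_of_int k)"
  define X where "X = (\<Sum>i\<in>P. (x i)\<^sup>2)"
  define Z where "Z = (\<Sum>j\<in>Q. (z j)\<^sup>2)"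
  define F where "F = (\<lambda>i j. x i * B i j * z j)"
  have fS: "finite (S k)" "S k \<subseteq> P" and fT: "finite (T k)" "T k \<subseteq> Q" for k
    using finP finQ by (auto simp: S_def T_def)
  have wpos: "w k > 0" for k by (simp add: w_def)
  have split: "(\<Sum>i\<in>P. \<Sum>j\<in>Q. F i j) = (\<Sum>i\<in>P. \<Sum>j\<in>Q. if near (lx i) (lz j) then F i j else 0)
      + (\<Sum>i\<in>P. \<Sum>j\<in>Q. if near (lx i) (lz j) then 0 else F i j)"
    unfolding sum.distrib[symmetric] by (intro sum.cong) auto
  have far: "(\<Sum>i\<in>P. \<Sum>j\<in>Q. if near (lx i) (lz j) then 0 else F i j) \<le> (1/2)^g * d * (X + Z)"
  proof -
    \<comment> \<open>Both squares are kept in the bound, so that it does not matter which of the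
      two entries is the larger one.\<close>
    have "(\<Sum>i\<in>P. \<Sum>j\<in>Q. if near (lx i) (lz j) then 0 else F i j)
       \<le> (\<Sum>i\<in>P. \<Sum>j\<in>Q. (1/2)^g * ((x i)\<^sup>2 * \<bar>B i j\<bar>) + (1/2)^g * ((z j)\<^sup>2 * \<bar>B i j\<bar>))"
    proof (intro sum_mono)
      fix i j assume ij: "i \<in> P" "j \<in> Q"
      note px = x[OF ij(1)] and pz = z[OF ij(2)]
      show "(if near (lx i) (lz j) then 0 else F i j) \<le> (1/2)^g * ((x i)\<^sup>2 * \<bar>B i j\<bar>) + (1/2)^g * ((z j)\<^sup>2 * \<bar>B i j\<bar>)"
      proof (cases "near (lx i) (lz j)")
        case False
        have F: "F i j \<le> x i * z j * \<bar>B i j\<bar>"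
          unfolding F_def using px pz by (simp add: mult.commute mult.left_commute mult_left_mono)
        from False consider "lz j + int g < lx i" | "lx i + int g < lz j"
          unfolding near_def by linarith
        thus ?thesis
        proof cases
          case 1
          from dyadic_far[OF px pz 1[unfolded lx_def lz_def]]
          have "x i * z j * \<bar>B i j\<bar> \<le> x i * ((1/2)^g * x i) * \<bar>B i j\<bar>"
            using px by (intro mult_right_mono mult_left_mono) auto
          also have "\<dots> = (1/2)^g * ((x i)\<^sup>2 * \<bar>B i j\<bar>)" by (simp add: power2_eq_square)
          finally show ?thesis using F False by (simp add: add_increasing2)
        next
          case 2
          from dyadic_far[OF pz px 2[unfolded lx_def lz_def]]
          have "x i * z j * \<bar>B i j\<bar> \<le> ((1/2)^g * z j) * z j * \<bar>B i j\<bar>"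
            using pz by (intro mult_right_mono) auto
          also have "\<dots> = (1/2)^g * ((z j)\<^sup>2 * \<bar>B i j\<bar>)" by (simp add: power2_eq_square)
          finally show ?thesis using F False by (simp add: add_increasing)
        qed
      qed simp
    qed
    also have "\<dots> = (1/2)^g * (\<Sum>i\<in>P. (x i)\<^sup>2 * (\<Sum>j\<in>Q. \<bar>B i j\<bar>)) + (1/2)^g * (\<Sum>j\<in>Q. (z j)\<^sup>2 * (\<Sum>i\<in>P. \<bar>B i j\<bar>))"
      unfolding sum.distrib sum_distrib_left by (subst (2) sum.swap) simp
    also have "\<dots> \<le> (1/2)^g * (\<Sum>i\<in>P. (x i)\<^sup>2 * d) + (1/2)^g * (\<Sum>j\<in>Q. (z j)\<^sup>2 * d)"
      by (intro add_mono mult_left_mono sum_mono row col) auto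
    also have "\<dots> = (1/2)^g * d * (X + Z)"
      unfolding X_def Z_def sum_distrib_right[symmetric] by (simp add: algebra_simps)
    finally show ?thesis .
  qed
  have block: "(\<Sum>i\<in>S k. \<Sum>j\<in>T l. F i j) \<le> 2 * a * ((w k)\<^sup>2 * real (card (S k))) + 2 * a * ((w l)\<^sup>2 * real (card (T l)))" for k l
  proof -
    have "(\<Sum>i\<in>S k. \<Sum>j\<in>T l. F i j) \<le> (2 * w k) * (2 * w l) * (a * sqrt (real (card (S k)) * real (card (T l))))"
      unfolding F_def
    proof (rule bilinear_le_on_box[OF fS(1) fT(1)])
      show "0 \<le> 2 * w k" "0 \<le> 2 * w l" using wpos by (auto intro: less_imp_le)
      show "0 \<le> x i \<and> x i \<le> 2 * w k" if "i \<in> S k" for i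
        using that x[of i] dyadic_level_bounds(2)[of "x i"] by (auto simp: S_def w_def lx_def)
      show "0 \<le> z i \<and> z i \<le> 2 * w l" if "i \<in> T l" for i
        using that z[of i] dyadic_level_bounds(2)[of "z i"] by (auto simp: T_def w_def lz_def)
      fix S' T' assume st: "S' \<subseteq> S k" "T' \<subseteq> T l"
      have "(\<Sum>i\<in>S'. \<Sum>j\<in>T'. B i j) \<le> a * sqrt (real (card S') * real (card T'))"
        using st fS(2)[of k] fT(2)[of l] by (intro disc) auto
      also have "\<dots> \<le> a * sqrt (real (card (S k)) * real (card (T l)))"
        using st fS fT a by (intro mult_left_mono real_sqrt_le_mono mult_mono) (auto intro: card_mono)
      finally show "(\<Sum>i\<in>S'. \<Sum>j\<in>T'. B i j) \<le> a * sqrt (real (card (S k)) * real (card (T l)))" .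
    qed
    also have "\<dots> = 4 * a * ((w k * sqrt (real (card (S k)))) * (w l * sqrt (real (card (T l)))))"
      by (simp add: real_sqrt_mult)
    \<comment> \<open>The inequality of the means separates the product into a term of level
      \<open>k\<close> and a term of level \<open>l\<close>, each of which can be summed over its
      near partners.\<close>
    also have "\<dots> \<le> 4 * a * (((w k * sqrt (real (card (S k))))\<^sup>2 + (w l * sqrt (real (card (T l))))\<^sup>2) / 2)"
      using a sum_squares_bound[of "w k * sqrt (real (card (S k)))" "w l * sqrt (real (card (T l)))"]
      by (intro mult_left_mono) auto
    finally show ?thesis by (simp add: power_mult_distrib algebra_simps)
  qed
  have "(\<Sum>i\<in>P. \<Sum>j\<in>Q. if near (lx i) (lz j) then F i j else 0)
     = (\<Sum>k\<in>lx ` P. \<Sum>i\<in>S k. \<Sum>j\<in>Q. if near (lx i) (lz j) then F i j else 0)"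
    unfolding S_def by (rule sum.group[symmetric]) (use finP in auto)
  also have "\<dots> = (\<Sum>k\<in>lx ` P. \<Sum>i\<in>S k. \<Sum>l\<in>lz ` Q. \<Sum>j\<in>T l. if near (lx i) (lz j) then F i j else 0)"
    unfolding T_def by (intro sum.cong refl sum.group[symmetric]) (use finQ in auto)
  also have "\<dots> = (\<Sum>k\<in>lx ` P. \<Sum>l\<in>lz ` Q. \<Sum>i\<in>S k. \<Sum>j\<in>T l. if near (lx i) (lz j) then F i j else 0)"
    by (subst sum.swap) (rule refl)
  also have "\<dots> = (\<Sum>k\<in>lx ` P. \<Sum>l\<in>lz ` Q. \<Sum>i\<in>S k. \<Sum>j\<in>T l. if near k l then F i j else 0)"
    by (intro sum.cong refl) (auto simp: S_def T_def)
  also have "\<dots> = (\<Sum>k\<in>lx ` P. \<Sum>l\<in>lz ` Q. if near k l then (\<Sum>i\<in>S k. \<Sum>j\<in>T l. F i j) else 0)"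
    by (intro sum.cong refl) auto
  also have "\<dots> \<le> (\<Sum>k\<in>lx ` P. \<Sum>l\<in>lz ` Q. (if near k l then 2 * a * ((w k)\<^sup>2 * real (card (S k))) else 0)
        + (if near k l then 2 * a * ((w l)\<^sup>2 * real (card (T l))) else 0))"
    by (intro sum_mono) (use block in auto)
  also have "\<dots> = (\<Sum>k\<in>lx ` P. \<Sum>l\<in>lz ` Q. if near k l then 2 * a * ((w k)\<^sup>2 * real (card (S k))) else 0)
     + (\<Sum>l\<in>lz ` Q. \<Sum>k\<in>lx ` P. if \<bar>l - k\<bar> \<le> int g then 2 * a * ((w l)\<^sup>2 * real (card (T l))) else 0)"
    unfolding sum.distrib by (subst (2) sum.swap) (simp add: near_def abs_minus_commute)
  also have "\<dots> \<le> (2 * real g + 1) * (\<Sum>k\<in>lx ` P. 2 * a * ((w k)\<^sup>2 * real (card (S k))))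
     + (2 * real g + 1) * (\<Sum>l\<in>lz ` Q. 2 * a * ((w l)\<^sup>2 * real (card (T l))))"
    unfolding near_def using finP finQ a by (intro add_mono near_levels_sum) auto
  also have "\<dots> \<le> (2 * real g + 1) * (2 * a * X) + (2 * real g + 1) * (2 * a * Z)"
    unfolding sum_distrib_left[symmetric] X_def Z_def w_def S_def T_def lx_def lz_def
    using a sum_levels_le[of P x] sum_levels_le[of Q z] finP finQ x z
    by (intro add_mono mult_left_mono) auto
  finally have near: "(\<Sum>i\<in>P. \<Sum>j\<in>Q. if near (lx i) (lz j) then F i j else 0) \<le> 2 * a * (2 * real g + 1) * (X + Z)"
    by (simp add: algebra_simps)
  show ?thesis using split near far unfolding F_def X_def Z_def by (simp add: algebra_simps)
qed

text \<open>Positive and negative parts of \<open>x\<close> and \<open>z\<close> give four sign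
  patterns; a mixed pattern is the positive case for \<open>- B\<close>, which the two-sided
  discrepancy hypothesis also covers. Each part occurs in two patterns, hence the factor 2.\<close>

lemma bilinear_le_discrepancy_add:
  fixes B :: "'a \<Rightarrow> 'a \<Rightarrow> real" and g :: nat and x z :: "'a \<Rightarrow> real"
  assumes fin: "finite I" and a: "0 \<le> a" and d: "0 \<le> d"
    and disc: "\<And>S T. S \<subseteq> I \<Longrightarrow> T \<subseteq> I \<Longrightarrow>
        \<bar>\<Sum>i\<in>S. \<Sum>j\<in>T. B i j\<bar> \<le> a * sqrt (real (card S) * real (card T))"
    and row: "\<And>i. i \<in> I \<Longrightarrow> (\<Sum>j\<in>I. \<bar>B i j\<bar>) \<le> d"
    and sym: "\<And>i j. i \<in> I \<Longrightarrow> j \<in> I \<Longrightarrow> B i j = B j i"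
  defines "C \<equiv> 2 * a * (2 * real g + 1) + (1/2)^g * d"
  shows "(\<Sum>i\<in>I. \<Sum>j\<in>I. x i * B i j * z j) \<le> 2 * C * ((\<Sum>i\<in>I. (x i)\<^sup>2) + (\<Sum>j\<in>I. (z j)\<^sup>2))"
proof -
  have key: "(\<Sum>i\<in>P. \<Sum>j\<in>Q. x i * (s * B i j) * z j) \<le> C * ((\<Sum>i\<in>P. (x i)\<^sup>2) + (\<Sum>j\<in>Q. (z j)\<^sup>2))"
    if "P \<subseteq> I" "Q \<subseteq> I" "s \<in> {-1, 1}" "\<And>i. i \<in> P \<Longrightarrow> 0 < x i" "\<And>j. j \<in> Q \<Longrightarrow> 0 < z j" for P Q s and x z :: "'a \<Rightarrow> real"
    unfolding C_def
  proof (rule bilinear_le_discrepancy_pos[OF _ _ a d])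
    show fP: "finite P" "finite Q" using that fin finite_subset by auto
    show "(\<Sum>i\<in>S. \<Sum>j\<in>T. s * B i j) \<le> a * sqrt (real (card S) * real (card T))"
      if "S \<subseteq> P" "T \<subseteq> Q" for S T
      using disc[of S T] that \<open>P \<subseteq> I\<close> \<open>Q \<subseteq> I\<close> \<open>s \<in> {-1, 1}\<close>
      by (auto simp: sum_negf abs_le_iff)
    show "(\<Sum>j\<in>Q. \<bar>s * B i j\<bar>) \<le> d" if "i \<in> P" for i
    proof -
      have "(\<Sum>j\<in>Q. \<bar>s * B i j\<bar>) = (\<Sum>j\<in>Q. \<bar>B i j\<bar>)" using \<open>s \<in> {-1, 1}\<close> by auto
      also have "\<dots> \<le> (\<Sum>j\<in>I. \<bar>B i j\<bar>)" using \<open>Q \<subseteq> I\<close> fin by (intro sum_mono2) auto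
      finally show ?thesis using row[of i] that \<open>P \<subseteq> I\<close> by auto
    qed
    show "(\<Sum>i\<in>P. \<bar>s * B i j\<bar>) \<le> d" if "j \<in> Q" for j
    proof -
      have "(\<Sum>i\<in>P. \<bar>s * B i j\<bar>) = (\<Sum>i\<in>P. \<bar>B j i\<bar>)"
      proof (intro sum.cong refl)
        fix i assume "i \<in> P"
        hence "B i j = B j i" using \<open>P \<subseteq> I\<close> \<open>Q \<subseteq> I\<close> that by (intro sym) auto
        thus "\<bar>s * B i j\<bar> = \<bar>B j i\<bar>" using \<open>s \<in> {-1, 1}\<close> by auto
      qed
      also have "\<dots> \<le> (\<Sum>i\<in>I. \<bar>B j i\<bar>)" using \<open>P \<subseteq> I\<close> fin by (intro sum_mono2) auto
      finally show ?thesis using row[of j] that \<open>Q \<subseteq> I\<close> by auto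
    qed
  qed (use that in auto)
  define P N where "P = (\<lambda>x :: 'a \<Rightarrow> real. {i \<in> I. 0 < x i})" and "N = (\<lambda>x :: 'a \<Rightarrow> real. {i \<in> I. x i < 0})"
  have split: "(\<Sum>i\<in>I. f i) = (\<Sum>i\<in>P x. f i) + (\<Sum>i\<in>N x. f i)"
    if "\<And>i. i \<in> I \<Longrightarrow> x i = 0 \<Longrightarrow> f i = 0" for x f :: "'a \<Rightarrow> real"
  proof -
    have PN: "P x \<union> N x = {i \<in> I. x i \<noteq> 0}" by (auto simp: P_def N_def)
    have "(\<Sum>i\<in>I. f i) = (\<Sum>i\<in>P x \<union> N x. f i)"
      unfolding PN using that fin by (intro sum.mono_neutral_right) auto
    also have "\<dots> = (\<Sum>i\<in>P x. f i) + (\<Sum>i\<in>N x. f i)"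
      using fin by (intro sum.union_disjoint) (auto simp: P_def N_def)
    finally show ?thesis .
  qed
  let ?f = "\<lambda>i j. x i * B i j * z j"
  have sub: "P x \<subseteq> I" "N x \<subseteq> I" for x by (auto simp: P_def N_def)
  have pos: "\<And>i. i \<in> P x \<Longrightarrow> 0 < x i" "\<And>i. i \<in> N x \<Longrightarrow> 0 < - x i" for x by (auto simp: P_def N_def)
  have "(\<Sum>i\<in>I. \<Sum>j\<in>I. ?f i j) = (\<Sum>i\<in>P x. \<Sum>j\<in>P z. ?f i j) + (\<Sum>i\<in>P x. \<Sum>j\<in>N z. ?f i j)
     + (\<Sum>i\<in>N x. \<Sum>j\<in>P z. ?f i j) + (\<Sum>i\<in>N x. \<Sum>j\<in>N z. ?f i j)"
    by (subst split[of x], simp, subst (1 2) split[of z]) (simp_all add: sum.distrib)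
  moreover have "(\<Sum>i\<in>P x. \<Sum>j\<in>P z. ?f i j) \<le> C * ((\<Sum>i\<in>P x. (x i)\<^sup>2) + (\<Sum>j\<in>P z. (z j)\<^sup>2))"
    using key[OF sub(1) sub(1), of 1 x x z z] pos by simp
  moreover have "(\<Sum>i\<in>P x. \<Sum>j\<in>N z. ?f i j) \<le> C * ((\<Sum>i\<in>P x. (x i)\<^sup>2) + (\<Sum>j\<in>N z. (z j)\<^sup>2))"
    using key[OF sub(1) sub(2), of "-1" x x z "\<lambda>j. - z j"] pos by simp
  moreover have "(\<Sum>i\<in>N x. \<Sum>j\<in>P z. ?f i j) \<le> C * ((\<Sum>i\<in>N x. (x i)\<^sup>2) + (\<Sum>j\<in>P z. (z j)\<^sup>2))"
    using key[OF sub(2) sub(1), of "-1" x "\<lambda>j. - x j" z z] pos by simp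
  moreover have "(\<Sum>i\<in>N x. \<Sum>j\<in>N z. ?f i j) \<le> C * ((\<Sum>i\<in>N x. (x i)\<^sup>2) + (\<Sum>j\<in>N z. (z j)\<^sup>2))"
    using key[OF sub(2) sub(2), of 1 x "\<lambda>j. - x j" z "\<lambda>j. - z j"] pos by simp
  moreover have "(\<Sum>i\<in>I. (x i)\<^sup>2) = (\<Sum>i\<in>P x. (x i)\<^sup>2) + (\<Sum>i\<in>N x. (x i)\<^sup>2)"
     "(\<Sum>i\<in>I. (z i)\<^sup>2) = (\<Sum>i\<in>P z. (z i)\<^sup>2) + (\<Sum>i\<in>N z. (z i)\<^sup>2)"
    by (rule split; simp)+
  ultimately show ?thesis by (simp add: algebra_simps)
qed

text \<open>A variant of the converse expander mixing lemma of Bilu and Linial.\<close>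
lemma bilinear_le_discrepancy:
  fixes B :: "'a \<Rightarrow> 'a \<Rightarrow> real"
  assumes fin: "finite I" and a: "0 \<le> a" and d: "0 \<le> d"
    and disc: "\<And>S T. S \<subseteq> I \<Longrightarrow> T \<subseteq> I \<Longrightarrow>
        \<bar>\<Sum>i\<in>S. \<Sum>j\<in>T. B i j\<bar> \<le> a * sqrt (real (card S) * real (card T))"
    and row: "\<And>i. i \<in> I \<Longrightarrow> (\<Sum>j\<in>I. \<bar>B i j\<bar>) \<le> d"
    and sym: "\<And>i j. i \<in> I \<Longrightarrow> j \<in> I \<Longrightarrow> B i j = B j i"
  shows "\<bar>\<Sum>i\<in>I. \<Sum>j\<in>I. x i * B i j * z j\<bar>
     \<le> 4 * (2 * a * (2 * real g + 1) + (1/2)^g * d) * (sqrt (\<Sum>i\<in>I. (x i)\<^sup>2) * sqrt (\<Sum>j\<in>I. (z j)\<^sup>2))"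
proof -
  define C where "C = 2 * a * (2 * real g + 1) + (1/2)^g * d"
  have le: "(\<Sum>i\<in>I. \<Sum>j\<in>I. x i * B i j * z j) \<le> 4 * C * (sqrt (\<Sum>i\<in>I. (x i)\<^sup>2) * sqrt (\<Sum>j\<in>I. (z j)\<^sup>2))" for x z :: "'a \<Rightarrow> real"
  proof -
    define X where "X = sqrt (\<Sum>i\<in>I. (x i)\<^sup>2)"
    define Z where "Z = sqrt (\<Sum>i\<in>I. (z i)\<^sup>2)"
    have X2: "X\<^sup>2 = (\<Sum>i\<in>I. (x i)\<^sup>2)" "Z\<^sup>2 = (\<Sum>i\<in>I. (z i)\<^sup>2)" by (simp_all add: X_def Z_def sum_nonneg)
    have nn: "X \<ge> 0" "Z \<ge> 0" by (simp_all add: X_def Z_def sum_nonneg)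
    show ?thesis
    proof (cases "X = 0 \<or> Z = 0")
      case True
      have "(\<Sum>i\<in>I. \<Sum>j\<in>I. x i * B i j * z j) = 0"
      proof (cases "X = 0")
        case True
        hence "\<forall>i\<in>I. x i = 0" using X2(1) fin by (auto simp: sum_nonneg_eq_0_iff)
        thus ?thesis by simp
      next
        case False
        hence "\<forall>i\<in>I. z i = 0" using X2(2) fin True by (auto simp: sum_nonneg_eq_0_iff)
        thus ?thesis by simp
      qed
      thus ?thesis using True by (auto simp: X_def Z_def)
    next
      case False
      hence p: "X > 0" "Z > 0" using nn by auto
      \<comment> \<open>On unit vectors the two sums of squares add up to 2; by homogeneity the
        additive bound becomes one by the product of the norms.\<close>
      have "(\<Sum>i\<in>I. \<Sum>j\<in>I. (x i / X) * B i j * (z j / Z)) \<le> 2 * C * ((\<Sum>i\<in>I. (x i / X)\<^sup>2) + (\<Sum>j\<in>I. (z j / Z)\<^sup>2))"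
        unfolding C_def by (rule bilinear_le_discrepancy_add[OF fin a d disc row sym])
      also have "\<dots> = 4 * C"
        using p by (simp add: power_divide sum_divide_distrib[symmetric] X2[symmetric])
      also have "(\<Sum>i\<in>I. \<Sum>j\<in>I. (x i / X) * B i j * (z j / Z)) = (\<Sum>i\<in>I. \<Sum>j\<in>I. x i * B i j * z j) / (X * Z)"
        by (simp add: sum_divide_distrib)
      finally show ?thesis using p by (simp add: X_def[symmetric] Z_def[symmetric] field_simps)
    qed
  qed
  have "- (\<Sum>i\<in>I. \<Sum>j\<in>I. x i * B i j * z j) \<le> 4 * C * (sqrt (\<Sum>i\<in>I. (x i)\<^sup>2) * sqrt (\<Sum>j\<in>I. (z j)\<^sup>2))"
    using le[of x "\<lambda>j. - z j"] by (simp add: sum_negf)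
  thus ?thesis using le[of x z] unfolding C_def by (simp add: abs_le_iff)
qed

section \<open>Projected power iterations\<close>

lemma l2_norm_nonneg [simp]: "0 \<le> l2_norm v"
  and l2_norm_sq: "(l2_norm v)\<^sup>2 = v \<bullet> v"
proof -
  have "0 \<le> v \<bullet> v" unfolding scalar_prod_def by (intro sum_nonneg) auto
  thus "0 \<le> l2_norm v" "(l2_norm v)\<^sup>2 = v \<bullet> v" by (auto simp: l2_norm_def)
qed

lemma l2_norm_zero_iff:
  assumes "v \<in> carrier_vec n"
  shows "l2_norm v = 0 \<longleftrightarrow> v = 0\<^sub>v n"
proof
  assume "l2_norm v = 0"
  hence "(\<Sum>i\<in>{0..<n}. v $ i * v $ i) = 0" using assms by (simp add: l2_norm_def scalar_prod_def)
  hence "\<forall>i\<in>{0..<n}. v $ i * v $ i = 0" by (subst (asm) sum_nonneg_eq_0_iff) auto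
  thus "v = 0\<^sub>v n" using assms by (intro eq_vecI) auto
next
  assume "v = 0\<^sub>v n"
  thus "l2_norm v = 0" by (simp add: l2_norm_def)
qed

lemma l2_norm_smult:
  assumes "v \<in> carrier_vec n"
  shows "l2_norm (c \<cdot>\<^sub>v v) = \<bar>c\<bar> * l2_norm v"
proof -
  have "(c \<cdot>\<^sub>v v) \<bullet> (c \<cdot>\<^sub>v v) = c\<^sup>2 * (v \<bullet> v)"
    using assms by (simp add: power2_eq_square)
  thus ?thesis by (simp add: l2_norm_def real_sqrt_mult)
qed

lemma l2_norm_eq_L2_set: "v \<in> carrier_vec n \<Longrightarrow> l2_norm v = L2_set (\<lambda>i. v $ i) {0..<n}"
  by (simp add: l2_norm_def L2_set_def scalar_prod_def power2_eq_square)

lemma abs_scalar_prod_le: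
  assumes "v \<in> carrier_vec n" "w \<in> carrier_vec n"
  shows "\<bar>v \<bullet> w\<bar> \<le> l2_norm v * l2_norm w"
proof -
  have "\<bar>v \<bullet> w\<bar> \<le> (\<Sum>i\<in>{0..<n}. \<bar>v $ i\<bar> * \<bar>w $ i\<bar>)"
    using assms sum_abs[of "\<lambda>i. v $ i * w $ i" "{0..<n}"] by (simp add: scalar_prod_def abs_mult)
  also have "\<dots> \<le> L2_set (\<lambda>i. v $ i) {0..<n} * L2_set (\<lambda>i. w $ i) {0..<n}"
    by (rule L2_set_mult_ineq)
  finally show ?thesis using assms by (simp add: l2_norm_eq_L2_set)
qed

lemma l2_norm_triangle:
  assumes "v \<in> carrier_vec n" "w \<in> carrier_vec n"
  shows "l2_norm (v + w) \<le> l2_norm v + l2_norm w"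
proof -
  have "l2_norm (v + w) = L2_set (\<lambda>i. v $ i + w $ i) {0..<n}"
    using assms by (subst l2_norm_eq_L2_set[of _ n]) (auto intro!: L2_set_cong)
  also have "\<dots> \<le> L2_set (\<lambda>i. v $ i) {0..<n} + L2_set (\<lambda>i. w $ i) {0..<n}"
    by (rule L2_set_triangle_ineq)
  finally show ?thesis using assms by (simp add: l2_norm_eq_L2_set)
qed

lemma ones_carrier [simp]: "ones n \<in> carrier_vec n"
  by (simp add: ones_def)

lemma ones_sq [simp]: "ones n \<bullet> ones n = real n"
  by (simp add: ones_def scalar_prod_def)

lemma balanced_labelsD:
  assumes "z \<in> balanced_labels n"
  shows "z \<in> carrier_vec n" "ones n \<bullet> z = 0" "z \<bullet> ones n = 0" "z \<bullet> z = real n"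
    and "\<And>i. i < n \<Longrightarrow> z $ i = 1 \<or> z $ i = -1"
proof -
  show c: "z \<in> carrier_vec n" and o: "ones n \<bullet> z = 0" and v: "\<And>i. i < n \<Longrightarrow> z $ i = 1 \<or> z $ i = -1"
    using assms by (auto simp: balanced_labels_def)
  show "z \<bullet> ones n = 0" using comm_scalar_prod[OF c ones_carrier] o by simp
  have "z \<bullet> z = (\<Sum>i\<in>{0..<n}. 1)" unfolding scalar_prod_def using c
    by (intro sum.cong) (auto dest: v)
  thus "z \<bullet> z = real n" by simp
qed

lemma balanced_labels_uminus:
  assumes "z \<in> balanced_labels n"
  shows "- z \<in> balanced_labels n"
  using balanced_labelsD[OF assms] by (auto simp: balanced_labels_def)

lemma finite_balanced_labels: "finite (balanced_labels n)"
proof (rule finite_subset)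
  show "balanced_labels n \<subseteq> vec n ` ({..<n} \<rightarrow>\<^sub>E {-1, 1})"
  proof
    fix z assume z: "z \<in> balanced_labels n"
    have "z = vec n (restrict (\<lambda>i. z $ i) {..<n})"
      using balanced_labelsD(1)[OF z] by (intro eq_vecI) auto
    moreover have "restrict (\<lambda>i. z $ i) {..<n} \<in> {..<n} \<rightarrow>\<^sub>E {-1, 1}"
      using balanced_labelsD(5)[OF z] by auto
    ultimately show "z \<in> vec n ` ({..<n} \<rightarrow>\<^sub>E {-1, 1})" by blast
  qed
  show "finite (vec n ` ({..<n} \<rightarrow>\<^sub>E {-1::real, 1}))"
    by (intro finite_imageI finite_PiE) auto
qed

lemma projections_nonempty:
  assumes "balanced_labels n \<noteq> {}"
  shows "projections n c \<noteq> {}"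
  using ex_is_arg_min_if_finite[OF finite_balanced_labels assms, of "\<lambda>u. (l2_norm (u - c))\<^sup>2"]
  by (auto simp: projections_def)

text \<open>All balanced labels have squared norm \<open>n\<close>, so the ones nearest to
  \<open>c\<close> are those with the largest scalar product with \<open>c\<close>.\<close>

lemma projection_scalar_prod_le:
  assumes "x \<in> projections n c" "z \<in> balanced_labels n" and c: "c \<in> carrier_vec n"
  shows "x \<in> balanced_labels n" "z \<bullet> c \<le> x \<bullet> c"
proof -
  show x: "x \<in> balanced_labels n" using assms by (simp add: projections_def is_arg_min_def)
  have le: "(l2_norm (x - c))\<^sup>2 \<le> (l2_norm (z - c))\<^sup>2"
    using assms by (auto simp: projections_def is_arg_min_linorder)
  have e: "(l2_norm (u - c))\<^sup>2 = real n - 2 * (u \<bullet> c) + c \<bullet> c" if u: "u \<in> balanced_labels n" for u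
    using balanced_labelsD(1,4)[OF u] c comm_scalar_prod[of c n u]
    by (simp add: l2_norm_sq minus_scalar_prod_distrib[of _ n] scalar_prod_minus_distrib[of _ n])
  show "z \<bullet> c \<le> x \<bullet> c" using le e[OF x] e[OF assms(2)] by simp
qed

text \<open>Equal norms turn the distance into a scalar product; each nonzero coordinate of
  \<open>z - x\<close> carries the sign of \<open>z\<close>; two different labels differ by 2 in
  some coordinate. The last fact turns approximate into exact recovery.\<close>

lemma balanced_labels_diff:
  assumes "x \<in> balanced_labels n" "z \<in> balanced_labels n"
  shows "z \<bullet> (z - x) = (z - x) \<bullet> (z - x) / 2"
    and "i < n \<Longrightarrow> 0 \<le> (z - x) $ i * z $ i"
    and "l2_norm (x - z) < 2 \<Longrightarrow> x = z"
proof -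
  note x = balanced_labelsD[OF assms(1)] and z = balanced_labelsD[OF assms(2)]
  show "z \<bullet> (z - x) = (z - x) \<bullet> (z - x) / 2"
    using x z comm_scalar_prod[OF x(1) z(1)]
    by (simp add: minus_scalar_prod_distrib[of _ n] scalar_prod_minus_distrib[of _ n])
  show "0 \<le> (z - x) $ i * z $ i" if "i < n" for i
    using x(1) z(1) x(5)[OF that] z(5)[OF that] that by auto
  show "x = z" if l: "l2_norm (x - z) < 2"
  proof (rule ccontr)
    assume "x \<noteq> z"
    then obtain i where i: "i < n" "x $ i \<noteq> z $ i"
      using x(1) z(1) by (auto simp: vec_eq_iff)
    have "4 = (x - z) $ i * (x - z) $ i" using i x(1,5) z(1,5) by force
    also have "\<dots> \<le> (\<Sum>i\<in>{0..<n}. (x - z) $ i * (x - z) $ i)"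
      using i by (intro member_le_sum) auto
    also have "\<dots> = (l2_norm (x - z))\<^sup>2" using x(1) z(1) by (simp add: l2_norm_sq scalar_prod_def)
    also have "\<dots> < 2\<^sup>2" using l by (intro power_strict_mono) auto
    finally show False by simp
  qed
qed

text \<open>The operator norm bound on the noise is phrased through the bilinear form, so no norm of
  matrices has to be introduced. The mean has eigenvalue \<open>a\<close> on \<open>ones n\<close>
  and \<open>b\<close> on \<open>z\<close>.\<close>

locale block_matrix =
  fixes n :: nat and A :: "real mat" and z :: "real vec" and a b e :: real
  assumes n_pos: "0 < n"
    and A: "A \<in> carrier_mat n n" and sym: "transpose_mat A = A"
    and z: "z \<in> balanced_labels n"
    and b_nonneg: "0 \<le> b" and b_le_a: "b \<le> a" and e_nonneg: "0 \<le> e"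
    and approx: "\<And>x y. x \<in> carrier_vec n \<Longrightarrow> y \<in> carrier_vec n \<Longrightarrow>
      \<bar>y \<bullet> (A *\<^sub>v x) - a / real n * ((ones n \<bullet> x) * (ones n \<bullet> y)) - b / real n * ((z \<bullet> x) * (z \<bullet> y))\<bar>
        \<le> e * (l2_norm x * l2_norm y)"
begin

lemmas zD = balanced_labelsD[OF z]

lemma A_carrier [simp]: "x \<in> carrier_vec n \<Longrightarrow> A *\<^sub>v x \<in> carrier_vec n"
  using A by simp

text \<open>With \<open>h = z - x'\<close> and \<open>v = x - z\<close>, optimality of
  \<open>x'\<close> says \<open>h \<bullet> A x \<le> 0\<close>. The part
  \<open>h \<bullet> A z\<close> is at least \<open>\<eta> * |h|^2 / 2\<close>. In
  \<open>h \<bullet> A v\<close> the component along \<open>ones n\<close> vanishes since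
  \<open>h\<close> is centred, the component along \<open>z\<close> is of second order in both
  vectors and \<open>near\<close> bounds it by \<open>\<eta> * |h|^2 / 4\<close>, and the noise
  contributes at most \<open>e * |v| * |h|\<close>.\<close>

lemma projected_power_step:
  assumes x: "x \<in> carrier_vec n" "ones n \<bullet> x = 0" "x \<bullet> x = real n"
    and x': "x' \<in> projections n (A *\<^sub>v x)"
    and eta: "0 < \<eta>" "\<And>i. i < n \<Longrightarrow> \<eta> \<le> z $ i * (A *\<^sub>v z) $ i"
    and near: "b * (l2_norm (x - z))\<^sup>2 \<le> \<eta> * real n"
  shows "l2_norm (x' - z) \<le> 4 * e / \<eta> * l2_norm (x - z)"
proof -
  note zc = zD(1)
  note P = projection_scalar_prod_le[OF x' z A_carrier[OF x(1)]]
  note x'D = balanced_labelsD[OF P(1)]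
  define h where "h = z - x'"
  define v where "v = x - z"
  have hc: "h \<in> carrier_vec n" and vc: "v \<in> carrier_vec n"
    using zc x'D(1) x(1) by (auto simp: h_def v_def)
  have hA: "h \<bullet> (A *\<^sub>v x) \<le> 0"
    unfolding h_def using P(2) zc x'D(1) x(1) by (simp add: minus_scalar_prod_distrib[of _ n])
  have "x = z + v" unfolding v_def using x(1) zc by auto
  hence "A *\<^sub>v x = A *\<^sub>v z + A *\<^sub>v v" using mult_add_distrib_mat_vec[OF A zc vc] by simp
  hence split: "h \<bullet> (A *\<^sub>v x) = h \<bullet> (A *\<^sub>v z) + h \<bullet> (A *\<^sub>v v)"
    using scalar_prod_add_distrib[OF hc A_carrier[OF zc] A_carrier[OF vc]] by simp
  have zh: "z \<bullet> h = (l2_norm h)\<^sup>2 / 2"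
    unfolding h_def l2_norm_sq by (rule balanced_labels_diff[OF P(1) z])
  have "\<eta> * (z \<bullet> h) = (\<Sum>i\<in>{0..<n}. (h $ i * z $ i) * \<eta>)"
    using hc by (simp add: scalar_prod_def sum_distrib_left mult_ac)
  also have "\<dots> \<le> (\<Sum>i\<in>{0..<n}. (h $ i * z $ i) * (z $ i * (A *\<^sub>v z) $ i))"
    using eta(2) balanced_labels_diff(2)[OF P(1) z] unfolding h_def
    by (intro sum_mono mult_left_mono) auto
  also have "\<dots> = (\<Sum>i\<in>{0..<n}. h $ i * (A *\<^sub>v z) $ i)"
    by (intro sum.cong) (use zD(5) in force)+
  also have "\<dots> = h \<bullet> (A *\<^sub>v z)" using A by (simp add: scalar_prod_def)
  finally have main: "\<eta> * (l2_norm h)\<^sup>2 / 2 \<le> h \<bullet> (A *\<^sub>v z)" using zh by simp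
  have oh: "ones n \<bullet> h = 0" unfolding h_def using zD(2) x'D(2) zc x'D(1)
    by (simp add: scalar_prod_minus_distrib[of _ n])
  \<comment> \<open>As \<open>x\<close> and \<open>z\<close> have equal norms, \<open>v\<close> is
    nearly orthogonal to \<open>z\<close>: the scalar product is quadratic in
    \<open>v\<close>.\<close>
  have zv: "z \<bullet> v = - (l2_norm v)\<^sup>2 / 2"
    unfolding v_def l2_norm_sq using x zc zD(4) comm_scalar_prod[OF x(1) zc]
    by (simp add: minus_scalar_prod_distrib[of _ n] scalar_prod_minus_distrib[of _ n])
  have "- (e * (l2_norm v * l2_norm h)) \<le> h \<bullet> (A *\<^sub>v v) - b / real n * ((z \<bullet> v) * (z \<bullet> h))"
    using approx[OF vc hc] oh by simp
  hence hv: "- (e * (l2_norm v * l2_norm h)) - b / real n * ((l2_norm v)\<^sup>2 / 2 * ((l2_norm h)\<^sup>2 / 2)) \<le> h \<bullet> (A *\<^sub>v v)"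
    unfolding zv zh by simp
  have "b / real n * ((l2_norm v)\<^sup>2 / 2 * ((l2_norm h)\<^sup>2 / 2)) = (b * (l2_norm v)\<^sup>2) / real n * (l2_norm h)\<^sup>2 / 4"
    by simp
  also have "\<dots> \<le> \<eta> * (l2_norm h)\<^sup>2 / 4"
    using near n_pos unfolding v_def
    by (intro divide_right_mono mult_right_mono) (auto simp: divide_le_eq)
  finally have "\<eta> * (l2_norm h)\<^sup>2 / 4 \<le> e * (l2_norm v * l2_norm h)"
    using hA split main hv by linarith
  hence "l2_norm h * (\<eta> * l2_norm h) \<le> l2_norm h * (4 * e * l2_norm v)"
    by (simp add: power2_eq_square mult_ac)
  hence "l2_norm h = 0 \<or> \<eta> * l2_norm h \<le> 4 * e * l2_norm v"
    using l2_norm_nonneg[of h] by (metis less_eq_real_def mult_le_cancel_left_pos)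
  hence "l2_norm h \<le> 4 * e / \<eta> * l2_norm v"
    using eta(1) e_nonneg by (auto simp: field_simps)
  moreover have "l2_norm h = l2_norm (x' - z)"
  proof -
    have "h = (-1) \<cdot>\<^sub>v (x' - z)" unfolding h_def using zc x'D(1) by (intro eq_vecI) auto
    thus ?thesis using l2_norm_smult[of "x' - z" n "-1"] zc x'D(1) by simp
  qed
  ultimately show ?thesis by (simp add: v_def)
qed

text \<open>The sequence is projected forever, which is a legitimate execution since the values
  after termination are free.\<close>

lemma projected_power_iterations_exist: "\<exists>x. projected_power_iterations n A y x"
proof -
  define x where "x = rec_nat ((sqrt (real n) / l2_norm y) \<cdot>\<^sub>v y) (\<lambda>_ u. SOME v. v \<in> projections n (A *\<^sub>v u))"
  have "x (Suc k) \<in> projections n (A *\<^sub>v x k)" for k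
    using projections_nonempty[of n "A *\<^sub>v x k"] z by (auto simp: x_def some_in_eq)
  moreover have "x 0 = (sqrt (real n) / l2_norm y) \<cdot>\<^sub>v y" by (simp add: x_def)
  ultimately show ?thesis unfolding projected_power_iterations_def by blast
qed

text \<open>Distances to \<open>z\<close> contract up to termination. Without termination
  \<open>x K\<close> would be a label at distance below 2, that is \<open>z\<close>, and the next
  iterate would equal it; hence \<open>Suc K\<close> is the latest possible stop. An earlier stop
  also happens at \<open>z\<close>: a repeated iterate satisfies its own contraction inequality with
  a factor below 1.\<close>

lemma projected_power_iterations_converge:
  assumes run: "projected_power_iterations n A y x"
    and x0: "x 0 \<in> carrier_vec n" "ones n \<bullet> x 0 = 0" "x 0 \<bullet> x 0 = real n"
    and eta: "0 < \<eta>" "\<And>i. i < n \<Longrightarrow> \<eta> \<le> z $ i * (A *\<^sub>v z) $ i"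
    and near: "b * (l2_norm (x 0 - z))\<^sup>2 \<le> \<eta> * real n"
    and rho: "4 * e / \<eta> < 1"
    and K: "1 \<le> K" "(4 * e / \<eta>)^K * l2_norm (x 0 - z) < 2"
  shows "\<exists>k. terminates_at x k \<and> k \<le> Suc K \<and> x k = z"
proof -
  define \<rho> where "\<rho> = 4 * e / \<eta>"
  have rho0: "0 \<le> \<rho>" "\<rho> < 1" using e_nonneg eta rho by (auto simp: \<rho>_def)
  \<comment> \<open>The invariant asks for a centred vector of norm \<open>sqrt n\<close> rather
    than a label, so that the real vector \<open>x 0\<close> satisfies it.\<close>
  define Inv where "Inv = (\<lambda>k. x k \<in> carrier_vec n \<and> ones n \<bullet> x k = 0 \<and> x k \<bullet> x k = real n \<and>
     l2_norm (x k - z) \<le> \<rho>^k * l2_norm (x 0 - z))"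
  have near_k: "b * (l2_norm (x k - z))\<^sup>2 \<le> \<eta> * real n" if "Inv k" for k
  proof -
    have "\<rho>^k * l2_norm (x 0 - z) \<le> 1 * l2_norm (x 0 - z)"
      using rho0 by (intro mult_right_mono power_le_one) auto
    hence "(l2_norm (x k - z))\<^sup>2 \<le> (l2_norm (x 0 - z))\<^sup>2"
      using that by (intro power_mono) (auto simp: Inv_def)
    thus ?thesis using near mult_left_mono[OF _ b_nonneg] by (smt (verit))
  qed
  have bal: "x (Suc k) \<in> balanced_labels n" if "Inv k" "\<forall>j\<le>k. \<not> terminates_at x j" for k
    using projection_scalar_prod_le(1)[of "x (Suc k)" n "A *\<^sub>v x k" z] run that z
    by (auto simp: projected_power_iterations_def Inv_def)
  have step: "l2_norm (x (Suc k) - z) \<le> \<rho> * l2_norm (x k - z)" if "Inv k" "\<forall>j\<le>k. \<not> terminates_at x j" for k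
    unfolding \<rho>_def using run that eta near_k[OF that(1)]
    by (intro projected_power_step) (auto simp: projected_power_iterations_def Inv_def)
  have inv: "Inv k" if "\<And>j. j < k \<Longrightarrow> \<not> terminates_at x j" for k
    using that
  proof (induction k)
    case 0
    show ?case using x0 by (simp add: Inv_def)
  next
    case (Suc k)
    have I: "Inv k" using Suc by auto
    have nt: "\<forall>j\<le>k. \<not> terminates_at x j" using Suc.prems by auto
    have "l2_norm (x (Suc k) - z) \<le> \<rho> * (\<rho>^k * l2_norm (x 0 - z))"
      using step[OF I nt] I rho0(1) unfolding Inv_def by (meson mult_left_mono order_trans)
    thus ?case using balanced_labelsD[OF bal[OF I nt]] by (simp add: Inv_def)
  qed
  have "\<exists>k\<le>Suc K. terminates_at x k"
  proof (rule ccontr)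
    assume "\<not> (\<exists>k\<le>Suc K. terminates_at x k)"
    hence nt: "\<And>k. k \<le> Suc K \<Longrightarrow> \<not> terminates_at x k" by blast
    \<comment> \<open>Because \<open>K\<close> is positive, \<open>x K\<close> comes from a
      projection and is a label; \<open>x 0\<close> need not be one.\<close>
    obtain K' where K': "K = Suc K'" using K(1) by (cases K) auto
    have I: "Inv K'" "Inv K" using nt by (auto intro!: inv simp: K')
    have "x K \<in> balanced_labels n" using bal[OF I(1)] nt K' by auto
    moreover have "l2_norm (x K - z) < 2" using I(2) K(2) by (simp add: Inv_def \<rho>_def)
    ultimately have xK: "x K = z" using balanced_labels_diff(3) z by blast
    have "x (Suc K) \<in> balanced_labels n" using bal[OF I(2)] nt by auto
    moreover have "l2_norm (x (Suc K) - z) \<le> \<rho> * l2_norm (x K - z)" using step[OF I(2)] nt by auto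
    moreover have "l2_norm (x K - z) = 0" using xK zD(1) by (subst l2_norm_zero_iff[of _ n]) auto
    ultimately have xK': "x (Suc K) = z" using balanced_labels_diff(3)[of "x (Suc K)" n z] z by simp
    \<comment> \<open>The first repetition, since \<open>terminates_at\<close> excludes any earlier
      one.\<close>
    define k where "k = (LEAST k. 1 \<le> k \<and> x k = x (k - 1))"
    have k: "1 \<le> k \<and> x k = x (k - 1)" "k \<le> Suc K"
      unfolding k_def by (rule LeastI[of _ "Suc K"], use xK xK' in simp) (rule Least_le, use xK xK' in simp)
    have "terminates_at x k"
      unfolding terminates_at_def using k not_less_Least[of _ "\<lambda>k. 1 \<le> k \<and> x k = x (k - 1)"]
      unfolding k_def by blast
    thus False using nt k by auto
  qed
  then obtain k where k: "k \<le> Suc K" "terminates_at x k" by blast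
  have nt: "\<not> terminates_at x j" if "j < k" for j
    using k(2) that unfolding terminates_at_def by auto
  obtain k' where k': "k = Suc k'" using k(2) by (cases k) (auto simp: terminates_at_def)
  have I: "Inv k'" using nt by (intro inv) (auto simp: k')
  have eq: "x (Suc k') = x k'" using k(2) by (simp add: k' terminates_at_def)
  have "l2_norm (x k - z) \<le> \<rho> * l2_norm (x k - z)" using step[OF I] nt eq by (auto simp: k')
  hence "(1 - \<rho>) * l2_norm (x k - z) \<le> 0" by (simp add: algebra_simps)
  hence "l2_norm (x k - z) = 0"
    using rho0(2) l2_norm_nonneg[of "x k - z"] by (simp add: mult_le_0_iff)
  moreover have "x k \<in> balanced_labels n" using bal[OF I] nt by (auto simp: k')
  ultimately have "x k = z" using balanced_labels_diff(3) z by force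
  thus ?thesis using k by blast
qed

end

section \<open>Powers of a noisy block matrix\<close>

text \<open>Ratios of consecutive terms of a log-convex sequence increase, so a last ratio of at
  most \<open>r\<close> bounds all earlier ones. The lemma is used in contrapositive form. Products
  instead of quotients admit vanishing terms.\<close>

lemma log_convex_last_ratio:
  fixes f :: "nat \<Rightarrow> real"
  assumes nonneg: "\<And>k. 0 \<le> f k" and conv: "\<And>k. (f (Suc k))\<^sup>2 \<le> f k * f (Suc (Suc k))"
    and r: "0 \<le> r" and step: "f (Suc m) \<le> r * f m"
  shows "f (Suc m) \<le> r ^ Suc m * f 0"
proof -
  have ratio: "f (Suc k) \<le> r * f k" if "k \<le> m" for k
    using that
  proof (induction rule: inc_induct)
    case base
    show ?case by (rule step)
  next
    case (step k)
    have "f (Suc k) * f (Suc k) \<le> f k * f (Suc (Suc k))" using conv[of k] by (simp add: power2_eq_square)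
    also have "\<dots> \<le> f k * (r * f (Suc k))" by (intro mult_left_mono step nonneg)
    finally have "f (Suc k) * f (Suc k) \<le> (r * f k) * f (Suc k)" by (simp add: mult_ac)
    hence "f (Suc k) = 0 \<or> f (Suc k) \<le> r * f k"
      using nonneg[of "Suc k"] by (metis less_eq_real_def mult_le_cancel_right_pos)
    thus ?case using r nonneg[of k] by auto
  qed
  have "f (Suc k) \<le> r ^ Suc k * f 0" if "k \<le> m" for k
    using that
  proof (induction k)
    case 0
    thus ?case using ratio[of 0] by simp
  next
    case (Suc k)
    have "f (Suc (Suc k)) \<le> r * f (Suc k)" using ratio Suc.prems by blast
    also have "\<dots> \<le> r * (r ^ Suc k * f 0)" using Suc r by (intro mult_left_mono) auto
    finally show ?case by simp
  qed
  thus ?thesis by blast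
qed

text \<open>The mirror image: the first ratio is the smallest one, so a lower bound on it propagates
  forward.\<close>

lemma log_convex_lower:
  fixes f :: "nat \<Rightarrow> real"
  assumes nonneg: "\<And>k. 0 \<le> f k" and conv: "\<And>k. (f (Suc k))\<^sup>2 \<le> f k * f (Suc (Suc k))"
    and r: "0 < r" and start: "r * f 0 \<le> f (Suc 0)"
  shows "r ^ k * f 0 \<le> f k"
proof (cases "f 0 = 0")
  case False
  hence f0: "f 0 > 0" using nonneg[of 0] by simp
  have "0 < f k \<and> r * f k \<le> f (Suc k)" for k
  proof (induction k)
    case 0
    show ?case using f0 start by simp
  next
    case (Suc k)
    have p: "0 < f (Suc k)" using Suc r by (meson mult_pos_pos less_le_trans)
    have "f k * (r * f (Suc k)) = (r * f k) * f (Suc k)" by simp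
    also have "\<dots> \<le> f (Suc k) * f (Suc k)" using Suc p by (intro mult_right_mono) auto
    also have "\<dots> \<le> f k * f (Suc (Suc k))" using conv[of k] by (simp add: power2_eq_square)
    finally show ?case using p Suc by simp
  qed
  note ratio = this
  show ?thesis
  proof (induction k)
    case (Suc k)
    have "r * (r ^ k * f 0) \<le> r * f k" using Suc r by (intro mult_left_mono) auto
    also have "\<dots> \<le> f (Suc k)" using ratio by blast
    finally show ?case by simp
  qed simp
qed (simp add: nonneg)

context block_matrix
begin

abbreviation Apow :: "nat \<Rightarrow> real vec \<Rightarrow> real vec" where
  "Apow k \<equiv> ((*\<^sub>v) A) ^^ k"

lemma Apow_carrier [simp]: "x \<in> carrier_vec n \<Longrightarrow> Apow k x \<in> carrier_vec n"
  by (induction k) auto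

lemma A_adjoint:
  assumes "x \<in> carrier_vec n" "y \<in> carrier_vec n"
  shows "(A *\<^sub>v x) \<bullet> y = x \<bullet> (A *\<^sub>v y)"
proof -
  have "x \<bullet> (A *\<^sub>v y) = (transpose_mat A *\<^sub>v x) \<bullet> y"
    using assoc_scalar_prod[OF _ A assms(2)] assms
    by (metis A transpose_vec_mult_scalar)
  thus ?thesis by (simp add: sym)
qed

lemma Apow_adjoint:
  assumes "x \<in> carrier_vec n" "y \<in> carrier_vec n"
  shows "Apow k x \<bullet> y = x \<bullet> Apow k y"
  using assms
proof (induction k arbitrary: y)
  case (Suc k)
  have "Apow (Suc k) x \<bullet> y = Apow k x \<bullet> (A *\<^sub>v y)" using Suc.prems by (simp add: A_adjoint)
  also have "\<dots> = x \<bullet> Apow (Suc k) y" using Suc by (simp add: funpow_swap1)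
  finally show ?case .
qed simp

lemma Apow_lincomb:
  assumes "x \<in> carrier_vec n" "y \<in> carrier_vec n"
  shows "Apow k (c \<cdot>\<^sub>v x + d \<cdot>\<^sub>v y) = c \<cdot>\<^sub>v Apow k x + d \<cdot>\<^sub>v Apow k y"
proof (induction k)
  case (Suc k)
  have c: "c \<cdot>\<^sub>v Apow k x \<in> carrier_vec n" "d \<cdot>\<^sub>v Apow k y \<in> carrier_vec n" using assms by auto
  show ?case
    using Suc assms by (simp add: mult_add_distrib_mat_vec[OF A c] mult_mat_vec[OF A])
qed simp

text \<open>Symmetry moves one factor \<open>A\<close> to the other side of the scalar product; the
  rest is the Cauchy-Schwarz inequality.\<close>

lemma Apow_log_convex:
  assumes x: "x \<in> carrier_vec n"
  shows "(l2_norm (Apow (Suc k) x))\<^sup>2 \<le> l2_norm (Apow k x) * l2_norm (Apow (Suc (Suc k)) x)"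
proof -
  have "(l2_norm (Apow (Suc k) x))\<^sup>2 = Apow k x \<bullet> Apow (Suc (Suc k)) x"
    using x by (simp add: l2_norm_sq A_adjoint)
  also have "\<dots> \<le> l2_norm (Apow k x) * l2_norm (Apow (Suc (Suc k)) x)"
    using abs_scalar_prod_le[of "Apow k x" n "Apow (Suc (Suc k)) x"] x by auto
  finally show ?thesis .
qed

lemma l2_norm_ones: "l2_norm (ones n) = sqrt (real n)"
  and l2_norm_z: "l2_norm z = sqrt (real n)"
  by (simp_all add: l2_norm_def zD)

lemma A_norm_le:
  assumes x: "x \<in> carrier_vec n"
  shows "l2_norm (A *\<^sub>v x) \<le> (a + b + e) * l2_norm x"
proof -
  define y where "y = A *\<^sub>v x"
  have y: "y \<in> carrier_vec n" using x by (simp add: y_def)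
  have o: "\<bar>ones n \<bullet> u\<bar> \<le> sqrt (real n) * l2_norm u" "\<bar>z \<bullet> u\<bar> \<le> sqrt (real n) * l2_norm u"
    if "u \<in> carrier_vec n" for u
    using abs_scalar_prod_le[OF _ that] zD(1) l2_norm_ones l2_norm_z by (metis ones_carrier)+
  have t: "c / real n * (p * q) \<le> c * (l2_norm x * l2_norm y)"
    if "0 \<le> c" "\<bar>p\<bar> \<le> sqrt (real n) * l2_norm x" "\<bar>q\<bar> \<le> sqrt (real n) * l2_norm y" for c p q
  proof -
    have "p * q \<le> \<bar>p\<bar> * \<bar>q\<bar>" by (simp add: abs_mult[symmetric])
    also have "\<dots> \<le> (sqrt (real n) * l2_norm x) * (sqrt (real n) * l2_norm y)"
      using that by (intro mult_mono) auto
    also have "\<dots> = real n * (l2_norm x * l2_norm y)" by simp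
    finally have "c / real n * (p * q) \<le> c / real n * (real n * (l2_norm x * l2_norm y))"
      using that(1) by (intro mult_left_mono) auto
    thus ?thesis using n_pos by simp
  qed
  have "y \<bullet> y \<le> e * (l2_norm x * l2_norm y) + a / real n * ((ones n \<bullet> x) * (ones n \<bullet> y)) + b / real n * ((z \<bullet> x) * (z \<bullet> y))"
    using approx[OF x y] by (simp add: y_def)
  also have "\<dots> \<le> e * (l2_norm x * l2_norm y) + a * (l2_norm x * l2_norm y) + b * (l2_norm x * l2_norm y)"
    using b_nonneg b_le_a by (intro add_mono t o x y) auto
  finally have "l2_norm y * l2_norm y \<le> ((a + b + e) * l2_norm x) * l2_norm y"
    by (simp add: l2_norm_sq[symmetric] power2_eq_square algebra_simps)
  thus ?thesis using b_nonneg b_le_a e_nonneg l2_norm_nonneg[of y] unfolding y_def[symmetric]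
    by (cases "l2_norm y = 0") (auto simp: less_le)
qed

lemma Apow_norm_le:
  assumes x: "x \<in> carrier_vec n"
  shows "l2_norm (Apow k x) \<le> (a + b + e) ^ k * l2_norm x"
proof (induction k)
  case (Suc k)
  have "l2_norm (Apow (Suc k) x) \<le> (a + b + e) * l2_norm (Apow k x)" using x A_norm_le by simp
  also have "\<dots> \<le> (a + b + e) * ((a + b + e) ^ k * l2_norm x)"
    using Suc b_nonneg b_le_a e_nonneg by (intro mult_left_mono) auto
  finally show ?case by simp
qed simp

text \<open>The span of \<open>ones n\<close> and \<open>z\<close> is only approximately invariant
  under \<open>A\<close>, so a bound on it cannot be iterated. It is used for the first step alone,
  where \<open>u \<bullet> A u\<close> is at least \<open>(b - e) * |u|^2\<close>, and log-convexity
  carries it to all powers.\<close>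

lemma Apow_signal_lower:
  assumes "e < b"
  shows "(b - e) ^ (2 * k) * (real n * (c\<^sup>2 + d\<^sup>2)) \<le> (l2_norm (Apow k (c \<cdot>\<^sub>v ones n + d \<cdot>\<^sub>v z)))\<^sup>2"
proof -
  define u where "u = c \<cdot>\<^sub>v ones n + d \<cdot>\<^sub>v z"
  have u: "u \<in> carrier_vec n" using zD(1) by (simp add: u_def)
  have ou: "ones n \<bullet> u = c * real n" "z \<bullet> u = d * real n"
    using zD by (simp_all add: u_def scalar_prod_add_distrib[of _ n])
  have uu: "(l2_norm u)\<^sup>2 = real n * (c\<^sup>2 + d\<^sup>2)"
  proof -
    have "u \<bullet> u = c * (ones n \<bullet> u) + d * (z \<bullet> u)"
      using zD(1) u by (subst (1) u_def) (simp add: add_scalar_prod_distrib[of _ n])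
    thus ?thesis unfolding ou l2_norm_sq by (simp add: power2_eq_square algebra_simps)
  qed
  have "(b - e) * (l2_norm u)\<^sup>2 = b / real n * ((c * real n)\<^sup>2 + (d * real n)\<^sup>2) - e * (l2_norm u * l2_norm u)"
    using n_pos unfolding left_diff_distrib uu power2_eq_square[of "l2_norm u", symmetric] by (simp add: power2_eq_square algebra_simps)
  also have "\<dots> \<le> a / real n * (c * real n)\<^sup>2 + b / real n * (d * real n)\<^sup>2 - e * (l2_norm u * l2_norm u)"
    using b_le_a n_pos by (simp add: distrib_left divide_right_mono mult_right_mono)
  also have "\<dots> \<le> u \<bullet> (A *\<^sub>v u)" using approx[OF u u] unfolding ou by (simp add: power2_eq_square)
  also have "\<dots> \<le> l2_norm u * l2_norm (A *\<^sub>v u)"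
    using abs_scalar_prod_le[OF u A_carrier[OF u]] by auto
  finally have "l2_norm u * ((b - e) * l2_norm u) \<le> l2_norm u * l2_norm (A *\<^sub>v u)"
    by (simp add: power2_eq_square mult_ac)
  hence s: "(b - e) * l2_norm u \<le> l2_norm (A *\<^sub>v u)"
    using l2_norm_nonneg[of u] by (cases "l2_norm u = 0") (auto simp: less_le)
  have "(b - e) ^ k * l2_norm (Apow 0 u) \<le> l2_norm (Apow k u)"
    by (rule log_convex_lower) (use Apow_log_convex[OF u] s assms in auto)
  hence "((b - e) ^ k * l2_norm u)\<^sup>2 \<le> (l2_norm (Apow k u))\<^sup>2"
    using assms by (intro power_mono) auto
  thus ?thesis by (simp add: power_mult_distrib uu u_def[symmetric] power_mult[symmetric] mult.commute)
qed

text \<open>The 2 by 2 minor of rows \<open>i\<close> and \<open>j\<close> of the matrix with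
  columns \<open>Apow k (ones n)\<close> and \<open>Apow k z\<close>. These minors are the
  coefficients of the determinant as a bilinear form in the two columns of the start.\<close>

definition minor :: "nat \<Rightarrow> nat \<Rightarrow> nat \<Rightarrow> real" where
  "minor k i j = Apow k (ones n) $ i * Apow k z $ j - Apow k z $ i * Apow k (ones n) $ j"

text \<open>By Lagrange's identity the squared minors sum to twice the Gram determinant of the two
  columns. With \<open>m = (b - e) ^ (2 * k)\<close>, the quadratic form of the Gram matrix is at
  least \<open>m * n\<close> times the squared length of the coefficient vector, so the determinant
  is at least \<open>(m * n)^2\<close>, and one of the \<open>n^2\<close> minors has absolute value
  at least \<open>m\<close>.\<close>

lemma minor_large:
  assumes "e < b"
  shows "\<exists>i<n. \<exists>j<n. (b - e) ^ (2 * k) \<le> \<bar>minor k i j\<bar>"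
proof (rule ccontr)
  assume "\<not> ?thesis"
  hence small: "\<bar>minor k i j\<bar> < (b - e) ^ (2 * k)" if "i < n" "j < n" for i j using that by force
  define p q where "p = Apow k (ones n)" and "q = Apow k z"
  have pq: "p \<in> carrier_vec n" "q \<in> carrier_vec n" using zD(1) by (auto simp: p_def q_def)
  define m where "m = (b - e) ^ (2 * k)"
  have m0: "m > 0" using assms by (simp add: m_def)
  have low: "m * (real n * (c\<^sup>2 + d\<^sup>2)) \<le> c\<^sup>2 * (p \<bullet> p) + 2 * c * d * (p \<bullet> q) + d\<^sup>2 * (q \<bullet> q)" for c d
  proof -
    have "(l2_norm (Apow k (c \<cdot>\<^sub>v ones n + d \<cdot>\<^sub>v z)))\<^sup>2 = c\<^sup>2 * (p \<bullet> p) + 2 * c * d * (p \<bullet> q) + d\<^sup>2 * (q \<bullet> q)"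
      unfolding l2_norm_sq Apow_lincomb[OF ones_carrier zD(1)] p_def[symmetric] q_def[symmetric]
      using pq comm_scalar_prod[of q n p]
      by (simp add: scalar_prod_add_distrib[of _ n] add_scalar_prod_distrib[of _ n] power2_eq_square algebra_simps)
    thus ?thesis using Apow_signal_lower[OF assms, of k c d] by (simp add: m_def)
  qed
  have pp: "m * real n \<le> p \<bullet> p" using low[of 1 0] by simp
  define g where "g = (p \<bullet> p) * (q \<bullet> q) - (p \<bullet> q)\<^sup>2"
  \<comment> \<open>At these coefficients the quadratic form equals
    \<open>(p \<bullet> p) * g\<close>, the Gram determinant up to a positive factor.\<close>
  have "m * (real n * ((p \<bullet> q)\<^sup>2 + (p \<bullet> p)\<^sup>2)) \<le> (p \<bullet> p) * g"
    using low[of "- (p \<bullet> q)" "p \<bullet> p"] by (simp add: g_def power2_eq_square algebra_simps)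
  moreover have "m * (real n * (p \<bullet> p)\<^sup>2) \<le> m * (real n * ((p \<bullet> q)\<^sup>2 + (p \<bullet> p)\<^sup>2))"
    using m0 by (intro mult_left_mono) auto
  ultimately have "(p \<bullet> p) * (m * real n * (p \<bullet> p)) \<le> (p \<bullet> p) * g"
    by (simp add: power2_eq_square mult_ac)
  moreover have ppos: "p \<bullet> p > 0" using pp m0 n_pos by (smt (verit) mult_pos_pos of_nat_0_less_iff)
  ultimately have "m * real n * (p \<bullet> p) \<le> g" by simp
  moreover have "m * real n * (m * real n) \<le> m * real n * (p \<bullet> p)"
    using m0 by (intro mult_left_mono pp) auto
  ultimately have g: "m * real n * (m * real n) \<le> g" by linarith
  have "(\<Sum>i\<in>{0..<n}. \<Sum>j\<in>{0..<n}. (minor k i j)\<^sup>2)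
      = (\<Sum>i\<in>{0..<n}. \<Sum>j\<in>{0..<n}. (p$i*p$i) * (q$j*q$j) + (q$i*q$i) * (p$j*p$j) - 2 * ((p$i*q$i) * (p$j*q$j)))"
    unfolding minor_def p_def[symmetric] q_def[symmetric]
    by (intro sum.cong refl) (simp add: power2_eq_square algebra_simps)
  also have "\<dots> = 2 * g"
    unfolding g_def using pq
    by (simp add: scalar_prod_def sum.distrib sum_subtractf sum_distrib_right[symmetric] sum_distrib_left[symmetric] power2_eq_square)
  finally have eq: "(\<Sum>i\<in>{0..<n}. \<Sum>j\<in>{0..<n}. (minor k i j)\<^sup>2) = 2 * g" .
  have "(\<Sum>i\<in>{0..<n}. \<Sum>j\<in>{0..<n}. (minor k i j)\<^sup>2) \<le> (\<Sum>i\<in>{0..<n}. \<Sum>j\<in>{0..<n}. m\<^sup>2)"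
    using small m0 by (intro sum_mono) (auto intro!: abs_le_square_iff[THEN iffD1] simp: m_def less_imp_le)
  also have "\<dots> = m * real n * (m * real n)" by (simp add: power2_eq_square)
  finally have "g > 0 \<Longrightarrow> False" using eq g by linarith
  moreover have "g > 0" using g m0 n_pos by (smt (verit) mult_pos_pos of_nat_0_less_iff)
  ultimately show False by blast
qed

text \<open>The component orthogonal to \<open>ones n\<close> and \<open>z\<close>; dividing by
  \<open>n\<close> normalises, since these two vectors are orthogonal and have squared norm
  \<open>n\<close>.\<close>

definition res :: "real vec \<Rightarrow> real vec" where
  "res w = w - ((ones n \<bullet> w) / real n) \<cdot>\<^sub>v ones n - ((z \<bullet> w) / real n) \<cdot>\<^sub>v z"

lemma res_props:
  assumes "w \<in> carrier_vec n" "w' \<in> carrier_vec n"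
  shows "res w \<in> carrier_vec n" "ones n \<bullet> res w = 0" "z \<bullet> res w = 0" "res w \<bullet> w' = res w \<bullet> res w'"
    and "res w \<bullet> res w' = w \<bullet> w' - (ones n \<bullet> w) * (ones n \<bullet> w') / real n - (z \<bullet> w) * (z \<bullet> w') / real n"
proof -
  have c: "res w \<in> carrier_vec n" if "w \<in> carrier_vec n" for w using that zD(1) by (simp add: res_def)
  have o: "ones n \<bullet> res w = 0" if "w \<in> carrier_vec n" for w
    using that zD n_pos by (simp add: res_def scalar_prod_minus_distrib[of _ n])
  have zr: "z \<bullet> res w = 0" if "w \<in> carrier_vec n" for w
    using that zD n_pos by (simp add: res_def scalar_prod_minus_distrib[of _ n])
  note o' = o[OF assms(1)] zr[OF assms(1)]
  show "res w \<in> carrier_vec n" "ones n \<bullet> res w = 0" "z \<bullet> res w = 0" using c o' assms(1) by auto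
  have o'': "res w \<bullet> ones n = 0" "res w \<bullet> z = 0"
    using o' comm_scalar_prod[OF c[OF assms(1)]] zD(1) by (metis ones_carrier)+
  have "res w \<bullet> res w' = res w \<bullet> w'"
    using assms zD(1) o'' c[OF assms(1)]
    by (subst (2) res_def) (simp add: scalar_prod_minus_distrib[of _ n] scalar_prod_smult_distrib[of _ n])
  thus e: "res w \<bullet> w' = res w \<bullet> res w'" by simp
  have "res w \<bullet> w' = w \<bullet> w' - (ones n \<bullet> w) * (ones n \<bullet> w') / real n - (z \<bullet> w) * (z \<bullet> w') / real n"
    using assms zD(1) by (simp add: res_def minus_scalar_prod_distrib[of _ n])
  thus "res w \<bullet> res w' = w \<bullet> w' - (ones n \<bullet> w) * (ones n \<bullet> w') / real n - (z \<bullet> w) * (z \<bullet> w') / real n"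
    using e by simp
qed

text \<open>Log-convexity shows that the last application of \<open>A\<close> stretches
  \<open>u = Apow (N - 1) w\<close> by at least \<open>r\<close>. The residual of \<open>A u\<close>
  comes from the noise alone and is at most \<open>e * |u|\<close>, hence the quotient
  \<open>e / r\<close>.\<close>

lemma Apow_close:
  assumes w: "w \<in> carrier_vec n" and r: "0 < r" and N: "0 < N"
    and large: "r ^ N * l2_norm w < l2_norm (Apow N w)"
  shows "l2_norm (res (Apow N w)) \<le> e / r * l2_norm (Apow N w)"
proof -
  obtain m where m: "N = Suc m" using N by (cases N) auto
  define u where "u = Apow m w"
  have u: "u \<in> carrier_vec n" using w by (simp add: u_def)
  have Au: "Apow N w = A *\<^sub>v u" by (simp add: m u_def)
  have "\<not> l2_norm (Apow (Suc m) w) \<le> r * l2_norm (Apow m w)"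
    using log_convex_last_ratio[of "\<lambda>k. l2_norm (Apow k w)" r m] Apow_log_convex[OF w] r large
    by (auto simp: m)
  hence ru: "r * l2_norm u \<le> l2_norm (A *\<^sub>v u)" by (simp add: u_def)
  define v where "v = res (A *\<^sub>v u)"
  have v: "v \<in> carrier_vec n" "ones n \<bullet> v = 0" "z \<bullet> v = 0" "v \<bullet> (A *\<^sub>v u) = v \<bullet> v"
    using res_props[of "A *\<^sub>v u" "A *\<^sub>v u"] u by (auto simp: v_def)
  have "v \<bullet> v \<le> e * (l2_norm u * l2_norm v)" using approx[OF u v(1)] v by simp
  hence "l2_norm v * l2_norm v \<le> l2_norm v * (e * l2_norm u)"
    by (simp add: l2_norm_sq[symmetric] power2_eq_square mult_ac)
  hence "l2_norm v \<le> e * l2_norm u"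
    using l2_norm_nonneg[of v] e_nonneg by (cases "l2_norm v = 0") (auto simp: less_le)
  also have "\<dots> \<le> e * (l2_norm (A *\<^sub>v u) / r)"
    using ru r e_nonneg by (intro mult_left_mono) (auto simp: field_simps)
  finally show ?thesis unfolding Au v_def by simp
qed

text \<open>Cramer's rule. With \<open>p\<close> and \<open>q\<close> the images of
  \<open>ones n\<close> and \<open>z\<close>, the numbers \<open>p \<bullet> w\<close> and
  \<open>q \<bullet> w\<close> are linear in \<open>c0\<close> and \<open>c1\<close> with
  determinant \<open>D\<close>, and by symmetry of \<open>A\<close> they are at most
  \<open>sqrt n * |Apow k w|\<close>. A large \<open>D\<close> therefore excludes a combination with
  large coefficients and a small image. The powers of \<open>n\<close> are crude.\<close>

lemma Apow_gaussian_lower: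
  fixes c0 c1 :: real
  assumes y: "y0 \<in> carrier_vec n" "y1 \<in> carrier_vec n"
    and bound: "\<And>i. i < n \<Longrightarrow> \<bar>y0 $ i\<bar> \<le> real n" "\<And>i. i < n \<Longrightarrow> \<bar>y1 $ i\<bar> \<le> real n"
    and \<theta>: "0 \<le> \<theta>" "\<theta> \<le> \<bar>\<Sum>i<n. \<Sum>j<n. y0 $ i * y1 $ j * minor k i j\<bar>"
  defines "w \<equiv> c0 \<cdot>\<^sub>v y0 + c1 \<cdot>\<^sub>v y1"
  defines "\<Lambda> \<equiv> a + b + e"
  shows "\<theta> * \<bar>c0\<bar> \<le> 2 * real n ^ 3 * \<Lambda> ^ k * l2_norm (Apow k w)"
    and "\<theta> * \<bar>c1\<bar> \<le> 2 * real n ^ 3 * \<Lambda> ^ k * l2_norm (Apow k w)"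
    and "\<theta> * l2_norm w \<le> 4 * real n ^ 5 * \<Lambda> ^ k * l2_norm (Apow k w)"
proof -
  define p q where "p = Apow k (ones n)" and "q = Apow k z"
  have pq: "p \<in> carrier_vec n" "q \<in> carrier_vec n" using zD(1) by (auto simp: p_def q_def)
  have w: "w \<in> carrier_vec n" using y by (simp add: w_def)
  have L0: "\<Lambda> \<ge> 0" using b_nonneg b_le_a e_nonneg by (simp add: \<Lambda>_def)
  have n1: "real n \<ge> 1" using n_pos by simp
  have ny: "l2_norm v \<le> real n * sqrt (real n)" if "v \<in> carrier_vec n" "\<And>i. i < n \<Longrightarrow> \<bar>v $ i\<bar> \<le> real n" for v
  proof -
    have "v \<bullet> v = (\<Sum>i\<in>{0..<n}. (v $ i)\<^sup>2)"
      using that(1) by (simp add: scalar_prod_def power2_eq_square)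
    also have "\<dots> \<le> (\<Sum>i\<in>{0..<n}. (real n)\<^sup>2)"
      using that(2) by (intro sum_mono) (auto intro!: abs_le_square_iff[THEN iffD1])
    also have "\<dots> = (real n * sqrt (real n))\<^sup>2" by (simp add: power_mult_distrib)
    finally show ?thesis unfolding l2_norm_def by (metis abs_of_nonneg real_sqrt_abs real_sqrt_le_mono of_nat_0_le_iff real_sqrt_ge_zero mult_nonneg_nonneg)
  qed
  note ny0 = ny[OF y(1) bound(1)] and ny1 = ny[OF y(2) bound(2)]
  have np: "l2_norm p \<le> \<Lambda> ^ k * sqrt (real n)" "l2_norm q \<le> \<Lambda> ^ k * sqrt (real n)"
    using Apow_norm_le[of "ones n" k] Apow_norm_le[of z k] zD(1) l2_norm_ones l2_norm_z
    by (auto simp: p_def q_def \<Lambda>_def)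
  define f where "f = l2_norm (Apow k w)"
  have f0: "f \<ge> 0" by (simp add: f_def)
  have pw: "\<bar>p \<bullet> w\<bar> \<le> sqrt (real n) * f" "\<bar>q \<bullet> w\<bar> \<le> sqrt (real n) * f"
    using abs_scalar_prod_le[of "ones n" n "Apow k w"] abs_scalar_prod_le[of z n "Apow k w"] w zD(1)
      Apow_adjoint[of "ones n" w k] Apow_adjoint[of z w k] l2_norm_ones l2_norm_z
    by (auto simp: p_def q_def f_def)
  have ip: "\<bar>u \<bullet> v\<bar> \<le> \<Lambda> ^ k * (real n)\<^sup>2"
    if "u \<in> carrier_vec n" "v \<in> carrier_vec n" "l2_norm u \<le> \<Lambda> ^ k * sqrt (real n)" "l2_norm v \<le> real n * sqrt (real n)" for u v
  proof -
    have "\<bar>u \<bullet> v\<bar> \<le> l2_norm u * l2_norm v" by (rule abs_scalar_prod_le[OF that(1,2)])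
    also have "\<dots> \<le> (\<Lambda> ^ k * sqrt (real n)) * (real n * sqrt (real n))"
      using that L0 by (intro mult_mono) auto
    also have "\<dots> = \<Lambda> ^ k * (real n)\<^sup>2" by (simp add: power2_eq_square)
    finally show ?thesis .
  qed
  define D where "D = (p \<bullet> y0) * (q \<bullet> y1) - (q \<bullet> y0) * (p \<bullet> y1)"
  have "(\<Sum>i<n. \<Sum>j<n. y0 $ i * y1 $ j * minor k i j)
     = (\<Sum>i<n. \<Sum>j<n. (p $ i * y0 $ i) * (q $ j * y1 $ j) - (q $ i * y0 $ i) * (p $ j * y1 $ j))"
    unfolding minor_def p_def[symmetric] q_def[symmetric]
    by (intro sum.cong refl) (simp add: algebra_simps)
  also have "\<dots> = D"
    unfolding D_def using y by (simp add: scalar_prod_def sum_subtractf sum_product[symmetric] atLeast0LessThan)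
  finally have \<theta>D: "\<theta> \<le> \<bar>D\<bar>" using \<theta>(2) by simp
  have e1: "p \<bullet> w = c0 * (p \<bullet> y0) + c1 * (p \<bullet> y1)" "q \<bullet> w = c0 * (q \<bullet> y0) + c1 * (q \<bullet> y1)"
    using pq y by (simp_all add: w_def scalar_prod_add_distrib[of _ n])
  have D0: "D * c0 = (p \<bullet> w) * (q \<bullet> y1) - (q \<bullet> w) * (p \<bullet> y1)"
   and D1: "D * c1 = (q \<bullet> w) * (p \<bullet> y0) - (p \<bullet> w) * (q \<bullet> y0)"
    unfolding e1 D_def by (simp_all add: algebra_simps)
  have prod: "\<bar>s * t\<bar> \<le> real n ^ 3 * \<Lambda> ^ k * f" if "\<bar>s\<bar> \<le> sqrt (real n) * f" "\<bar>t\<bar> \<le> \<Lambda> ^ k * (real n)\<^sup>2" for s t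
  proof -
    have "\<bar>s * t\<bar> \<le> (sqrt (real n) * f) * (\<Lambda> ^ k * (real n)\<^sup>2)"
      unfolding abs_mult using that f0 by (intro mult_mono) auto
    also have "\<dots> \<le> (real n * f) * (\<Lambda> ^ k * (real n)\<^sup>2)"
      using L0 f0 n1 sqrt_le_D[of "real n" "real n"] by (intro mult_right_mono) (auto intro!: real_le_lsqrt simp: power2_eq_square)
    also have "\<dots> = real n ^ 3 * \<Lambda> ^ k * f" by (simp add: power2_eq_square power3_eq_cube)
    finally show ?thesis .
  qed
  have c: "\<theta> * \<bar>c0\<bar> \<le> 2 * real n ^ 3 * \<Lambda> ^ k * f" "\<theta> * \<bar>c1\<bar> \<le> 2 * real n ^ 3 * \<Lambda> ^ k * f"
  proof -
    have "\<theta> * \<bar>c0\<bar> \<le> \<bar>D * c0\<bar>" using \<theta>D by (simp add: abs_mult mult_right_mono)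
    also have "\<dots> \<le> \<bar>(p \<bullet> w) * (q \<bullet> y1)\<bar> + \<bar>(q \<bullet> w) * (p \<bullet> y1)\<bar>" unfolding D0 by (rule abs_triangle_ineq4)
    also have "\<dots> \<le> real n ^ 3 * \<Lambda> ^ k * f + real n ^ 3 * \<Lambda> ^ k * f"
      by (intro add_mono prod pw ip pq y np ny1)
    finally show "\<theta> * \<bar>c0\<bar> \<le> 2 * real n ^ 3 * \<Lambda> ^ k * f" by (simp add: mult_ac)
    have "\<theta> * \<bar>c1\<bar> \<le> \<bar>D * c1\<bar>" using \<theta>D by (simp add: abs_mult mult_right_mono)
    also have "\<dots> \<le> \<bar>(q \<bullet> w) * (p \<bullet> y0)\<bar> + \<bar>(p \<bullet> w) * (q \<bullet> y0)\<bar>" unfolding D1 by (rule abs_triangle_ineq4)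
    also have "\<dots> \<le> real n ^ 3 * \<Lambda> ^ k * f + real n ^ 3 * \<Lambda> ^ k * f"
      by (intro add_mono prod pw ip pq y np ny0)
    finally show "\<theta> * \<bar>c1\<bar> \<le> 2 * real n ^ 3 * \<Lambda> ^ k * f" by (simp add: mult_ac)
  qed
  thus "\<theta> * \<bar>c0\<bar> \<le> 2 * real n ^ 3 * \<Lambda> ^ k * l2_norm (Apow k w)"
    "\<theta> * \<bar>c1\<bar> \<le> 2 * real n ^ 3 * \<Lambda> ^ k * l2_norm (Apow k w)" by (simp_all add: f_def)
  have sq: "sqrt (real n) \<le> real n" using n1 by (auto intro!: real_le_lsqrt simp: power2_eq_square)
  have yn: "l2_norm y0 \<le> (real n)\<^sup>2" "l2_norm y1 \<le> (real n)\<^sup>2"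
    using ny0 ny1 mult_left_mono[OF sq, of "real n"] by (auto simp: power2_eq_square)
  have "l2_norm w \<le> \<bar>c0\<bar> * l2_norm y0 + \<bar>c1\<bar> * l2_norm y1"
    unfolding w_def using l2_norm_triangle[of "c0 \<cdot>\<^sub>v y0" n "c1 \<cdot>\<^sub>v y1"] y l2_norm_smult by auto
  also have "\<dots> \<le> \<bar>c0\<bar> * (real n)\<^sup>2 + \<bar>c1\<bar> * (real n)\<^sup>2" using yn by (intro add_mono mult_left_mono) auto
  finally have "\<theta> * l2_norm w \<le> \<theta> * (\<bar>c0\<bar> * (real n)\<^sup>2 + \<bar>c1\<bar> * (real n)\<^sup>2)"
    using \<theta>(1) by (intro mult_left_mono)
  also have "\<dots> = (\<theta> * \<bar>c0\<bar>) * (real n)\<^sup>2 + (\<theta> * \<bar>c1\<bar>) * (real n)\<^sup>2" by (simp add: algebra_simps)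
  also have "\<dots> \<le> (2 * real n ^ 3 * \<Lambda> ^ k * f) * (real n)\<^sup>2 + (2 * real n ^ 3 * \<Lambda> ^ k * f) * (real n)\<^sup>2"
    by (intro add_mono mult_right_mono c) auto
  also have "\<dots> = 4 * real n ^ 5 * \<Lambda> ^ k * f" by (simp add: power2_eq_square power3_eq_cube eval_nat_numeral)
  finally show "\<theta> * l2_norm w \<le> 4 * real n ^ 5 * \<Lambda> ^ k * l2_norm (Apow k w)" by (simp add: f_def)
qed

end

section \<open>Decompositions with two columns\<close>

lemma less_two_cases: "i < (2::nat) \<Longrightarrow> i = 0 \<or> i = 1" by auto

lemma sum_upto_two: "(\<Sum>k\<in>{0..<2::nat}. f k) = f 0 + (f 1 :: real)"
  by (simp add: numeral_2_eq_2)

lemma mult_mat_two_vec: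
  fixes B :: "real mat"
  assumes "B \<in> carrier_mat n 2" "c \<in> carrier_vec 2"
  shows "B *\<^sub>v c = (c $ 0) \<cdot>\<^sub>v col B 0 + (c $ 1) \<cdot>\<^sub>v col B 1"
  using assms by (intro eq_vecI) (auto simp: scalar_prod_def sum_upto_two mult.commute)

lemma index_mult_mat_two:
  fixes X Y :: "real mat"
  assumes "X \<in> carrier_mat n 2" "Y \<in> carrier_mat 2 m" "i < n" "j < m"
  shows "(X * Y) $$ (i, j) = X $$ (i, 0) * Y $$ (0, j) + X $$ (i, 1) * Y $$ (1, j)"
  using assms by (simp add: scalar_prod_def sum_upto_two)

lemma orthonormal_columns_two:
  fixes Q :: "real mat"
  assumes "Q \<in> carrier_mat n 2" "col Q 0 \<bullet> col Q 0 = 1" "col Q 1 \<bullet> col Q 1 = 1" "col Q 0 \<bullet> col Q 1 = 0"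
  shows "transpose_mat Q * Q = 1\<^sub>m 2"
proof (rule eq_matI)
  have c: "col Q 1 \<bullet> col Q 0 = 0" using assms comm_scalar_prod[of "col Q 1" n "col Q 0"] by auto
  fix i j assume "i < dim_row (1\<^sub>m 2 :: real mat)" "j < dim_col (1\<^sub>m 2 :: real mat)"
  hence ij: "i < 2" "j < 2" by auto
  hence "(transpose_mat Q * Q) $$ (i, j) = col Q i \<bullet> col Q j" using assms(1) by simp
  also have "\<dots> = (if i = j then 1 else 0)"
    using less_two_cases[OF ij(1)] less_two_cases[OF ij(2)]
    by (elim disjE) (simp_all only: assms(2-4) c, simp_all)
  finally show "(transpose_mat Q * Q) $$ (i, j) = 1\<^sub>m 2 $$ (i, j)" using ij by simp
qed (use assms in auto)

text \<open>The Gram matrix is positive definite, and the coefficients \<open>- q\<close> and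
  \<open>p\<close> turn its quadratic form into \<open>p\<close> times its determinant.\<close>

lemma gram_two_pos:
  fixes B :: "real mat"
  assumes B: "B \<in> carrier_mat n 2"
    and inj: "\<And>c. c \<in> carrier_vec 2 \<Longrightarrow> B *\<^sub>v c = 0\<^sub>v n \<Longrightarrow> c = 0\<^sub>v 2"
  defines "p \<equiv> col B 0 \<bullet> col B 0" and "q \<equiv> col B 0 \<bullet> col B 1" and "r \<equiv> col B 1 \<bullet> col B 1"
  shows "0 < p" "q\<^sup>2 < p * r"
proof -
  have bc: "col B 0 \<in> carrier_vec n" "col B 1 \<in> carrier_vec n" using B by auto
  have pos: "0 < c0\<^sup>2 * p + 2 * c0 * c1 * q + c1\<^sup>2 * r" if "c0 \<noteq> 0 \<or> c1 \<noteq> 0" for c0 c1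
  proof -
    define c where "c = vec 2 (\<lambda>i. if i = 0 then c0 else c1 :: real)"
    have c: "c \<in> carrier_vec 2" "c $ 0 = c0" "c $ 1 = c1" by (auto simp: c_def)
    have "c \<noteq> 0\<^sub>v 2" using that c by auto
    hence "B *\<^sub>v c \<noteq> 0\<^sub>v n" using inj c(1) by blast
    moreover have Bc: "B *\<^sub>v c \<in> carrier_vec n" using B c by simp
    ultimately have "0 < (l2_norm (B *\<^sub>v c))\<^sup>2"
      using l2_norm_zero_iff[OF Bc] by simp
    also have "\<dots> = c0\<^sup>2 * p + 2 * c0 * c1 * q + c1\<^sup>2 * r"
      unfolding l2_norm_sq mult_mat_two_vec[OF B c(1)] c p_def q_def r_def
      using bc comm_scalar_prod[OF bc]
      by (simp add: scalar_prod_add_distrib[of _ n] add_scalar_prod_distrib[of _ n] power2_eq_square algebra_simps)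
    finally show ?thesis .
  qed
  show p: "0 < p" using pos[of 1 0] by simp
  have "0 < p * (p * r - q\<^sup>2)" using pos[of "- q" p] p by (simp add: power2_eq_square algebra_simps)
  thus "q\<^sup>2 < p * r" using p by (simp add: zero_less_mult_iff)
qed

text \<open>Gram-Schmidt; injectivity keeps both diagonal entries \<open>s\<close> and
  \<open>t\<close> of \<open>R\<close> positive.\<close>

lemma qr_decomposition_exists:
  fixes B :: "real mat"
  assumes B: "B \<in> carrier_mat n 2"
    and inj: "\<And>c. c \<in> carrier_vec 2 \<Longrightarrow> B *\<^sub>v c = 0\<^sub>v n \<Longrightarrow> c = 0\<^sub>v 2"
  shows "\<exists>Q R. is_qr_decomposition n B Q R"
proof -
  define b0 b1 where "b0 = col B 0" and "b1 = col B 1"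
  have bc: "b0 \<in> carrier_vec n" "b1 \<in> carrier_vec n" using B by (auto simp: b0_def b1_def)
  define p q r where "p = b0 \<bullet> b0" and "q = b0 \<bullet> b1" and "r = b1 \<bullet> b1"
  have g: "0 < p" "q\<^sup>2 < p * r"
    using gram_two_pos[OF B inj] by (simp_all add: p_def q_def r_def b0_def b1_def)
  define s where "s = sqrt p"
  define t where "t = sqrt (r - q\<^sup>2 / p)"
  have s: "s > 0" "s * s = p" using g by (auto simp: s_def)
  have t: "t > 0" "t * t = r - q\<^sup>2 / p" using g by (auto simp: t_def field_simps)
  define q0 where "q0 = (1 / s) \<cdot>\<^sub>v b0"
  define q1 where "q1 = (1 / t) \<cdot>\<^sub>v (b1 - (q / p) \<cdot>\<^sub>v b0)"
  have qc: "q0 \<in> carrier_vec n" "q1 \<in> carrier_vec n" using bc by (auto simp: q0_def q1_def)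
  have b10: "b1 \<bullet> b0 = q" using comm_scalar_prod[OF bc] by (simp add: q_def)
  have q00: "q0 \<bullet> q0 = 1" unfolding q0_def using bc s g(1) by (simp add: p_def[symmetric])
  have q01: "q0 \<bullet> q1 = 0" unfolding q0_def q1_def using bc g
    by (simp add: scalar_prod_minus_distrib[of _ n] p_def[symmetric] q_def[symmetric])
  have "(b1 - (q / p) \<cdot>\<^sub>v b0) \<bullet> (b1 - (q / p) \<cdot>\<^sub>v b0) = t * t"
    unfolding t(2) using bc g b10
    by (simp add: scalar_prod_minus_distrib[of _ n] minus_scalar_prod_distrib[of _ n]
        p_def[symmetric] q_def[symmetric] r_def[symmetric] field_simps power2_eq_square)
  hence q11: "q1 \<bullet> q1 = 1" unfolding q1_def using bc t(1) by simp
  define Q where "Q = mat n 2 (\<lambda>(i, j). if j = 0 then q0 $ i else q1 $ i)"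
  define R where "R = mat 2 2 (\<lambda>(i, j). if i = 0 then if j = 0 then s else q / s else if j = 0 then 0 else t)"
  have cols: "col Q 0 = q0" "col Q 1 = q1" using qc by (auto simp: Q_def)
  have "transpose_mat Q * Q = 1\<^sub>m 2"
    by (rule orthonormal_columns_two[of _ n]) (simp_all only: cols q00 q11 q01, simp add: Q_def)
  moreover have "B = Q * R"
  proof (rule eq_matI)
    fix i j assume "i < dim_row (Q * R)" "j < dim_col (Q * R)"
    hence ij: "i < n" "j < 2" by (auto simp: Q_def R_def)
    have BQ: "B $$ (i, 0) = b0 $ i" "B $$ (i, 1) = b1 $ i" using B ij by (auto simp: b0_def b1_def)
    have qs: "q0 $ i = b0 $ i / s" "q1 $ i = (b1 $ i - q / p * b0 $ i) / t"
      using ij bc by (auto simp: q0_def q1_def)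
    have Qe: "Q $$ (i, 0) = q0 $ i" "Q $$ (i, 1) = q1 $ i" using ij by (auto simp: Q_def)
    have Re: "R $$ (0, 0) = s" "R $$ (0, 1) = q / s" "R $$ (1, 0) = 0" "R $$ (1, 1) = t"
      by (auto simp: R_def)
    have QR: "(Q * R) $$ (i, j) = Q $$ (i, 0) * R $$ (0, j) + Q $$ (i, 1) * R $$ (1, j)"
      by (rule index_mult_mat_two[of _ n _ 2]) (use ij in \<open>auto simp: Q_def R_def\<close>)
    have "b0 $ i / s * (q / s) = q / p * b0 $ i" unfolding s(2)[symmetric] by simp
    hence e: "b0 $ i = q0 $ i * s" "b1 $ i = q0 $ i * (q / s) + q1 $ i * t"
      unfolding qs using s t by simp_all
    from less_two_cases[OF ij(2)] show "B $$ (i, j) = (Q * R) $$ (i, j)"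
    proof
      assume "j = 0"
      thus ?thesis unfolding QR by (simp only: BQ Qe Re e(1) mult_zero_right add_0_right)
    next
      assume "j = 1"
      thus ?thesis unfolding QR by (simp only: BQ Qe Re e(2))
    qed
  qed (use B in \<open>auto simp: Q_def R_def\<close>)
  ultimately have "is_qr_decomposition n B Q R"
    by (auto simp: is_qr_decomposition_def Q_def R_def upper_triangular_def)
  thus ?thesis by blast
qed

text \<open>For a positive definite 2 by 2 matrix \<open>G\<close>, the Cayley-Hamilton theorem
  gives the square root \<open>(G + s I) / t\<close> with \<open>s = sqrt (det G)\<close> and
  \<open>t = sqrt (tr G + 2 s)\<close>. Its inverse is the explicit matrix
  \<open>S = (adj G + s I) / (t s)\<close>.\<close>

lemma inverse_sqrt_exists:
  fixes Y :: "real mat"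
  assumes Y: "Y \<in> carrier_mat n 2"
    and inj: "\<And>c. c \<in> carrier_vec 2 \<Longrightarrow> Y *\<^sub>v c = 0\<^sub>v n \<Longrightarrow> c = 0\<^sub>v 2"
  shows "\<exists>S. is_inverse_sqrt (transpose_mat Y * Y) S"
proof -
  define p q r where "p = col Y 0 \<bullet> col Y 0" and "q = col Y 0 \<bullet> col Y 1" and "r = col Y 1 \<bullet> col Y 1"
  have g: "0 < p" "q\<^sup>2 < p * r"
    using gram_two_pos[OF Y inj] by (simp_all add: p_def q_def r_def)
  have r: "0 < r" using g by (smt (verit) mult_nonneg_nonpos zero_le_power2)
  have bc: "col Y 0 \<in> carrier_vec n" "col Y 1 \<in> carrier_vec n" using Y by auto
  have q': "col Y 1 \<bullet> col Y 0 = q" using comm_scalar_prod[OF bc] by (simp add: q_def)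
  define s where "s = sqrt (p * r - q\<^sup>2)"
  define t where "t = sqrt (p + r + 2 * s)"
  have s: "s > 0" "s * s = p * r - q * q" using g by (auto simp: s_def power2_eq_square)
  have t: "t > 0" "t * t = p + r + 2 * s" using g r s by (auto simp: t_def)
  define G where "G = transpose_mat Y * Y"
  have G: "G \<in> carrier_mat 2 2" "G $$ (0,0) = p" "G $$ (0,1) = q" "G $$ (1,0) = q" "G $$ (1,1) = r"
    using Y q' by (auto simp: G_def p_def q_def r_def)
  define S where "S = mat 2 2 (\<lambda>(i, j). (if i = 0 then if j = 0 then r + s else - q else if j = 0 then - q else p + s) / (t * s))"
  have S: "S \<in> carrier_mat 2 2" "S $$ (0,0) = (r + s) / (t * s)" "S $$ (0,1) = - q / (t * s)"
    "S $$ (1,0) = - q / (t * s)" "S $$ (1,1) = (p + s) / (t * s)"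
    by (auto simp: S_def)
  have SS: "S * S \<in> carrier_mat 2 2" "(S * S) $$ (0,0) = r / (s * s)" "(S * S) $$ (0,1) = - q / (s * s)"
    "(S * S) $$ (1,0) = - q / (s * s)" "(S * S) $$ (1,1) = p / (s * s)"
  proof -
    have e: "(S * S) $$ (i, j) = S $$ (i, 0) * S $$ (0, j) + S $$ (i, 1) * S $$ (1, j)" if "i < 2" "j < 2" for i j
      by (rule index_mult_mat_two[OF S(1) S(1) that])
    have lt: "0 < (2::nat)" "1 < (2::nat)" by auto
    have ne: "t * s \<noteq> 0" "s * s \<noteq> 0" using s t by auto
    have d: "x / (t * s) * (y / (t * s)) + x' / (t * s) * (y' / (t * s)) = w / (s * s)"
      if "x * y + x' * y' = w * (t * t)" for x y x' y' w
    proof -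
      have "x / (t * s) * (y / (t * s)) + x' / (t * s) * (y' / (t * s)) = (x * y + x' * y') / ((t * t) * (s * s))"
        by (simp add: add_divide_distrib mult_ac)
      also have "\<dots> = w / (s * s)" unfolding that using t(1) by simp
      finally show ?thesis .
    qed
    have qq: "q * q = p * r - s * s" using s(2) by simp
    show "(S * S) $$ (0,0) = r / (s * s)"
      unfolding e[OF lt(1) lt(1)] S(2-5) by (rule d) (simp add: t(2) qq algebra_simps)
    show "(S * S) $$ (0,1) = - q / (s * s)"
      unfolding e[OF lt(1) lt(2)] S(2-5) by (rule d) (simp add: t(2) algebra_simps)
    show "(S * S) $$ (1,0) = - q / (s * s)"
      unfolding e[OF lt(2) lt(1)] S(2-5) by (rule d) (simp add: t(2) algebra_simps)
    show "(S * S) $$ (1,1) = p / (s * s)"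
      unfolding e[OF lt(2) lt(2)] S(2-5) by (rule d) (simp add: t(2) qq algebra_simps)
    show "S * S \<in> carrier_mat 2 2" using S(1) by simp
  qed
  have "S * S * G = 1\<^sub>m 2"
  proof (rule eq_matI)
    fix i j assume "i < dim_row (1\<^sub>m 2 :: real mat)" "j < dim_col (1\<^sub>m 2 :: real mat)"
    hence ij: "i < 2" "j < 2" by auto
    have e: "(S * S * G) $$ (i, j) = (S * S) $$ (i, 0) * G $$ (0, j) + (S * S) $$ (i, 1) * G $$ (1, j)"
      by (rule index_mult_mat_two[OF SS(1) G(1) ij])
    have ss: "r / (s * s) * p + - q / (s * s) * q = 1" "r / (s * s) * q + - q / (s * s) * r = 0"
      "- q / (s * s) * p + p / (s * s) * q = 0" "- q / (s * s) * q + p / (s * s) * r = 1"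
    proof -
      have k: "x / (s * s) * y + x' / (s * s) * y' = (x * y + x' * y') / (s * s)" for x y x' y'
        by (simp add: add_divide_distrib)
      have pos: "0 < s * s" using s(1) by simp
      show "r / (s * s) * p + - q / (s * s) * q = 1" unfolding k using s(2) pos by (simp add: mult.commute)
      show "r / (s * s) * q + - q / (s * s) * r = 0" unfolding k by (simp add: mult.commute)
      show "- q / (s * s) * p + p / (s * s) * q = 0" unfolding k by (simp add: mult.commute)
      show "- q / (s * s) * q + p / (s * s) * r = 1" unfolding k using s(2) pos by (simp add: mult.commute)
    qed
    show "(S * S * G) $$ (i, j) = 1\<^sub>m 2 $$ (i, j)"
      unfolding e using less_two_cases[OF ij(1)] less_two_cases[OF ij(2)]
      by (elim disjE) (simp_all only: SS(2-5) G(2-5) ss, simp_all)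
  qed (use SS G in auto)
  moreover from mat_mult_left_right_inverse[OF SS(1) G(1) this] have "G * (S * S) = 1\<^sub>m 2" .
  moreover have "transpose_mat S = S"
  proof (rule eq_matI)
    fix i j assume "i < dim_row S" "j < dim_col S"
    hence ij: "i < 2" "j < 2" using S(1) by auto
    hence "transpose_mat S $$ (i, j) = S $$ (j, i)" using S(1) by simp
    also have "\<dots> = S $$ (i, j)" using ij by (simp add: S_def)
    finally show "transpose_mat S $$ (i, j) = S $$ (i, j)" .
  qed (use S in auto)
  moreover have "0 < v \<bullet> (S *\<^sub>v v)" if v: "v \<in> carrier_vec 2" "v \<noteq> 0\<^sub>v 2" for v
  proof -
    have v0: "v $ 0 \<noteq> 0 \<or> v $ 1 \<noteq> 0"
    proof (rule ccontr)
      assume "\<not> ?thesis"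
      hence "v $ i = 0" if "i < 2" for i using less_two_cases[OF that] by auto
      hence "v = 0\<^sub>v 2" using v(1) by (intro eq_vecI) auto
      thus False using v(2) by simp
    qed
    have "v \<bullet> (S *\<^sub>v v) = ((v $ 0)\<^sup>2 * (r + s) - 2 * q * v $ 0 * v $ 1 + (v $ 1)\<^sup>2 * (p + s)) / (t * s)"
    proof -
      have "(S *\<^sub>v v) $ 0 = S $$ (0,0) * v $ 0 + S $$ (0,1) * v $ 1" "(S *\<^sub>v v) $ 1 = S $$ (1,0) * v $ 0 + S $$ (1,1) * v $ 1"
        using S(1) v(1) by (auto simp: scalar_prod_def sum_upto_two)
      moreover have "v \<bullet> (S *\<^sub>v v) = v $ 0 * (S *\<^sub>v v) $ 0 + v $ 1 * (S *\<^sub>v v) $ 1"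
        using S(1) v(1) by (simp add: scalar_prod_def[of v] sum_upto_two)
      moreover have gen: "x * (A / T * x + B / T * y) + y * (B / T * x + D / T * y) = (x\<^sup>2 * A + 2 * B * x * y + y\<^sup>2 * D) / T" for x y A B D T :: real
        by (simp add: power2_eq_square add_divide_distrib algebra_simps)
      ultimately show ?thesis unfolding S(2-5)
        using gen[of "v $ 0" "r + s" "t * s" "- q" "v $ 1" "p + s"] by simp
    qed
    moreover have "0 < (v $ 0)\<^sup>2 * (r + s) - 2 * q * v $ 0 * v $ 1 + (v $ 1)\<^sup>2 * (p + s)"
    proof -
      \<comment> \<open>Completing the square after multiplication by \<open>p\<close> shows that
        the adjugate part is nonnegative; the multiple \<open>s\<close> of the identity makes the
        form strictly positive.\<close>
      have "p * ((v $ 0)\<^sup>2 * r - 2 * q * v $ 0 * v $ 1 + (v $ 1)\<^sup>2 * p) = (p * v $ 1 - q * v $ 0)\<^sup>2 + (p * r - q\<^sup>2) * (v $ 0)\<^sup>2"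
        by (simp add: power2_eq_square algebra_simps)
      also have "\<dots> \<ge> 0" using g by simp
      finally have "0 \<le> (v $ 0)\<^sup>2 * r - 2 * q * v $ 0 * v $ 1 + (v $ 1)\<^sup>2 * p"
        using g(1) by (simp add: zero_le_mult_iff)
      moreover have "0 < s * ((v $ 0)\<^sup>2 + (v $ 1)\<^sup>2)"
        using s(1) v0 by (simp add: sum_power2_gt_zero_iff)
      ultimately show ?thesis by (simp add: algebra_simps)
    qed
    ultimately show ?thesis using s t by simp
  qed
  ultimately have "is_inverse_sqrt G S" using SS(1) G(1) S(1)
    by (auto simp: is_inverse_sqrt_def inverts_mat_def)
  thus ?thesis unfolding G_def by blast
qed

text \<open>Half the difference of the diagonal entries and the off-diagonal entry are read as a
  plane vector of angle \<open>\<theta>\<close>; rotating by \<open>\<theta> / 2\<close>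
  diagonalises \<open>M\<close>, with eigenvalues \<open>m + \<rho>\<close> and
  \<open>m - \<rho>\<close>.\<close>

lemma eigendecomposition_exists:
  fixes M :: "real mat"
  assumes M: "M \<in> carrier_mat 2 2" and sym: "transpose_mat M = M"
  shows "\<exists>H d. is_eigendecomposition M H d"
proof -
  have M10: "M $$ (1, 0) = M $$ (0, 1)"
    using M by (subst sym[symmetric]) auto
  define m where "m = (M $$ (0,0) + M $$ (1,1)) / 2"
  obtain \<rho>0 \<theta>0 where pol0: "(M $$ (0,0) - M $$ (1,1)) / 2 = \<rho>0 * cos \<theta>0" "M $$ (0,1) = \<rho>0 * sin \<theta>0"
    using polar_Ex by blast
  \<comment> \<open>If necessary the radius is negated and the angle shifted by \<open>pi\<close>,
    so that \<open>m\<close> and \<open>\<rho>\<close> do not have opposite signs; this puts the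
    eigenvalue of larger absolute value first.\<close>
  define \<rho> where "\<rho> = (if 0 \<le> m * \<rho>0 then \<rho>0 else - \<rho>0)"
  define \<theta> where "\<theta> = (if 0 \<le> m * \<rho>0 then \<theta>0 else \<theta>0 + pi)"
  have pol: "(M $$ (0,0) - M $$ (1,1)) / 2 = \<rho> * cos \<theta>" "M $$ (0,1) = \<rho> * sin \<theta>" and m\<rho>: "0 \<le> m * \<rho>"
    using pol0 by (auto simp: \<rho>_def \<theta>_def)
  define c s where "c = cos (\<theta> / 2)" and "s = sin (\<theta> / 2)"
  have cs: "c * c + s * s = 1" by (simp add: c_def s_def power2_eq_square[symmetric])
  have c2: "cos \<theta> = c * c - s * s" "sin \<theta> = 2 * s * c"
    using cos_double[of "\<theta> / 2"] sin_double[of "\<theta> / 2"] by (simp_all add: c_def s_def power2_eq_square)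
  define H where "H = mat 2 2 (\<lambda>(i, j). if i = 0 then if j = 0 then c else - s else if j = 0 then s else c)"
  define d where "d = (\<lambda>i::nat. if i = 0 then m + \<rho> else m - \<rho>)"
  have H: "H \<in> carrier_mat 2 2" by (simp add: H_def)
  have HtH: "transpose_mat H * H = 1\<^sub>m 2"
  proof (rule eq_matI)
    fix i j assume "i < dim_row (1\<^sub>m 2 :: real mat)" "j < dim_col (1\<^sub>m 2 :: real mat)"
    hence ij: "i < 2" "j < 2" by auto
    have Ht: "transpose_mat H \<in> carrier_mat 2 2" using H by simp
    have "(transpose_mat H * H) $$ (i, j) = H $$ (0, i) * H $$ (0, j) + H $$ (1, i) * H $$ (1, j)"
      by (subst index_mult_mat_two[OF Ht H ij]) (use H ij in simp)
    also have "\<dots> = 1\<^sub>m 2 $$ (i, j)"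
      using less_two_cases[OF ij(1)] less_two_cases[OF ij(2)]
      by (elim disjE) (use cs in \<open>simp_all add: H_def add.commute\<close>)
    finally show "(transpose_mat H * H) $$ (i, j) = 1\<^sub>m 2 $$ (i, j)" .
  qed (auto simp: H_def)
  have HHt: "H * transpose_mat H = 1\<^sub>m 2"
    by (rule mat_mult_left_right_inverse[OF _ H HtH]) (use H in simp)
  have "M = H * mat_diag 2 d * transpose_mat H"
  proof (rule eq_matI)
    fix i j assume "i < dim_row (H * mat_diag 2 d * transpose_mat H)" "j < dim_col (H * mat_diag 2 d * transpose_mat H)"
    hence ij: "i < 2" "j < 2" using H by auto
    have HD: "H * mat_diag 2 d \<in> carrier_mat 2 2" using H by simp
    have He: "H $$ (0,0) = c" "H $$ (0,1) = - s" "H $$ (1,0) = s" "H $$ (1,1) = c" by (auto simp: H_def)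
    have lt: "0 < (2::nat)" "1 < (2::nat)" by auto
    have HDe: "(H * mat_diag 2 d) $$ (i, k) = H $$ (i, k) * d k" if "k < 2" for k
      unfolding mat_diag_mult_right[OF H] using that ij by simp
    have Hte: "transpose_mat H $$ (k, j) = H $$ (j, k)" if "k < 2" for k using H that ij by simp
    have "(H * mat_diag 2 d * transpose_mat H) $$ (i, j) = H $$ (i, 0) * d 0 * H $$ (j, 0) + H $$ (i, 1) * d 1 * H $$ (j, 1)"
      by (subst index_mult_mat_two[OF HD _ ij]) (use H lt in \<open>simp_all only: HDe Hte transpose_carrier_mat\<close>)
    also have "\<dots> = M $$ (i, j)"
    proof -
      have M00: "M $$ (0,0) = m + \<rho> * (c * c - s * s)" "M $$ (1,1) = m - \<rho> * (c * c - s * s)" "M $$ (0,1) = \<rho> * (2 * s * c)"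
        using pol unfolding c2 m_def by (simp_all add: field_simps)
      have de: "d 0 = m + \<rho>" "d 1 = m - \<rho>" by (simp_all add: d_def)
      have "c * (m + \<rho>) * c + - s * (m - \<rho>) * - s = m * (c * c + s * s) + \<rho> * (c * c - s * s)"
        by (simp add: algebra_simps)
      moreover have "s * (m + \<rho>) * s + c * (m - \<rho>) * c = m * (c * c + s * s) - \<rho> * (c * c - s * s)"
        by (simp add: algebra_simps)
      moreover have "c * (m + \<rho>) * s + - s * (m - \<rho>) * c = \<rho> * (2 * s * c)" "s * (m + \<rho>) * c + c * (m - \<rho>) * - s = \<rho> * (2 * s * c)"
        by (simp_all add: algebra_simps)
      ultimately show ?thesis
        using less_two_cases[OF ij(1)] less_two_cases[OF ij(2)]
        by (elim disjE) (simp_all only: He de M00 M10 cs mult_1_right)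
    qed
    finally show "M $$ (i, j) = (H * mat_diag 2 d * transpose_mat H) $$ (i, j)" by simp
  qed (use M H in auto)
  moreover have "\<bar>d 0\<bar> \<ge> \<bar>d 1\<bar>"
    using m\<rho> by (auto simp: d_def zero_le_mult_iff)
  ultimately show ?thesis using H HtH HHt unfolding is_eigendecomposition_def by blast
qed

section \<open>Orthogonal iterations and the Ritz step\<close>

lemma orthonormal_injective:
  fixes Q :: "real mat"
  assumes "Q \<in> carrier_mat n m" "transpose_mat Q * Q = 1\<^sub>m m" "c \<in> carrier_vec m" "Q *\<^sub>v c = 0\<^sub>v n"
  shows "c = 0\<^sub>v m"
proof -
  have "c = (transpose_mat Q * Q) *\<^sub>v c" using assms by simp
  also have "\<dots> = transpose_mat Q *\<^sub>v (Q *\<^sub>v c)" using assms by (intro assoc_mult_mat_vec[of _ m n _ m]) auto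
  also have "\<dots> = 0\<^sub>v m" using assms by (intro eq_vecI) auto
  finally show ?thesis .
qed

lemma right_inverse_exists:
  fixes R :: "real mat"
  assumes "R \<in> carrier_mat m m" "\<And>c. c \<in> carrier_vec m \<Longrightarrow> R *\<^sub>v c = 0\<^sub>v m \<Longrightarrow> c = 0\<^sub>v m"
  shows "\<exists>R' \<in> carrier_mat m m. R * R' = 1\<^sub>m m"
proof -
  have "det R \<noteq> 0" using det_0_iff_vec_prod_zero_field[OF assms(1)] assms(2) by blast
  from det_non_zero_imp_unit[OF assms(1) this, of "()"] obtain R' where
    "R' \<in> carrier_mat m m" "R * R' = 1\<^sub>m m"
    by (auto simp: Units_def ring_mat_def)
  thus ?thesis by blast
qed

context block_matrix
begin

lemma Apow_zero: "Apow j (0\<^sub>v n) = 0\<^sub>v n"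
  by (induction j) (use A in \<open>auto intro!: eq_vecI\<close>)

text \<open>Whatever QR decompositions are chosen, the columns of \<open>Q k\<close> lie in the
  image of the range of \<open>Y\<close> under \<open>Apow k\<close>. Injectivity at
  \<open>N\<close> makes every \<open>R\<close> invertible, since a kernel vector would be
  annihilated by \<open>Apow N\<close> as well. Keeping \<open>m\<close> apart from \<open>N\<close>
  lets the existence proof apply the lemma to partial runs.\<close>

lemma orthogonal_iterations_span:
  assumes Y: "Y \<in> carrier_mat n 2"
    and inj: "\<And>c. c \<in> carrier_vec 2 \<Longrightarrow> Apow N (Y *\<^sub>v c) = 0\<^sub>v n \<Longrightarrow> c = 0\<^sub>v 2"
    and it: "orthogonal_iterations n A Y m Q" and k: "k \<le> m" "m \<le> N"
  shows "Q k \<in> carrier_mat n 2 \<and> (\<forall>c \<in> carrier_vec 2. Q k *\<^sub>v c = 0\<^sub>v n \<longrightarrow> c = 0\<^sub>v 2) \<and>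
    (\<exists>M \<in> carrier_mat 2 2. \<forall>c \<in> carrier_vec 2. Q k *\<^sub>v c = Apow k (Y *\<^sub>v (M *\<^sub>v c)))"
  using k(1)
proof (induction k)
  case 0
  from it obtain S where S: "is_inverse_sqrt (transpose_mat Y * Y) S" "Q 0 = Y * S"
    by (auto simp: orthogonal_iterations_def)
  have Sc: "S \<in> carrier_mat 2 2" using S(1) by (simp add: is_inverse_sqrt_def)
  have Q: "Q 0 *\<^sub>v c = Y *\<^sub>v (S *\<^sub>v c)" if "c \<in> carrier_vec 2" for c
    unfolding S(2) by (rule assoc_mult_mat_vec[OF Y Sc that])
  have "c = 0\<^sub>v 2" if c: "c \<in> carrier_vec 2" "Q 0 *\<^sub>v c = 0\<^sub>v n" for c
  proof (rule ccontr)
    assume "c \<noteq> 0\<^sub>v 2"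
    hence pos: "0 < c \<bullet> (S *\<^sub>v c)" using S(1) c(1) by (auto simp: is_inverse_sqrt_def)
    have "S *\<^sub>v c = 0\<^sub>v 2" using c Sc Apow_zero by (intro inj) (auto simp: Q[symmetric])
    thus False using pos c(1) by simp
  qed
  thus ?case using S(2) Y Sc Q by auto
next
  case (Suc k)
  then obtain M where IH: "Q k \<in> carrier_mat n 2" "\<And>c. c \<in> carrier_vec 2 \<Longrightarrow> Q k *\<^sub>v c = 0\<^sub>v n \<Longrightarrow> c = 0\<^sub>v 2"
    and M: "M \<in> carrier_mat 2 2" "\<And>c. c \<in> carrier_vec 2 \<Longrightarrow> Q k *\<^sub>v c = Apow k (Y *\<^sub>v (M *\<^sub>v c))"
    by auto
  from it Suc.prems obtain R where qr: "is_qr_decomposition n (A * Q k) (Q (Suc k)) R"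
    by (auto simp: orthogonal_iterations_def Suc_le_eq)
  have Q': "Q (Suc k) \<in> carrier_mat n 2" "transpose_mat (Q (Suc k)) * Q (Suc k) = 1\<^sub>m 2"
    and R: "R \<in> carrier_mat 2 2" and AQ: "A * Q k = Q (Suc k) * R"
    using qr by (auto simp: is_qr_decomposition_def)
  have AQc: "Q (Suc k) *\<^sub>v (R *\<^sub>v c) = Apow (Suc k) (Y *\<^sub>v (M *\<^sub>v c))" if c: "c \<in> carrier_vec 2" for c
  proof -
    have "Q (Suc k) *\<^sub>v (R *\<^sub>v c) = A *\<^sub>v (Q k *\<^sub>v c)"
      using assoc_mult_mat_vec[OF Q'(1) R c] assoc_mult_mat_vec[OF A IH(1) c] AQ by simp
    thus ?thesis using M(2)[OF c] by simp
  qed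
  have "c = 0\<^sub>v 2" if c: "c \<in> carrier_vec 2" "R *\<^sub>v c = 0\<^sub>v 2" for c
  proof -
    have "Apow (Suc k) (Y *\<^sub>v (M *\<^sub>v c)) = 0\<^sub>v n"
    proof -
      have "Q (Suc k) *\<^sub>v 0\<^sub>v 2 = 0\<^sub>v n" using Q'(1) by (intro eq_vecI) auto
      thus ?thesis using AQc[OF c(1)] c(2) by simp
    qed
    \<comment> \<open>The remaining powers of \<open>A\<close> are applied because injectivity is
      assumed for the exponent \<open>N\<close> only.\<close>
    hence "Apow (N - Suc k) (Apow (Suc k) (Y *\<^sub>v (M *\<^sub>v c))) = 0\<^sub>v n" using Apow_zero by simp
    hence "Apow N (Y *\<^sub>v (M *\<^sub>v c)) = 0\<^sub>v n"
      using Suc.prems k(2) by (simp add: funpow_add[symmetric] del: funpow.simps flip: o_apply[of "Apow _" "Apow _"])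
    hence Mc0: "M *\<^sub>v c = 0\<^sub>v 2" using inj M(1) c(1) by simp
    have "Y *\<^sub>v 0\<^sub>v 2 = 0\<^sub>v n" using Y by (intro eq_vecI) auto
    hence "Q k *\<^sub>v c = 0\<^sub>v n" unfolding M(2)[OF c(1)] Mc0 using Apow_zero[of k] by simp
    thus ?thesis using IH(2) c(1) by blast
  qed
  from right_inverse_exists[OF R this] obtain R' where R': "R' \<in> carrier_mat 2 2" "R * R' = 1\<^sub>m 2" by blast
  have "Q (Suc k) *\<^sub>v c = Apow (Suc k) (Y *\<^sub>v ((M * R') *\<^sub>v c))" if c: "c \<in> carrier_vec 2" for c
  proof -
    have "c = R *\<^sub>v (R' *\<^sub>v c)" using assoc_mult_mat_vec[OF R R'(1) c] R'(2) c by simp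
    hence "Q (Suc k) *\<^sub>v c = Q (Suc k) *\<^sub>v (R *\<^sub>v (R' *\<^sub>v c))" by simp
    also have "\<dots> = Apow (Suc k) (Y *\<^sub>v (M *\<^sub>v (R' *\<^sub>v c)))" using R'(1) c by (intro AQc) auto
    also have "M *\<^sub>v (R' *\<^sub>v c) = (M * R') *\<^sub>v c" using assoc_mult_mat_vec[OF M(1) R'(1) c] by simp
    finally show ?thesis .
  qed
  moreover have "M * R' \<in> carrier_mat 2 2" using M(1) R'(1) by simp
  moreover have "\<forall>c \<in> carrier_vec 2. Q (Suc k) *\<^sub>v c = 0\<^sub>v n \<longrightarrow> c = 0\<^sub>v 2"
    using orthonormal_injective[OF Q'] by blast
  ultimately show ?case using Q'(1) by blast
qed

text \<open>A run is extended by Gram-Schmidt, for which \<open>A * Q m\<close> has to be injective;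
  a kernel vector would again survive as one of \<open>Apow N\<close> on the range of
  \<open>Y\<close>.\<close>

lemma orthogonal_iterations_exist:
  assumes Y: "Y \<in> carrier_mat n 2"
    and inj: "\<And>c. c \<in> carrier_vec 2 \<Longrightarrow> Apow N (Y *\<^sub>v c) = 0\<^sub>v n \<Longrightarrow> c = 0\<^sub>v 2"
    and m: "m \<le> N"
  shows "\<exists>Q. orthogonal_iterations n A Y m Q"
  using m
proof (induction m)
  case 0
  have "\<exists>S. is_inverse_sqrt (transpose_mat Y * Y) S"
    using inj Apow_zero by (intro inverse_sqrt_exists[OF Y]) auto
  then obtain S where "is_inverse_sqrt (transpose_mat Y * Y) S" by blast
  thus ?case by (intro exI[of _ "\<lambda>_. Y * S"]) (auto simp: orthogonal_iterations_def)
next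
  case (Suc m)
  then obtain Q where Q: "orthogonal_iterations n A Y m Q" by auto
  from Suc.prems have mN: "m \<le> N" by simp
  from orthogonal_iterations_span[OF Y inj Q order_refl mN] obtain M where
    Qm: "Q m \<in> carrier_mat n 2" "\<And>c. c \<in> carrier_vec 2 \<Longrightarrow> Q m *\<^sub>v c = 0\<^sub>v n \<Longrightarrow> c = 0\<^sub>v 2"
    and M: "M \<in> carrier_mat 2 2" "\<And>c. c \<in> carrier_vec 2 \<Longrightarrow> Q m *\<^sub>v c = Apow m (Y *\<^sub>v (M *\<^sub>v c))"
    by auto
  have "c = 0\<^sub>v 2" if c: "c \<in> carrier_vec 2" "(A * Q m) *\<^sub>v c = 0\<^sub>v n" for c
  proof -
    have "Apow (Suc m) (Y *\<^sub>v (M *\<^sub>v c)) = 0\<^sub>v n"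
      using c assoc_mult_mat_vec[OF A Qm(1) c(1)] M(2)[OF c(1)] by simp
    hence "Apow (N - Suc m) (Apow (Suc m) (Y *\<^sub>v (M *\<^sub>v c))) = 0\<^sub>v n" using Apow_zero by simp
    hence "Apow N (Y *\<^sub>v (M *\<^sub>v c)) = 0\<^sub>v n"
      using Suc.prems by (simp add: funpow_add[symmetric] del: funpow.simps flip: o_apply[of "Apow _" "Apow _"])
    hence Mc0: "M *\<^sub>v c = 0\<^sub>v 2" using inj M(1) c(1) by simp
    have "Y *\<^sub>v 0\<^sub>v 2 = 0\<^sub>v n" using Y by (intro eq_vecI) auto
    hence "Q m *\<^sub>v c = 0\<^sub>v n" unfolding M(2)[OF c(1)] Mc0 using Apow_zero[of m] by simp
    thus ?thesis using Qm(2) c(1) by blast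
  qed
  then obtain Q' R where qr: "is_qr_decomposition n (A * Q m) Q' R"
    using qr_decomposition_exists[of "A * Q m" n] A Qm(1) by auto
  have "orthogonal_iterations n A Y (Suc m) (Q(Suc m := Q'))"
    using Q qr by (auto simp: orthogonal_iterations_def less_Suc_eq)
  thus ?case by blast
qed

text \<open>Let \<open>(c, s)\<close> and \<open>(c', s')\<close> be the coordinates of
  \<open>w\<close> and \<open>w'\<close> along the normalised \<open>ones n\<close> and
  \<open>z\<close>. Orthogonality and the vanishing off-diagonal entry make
  \<open>c c' + s s'\<close> and \<open>a c c' + b s s'\<close> small, and \<open>b < a\<close>
  leaves \<open>c c'\<close> small: one of the two vectors is nearly orthogonal to
  \<open>ones n\<close>. If only \<open>w'\<close> were, then \<open>w\<close> would have Ritz value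
  about \<open>a\<close> and \<open>w'\<close> at most about \<open>b\<close>, against
  \<open>le\<close>; \<open>gap\<close> quantifies this.\<close>

lemma ritz_vector:
  assumes w: "w \<in> carrier_vec n" "w' \<in> carrier_vec n"
    and on: "w \<bullet> w = 1" "w' \<bullet> w' = 1" "w \<bullet> w' = 0"
    and diag: "w \<bullet> (A *\<^sub>v w') = 0" and le: "w \<bullet> (A *\<^sub>v w) \<le> w' \<bullet> (A *\<^sub>v w')"
    and \<tau>: "l2_norm (res w) \<le> \<tau>" "l2_norm (res w') \<le> \<tau>"
    and ba: "b < a"
  defines "\<kappa> \<equiv> (e + b * \<tau>\<^sup>2) / (a - b)"
  assumes small: "\<tau>\<^sup>2 + \<kappa> \<le> 1 / 2"
    and gap: "b + 2 * e + a * \<kappa> < a * (1 - \<tau>\<^sup>2 - 2 * (\<kappa> + \<tau>\<^sup>2)\<^sup>2)"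
  shows "(ones n \<bullet> w)\<^sup>2 / real n \<le> \<kappa>" "1 - \<tau>\<^sup>2 - \<kappa> \<le> (z \<bullet> w)\<^sup>2 / real n"
    "(ones n \<bullet> w)\<^sup>2 / real n + (z \<bullet> w)\<^sup>2 / real n \<le> 1"
proof -
  define c c' s s' where "c = (ones n \<bullet> w) / sqrt (real n)" and "c' = (ones n \<bullet> w') / sqrt (real n)"
    and "s = (z \<bullet> w) / sqrt (real n)" and "s' = (z \<bullet> w') / sqrt (real n)"
  have sq: "x / sqrt (real n) * (y / sqrt (real n)) = x * y / real n" for x y by simp
  have \<tau>0: "0 \<le> \<tau>" using \<tau>(1) l2_norm_nonneg order_trans by blast
  have a0: "0 < a" using ba b_nonneg by linarith
  have \<kappa>0: "0 \<le> \<kappa>" using e_nonneg b_nonneg ba by (simp add: \<kappa>_def)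
  have res1: "(l2_norm (res w))\<^sup>2 = 1 - c\<^sup>2 - s\<^sup>2" "(l2_norm (res w'))\<^sup>2 = 1 - c'\<^sup>2 - s'\<^sup>2"
    and res2: "res w \<bullet> res w' = - (c * c') - s * s'"
    unfolding l2_norm_sq res_props(5)[OF w] res_props(5)[OF w(1) w(1)] res_props(5)[OF w(2) w(2)] on
    by (simp_all add: c_def c'_def s_def s'_def power2_eq_square)
  have le1: "1 - \<tau>\<^sup>2 \<le> c\<^sup>2 + s\<^sup>2" "1 - \<tau>\<^sup>2 \<le> c'\<^sup>2 + s'\<^sup>2"
    using power_mono[OF \<tau>(1), of 2] power_mono[OF \<tau>(2), of 2] res1 by auto
  have ge1: "c\<^sup>2 + s\<^sup>2 \<le> 1" "c'\<^sup>2 + s'\<^sup>2 \<le> 1"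
    using res1 zero_le_power2[of "l2_norm (res w)"] zero_le_power2[of "l2_norm (res w')"] by linarith+
  have nw: "l2_norm w = 1" "l2_norm w' = 1" using on by (simp_all add: l2_norm_def)
  have ap: "\<bar>y \<bullet> (A *\<^sub>v x) - a * ((ones n \<bullet> x) / sqrt (real n) * ((ones n \<bullet> y) / sqrt (real n))) - b * ((z \<bullet> x) / sqrt (real n) * ((z \<bullet> y) / sqrt (real n)))\<bar> \<le> e"
    if "x \<in> carrier_vec n" "y \<in> carrier_vec n" "l2_norm x = 1" "l2_norm y = 1" for x y
    using approx[OF that(1,2)] that(3,4) unfolding sq by simp
  have off: "\<bar>a * (c' * c) + b * (s' * s)\<bar> \<le> e"
    using ap[OF w(2) w(1) nw(2) nw(1)] diag unfolding c_def c'_def s_def s'_def by linarith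
  have dw: "a * c\<^sup>2 + b * s\<^sup>2 - e \<le> w \<bullet> (A *\<^sub>v w)"
    using ap[OF w(1) w(1) nw(1) nw(1)] unfolding c_def c'_def s_def s'_def power2_eq_square by linarith
  have dw': "w' \<bullet> (A *\<^sub>v w') \<le> a * c'\<^sup>2 + b * s'\<^sup>2 + e"
    using ap[OF w(2) w(2) nw(2) nw(2)] unfolding c_def c'_def s_def s'_def power2_eq_square by linarith
  have "\<bar>res w \<bullet> res w'\<bar> \<le> l2_norm (res w) * l2_norm (res w')"
    using abs_scalar_prod_le res_props(1) w by blast
  also have "\<dots> \<le> \<tau> * \<tau>" using \<tau> \<tau>0 by (intro mult_mono) auto
  finally have orth: "\<bar>c * c' + s * s'\<bar> \<le> \<tau>\<^sup>2" unfolding res2 power2_eq_square by linarith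
  have cc: "\<bar>c * c'\<bar> \<le> \<kappa>"
  proof -
    \<comment> \<open>Subtracting \<open>b\<close> times the orthogonality relation eliminates
      \<open>s s'\<close>; this is the origin of \<open>\<kappa>\<close>.\<close>
    have "(a - b) * (c * c') = (a * (c' * c) + b * (s' * s)) - b * (c * c' + s * s')" by (simp add: algebra_simps)
    hence "\<bar>(a - b) * (c * c')\<bar> \<le> \<bar>a * (c' * c) + b * (s' * s)\<bar> + \<bar>b * (c * c' + s * s')\<bar>" by linarith
    also have "\<bar>b * (c * c' + s * s')\<bar> \<le> b * \<tau>\<^sup>2" using orth b_nonneg by (simp add: abs_mult mult_left_mono)
    finally have "(a - b) * \<bar>c * c'\<bar> \<le> e + b * \<tau>\<^sup>2" using off ba by (simp add: abs_mult)
    thus ?thesis using ba by (simp add: \<kappa>_def pos_le_divide_eq mult.commute)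
  qed
  have ss: "\<bar>s * s'\<bar> \<le> \<kappa> + \<tau>\<^sup>2" using cc orth by linarith
  have "c\<^sup>2 \<le> \<kappa>"
  proof (rule ccontr)
    assume "\<not> c\<^sup>2 \<le> \<kappa>"
    hence c2: "\<kappa> < c\<^sup>2" by simp
    have c'2: "c'\<^sup>2 \<le> \<kappa>"
    proof (rule ccontr)
      assume "\<not> c'\<^sup>2 \<le> \<kappa>"
      hence "\<kappa> * \<kappa> < c\<^sup>2 * c'\<^sup>2" using c2 \<kappa>0 by (intro mult_strict_mono') auto
      moreover have "c\<^sup>2 * c'\<^sup>2 = \<bar>c * c'\<bar> * \<bar>c * c'\<bar>" by (simp add: power2_eq_square)
      moreover have "\<dots> \<le> \<kappa> * \<kappa>" using cc by (intro mult_mono) auto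
      ultimately show False by linarith
    qed
    \<comment> \<open>A large \<open>s'\<close> forces a small \<open>s\<close> through the bound on
      \<open>s * s'\<close>, so the mass of \<open>w\<close> lies almost entirely along
      \<open>ones n\<close>.\<close>
    have s'2: "1 / 2 \<le> s'\<^sup>2" using le1(2) c'2 small by linarith
    have "s\<^sup>2 * (1 / 2) \<le> s\<^sup>2 * s'\<^sup>2" using s'2 by (intro mult_left_mono) auto
    also have "\<dots> = \<bar>s * s'\<bar>\<^sup>2" by (simp add: power_mult_distrib)
    also have "\<dots> \<le> (\<kappa> + \<tau>\<^sup>2)\<^sup>2" using ss by (intro power_mono) auto
    finally have s2: "s\<^sup>2 \<le> 2 * (\<kappa> + \<tau>\<^sup>2)\<^sup>2" by simp
    have "a * (1 - \<tau>\<^sup>2 - 2 * (\<kappa> + \<tau>\<^sup>2)\<^sup>2) \<le> a * c\<^sup>2" using le1(1) s2 a0 by (intro mult_left_mono) auto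
    also have "\<dots> \<le> w \<bullet> (A *\<^sub>v w) + e" using dw b_nonneg by (smt (verit) mult_nonneg_nonneg zero_le_power2)
    also have "\<dots> \<le> a * c'\<^sup>2 + b * s'\<^sup>2 + 2 * e" using le dw' by linarith
    also have "\<dots> \<le> a * \<kappa> + b * 1 + 2 * e"
      using c'2 ge1(2) a0 b_nonneg zero_le_power2[of c'] by (intro add_mono mult_left_mono) linarith+
    finally show False using gap by linarith
  qed
  moreover have "c\<^sup>2 = (ones n \<bullet> w)\<^sup>2 / real n" "s\<^sup>2 = (z \<bullet> w)\<^sup>2 / real n"
    by (simp_all add: c_def s_def power_divide)
  ultimately show "(ones n \<bullet> w)\<^sup>2 / real n \<le> \<kappa>" "1 - \<tau>\<^sup>2 - \<kappa> \<le> (z \<bullet> w)\<^sup>2 / real n"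
    "(ones n \<bullet> w)\<^sup>2 / real n + (z \<bullet> w)\<^sup>2 / real n \<le> 1"
    using le1 ge1 by simp_all
qed

text \<open>Centring removes a component orthogonal to \<open>z\<close>, so it keeps
  \<open>z \<bullet> w\<close> and can only shorten the unit vector; rescaling to length
  \<open>sqrt n\<close> then does not lose correlation with \<open>z\<close>. The sign of
  \<open>w\<close> is arbitrary, whence the two alternatives.\<close>

lemma centered_normalized:
  assumes w: "w \<in> carrier_vec n" "w \<bullet> w = 1"
    and d: "1 - \<delta> \<le> (z \<bullet> w)\<^sup>2 / real n" "(ones n \<bullet> w)\<^sup>2 / real n + (z \<bullet> w)\<^sup>2 / real n \<le> 1" "\<delta> < 1" "0 \<le> \<delta>"
  defines "y \<equiv> w - ((ones n \<bullet> w) / real n) \<cdot>\<^sub>v ones n"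
  defines "x \<equiv> (sqrt (real n) / l2_norm y) \<cdot>\<^sub>v y"
  shows "y \<noteq> 0\<^sub>v n" "x \<in> carrier_vec n" "ones n \<bullet> x = 0" "x \<bullet> x = real n"
    "(l2_norm (x - z))\<^sup>2 \<le> 2 * real n * \<delta> \<or> (l2_norm (x - (- z)))\<^sup>2 \<le> 2 * real n * \<delta>"
proof -
  have n: "real n > 0" using n_pos by simp
  have y: "y \<in> carrier_vec n" using w by (simp add: y_def)
  have oy: "ones n \<bullet> y = 0" unfolding y_def using w n by (simp add: scalar_prod_minus_distrib[of _ n])
  have zy: "z \<bullet> y = z \<bullet> w" unfolding y_def using w zD by (simp add: scalar_prod_minus_distrib[of _ n])
  have yo: "y \<bullet> ones n = 0" using oy comm_scalar_prod[OF y ones_carrier] by simp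
  have "y \<bullet> y = y \<bullet> w" using w y yo
    by (subst (2) y_def) (simp add: scalar_prod_minus_distrib[of _ n] scalar_prod_smult_distrib[of _ n])
  also have "\<dots> = 1 - (ones n \<bullet> w)\<^sup>2 / real n" unfolding y_def using w
    by (simp add: minus_scalar_prod_distrib[of _ n] power2_eq_square)
  finally have yy: "y \<bullet> y = 1 - (ones n \<bullet> w)\<^sup>2 / real n" .
  have yy1: "y \<bullet> y \<le> 1" unfolding yy by simp
  have yy0: "0 < y \<bullet> y" unfolding yy using d by linarith
  define Ny where "Ny = l2_norm y"
  have Ny: "0 < Ny" "Ny \<le> 1" using yy0 yy1 by (auto simp: Ny_def l2_norm_def)
  show "y \<noteq> 0\<^sub>v n" using Ny l2_norm_zero_iff[OF y] by (auto simp: Ny_def)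
  show xc: "x \<in> carrier_vec n" using y by (simp add: x_def)
  show "ones n \<bullet> x = 0" using y oy by (simp add: x_def)
  have "x \<bullet> x = (sqrt (real n) / Ny) * ((sqrt (real n) / Ny) * Ny\<^sup>2)"
    using y by (simp add: x_def Ny_def l2_norm_sq)
  thus xx: "x \<bullet> x = real n" using Ny by (simp add: power2_eq_square)
  define s where "s = (z \<bullet> w) / sqrt (real n)"
  have "real n * s = real n / sqrt (real n) * (z \<bullet> w)" by (simp add: s_def)
  also have "real n / sqrt (real n) = sqrt (real n)" by (rule real_div_sqrt) simp
  finally have ns: "real n * s = sqrt (real n) * (z \<bullet> w)" .
  have "z \<bullet> x = sqrt (real n) / Ny * (z \<bullet> y)"
    unfolding x_def Ny_def by (rule scalar_prod_smult_distrib[OF zD(1) y])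
  hence zx: "z \<bullet> x = real n * s / Ny" unfolding ns zy by simp
  have s2: "s\<^sup>2 = (z \<bullet> w)\<^sup>2 / real n" by (simp add: s_def power_divide)
  have "0 \<le> (ones n \<bullet> w)\<^sup>2 / real n" by simp
  hence "s\<^sup>2 \<le> 1" using d(2) s2 by linarith
  hence s1: "\<bar>s\<bar> \<le> 1" by (simp only: abs_square_le_1)
  \<comment> \<open>Since the absolute value of \<open>s\<close> is at most 1, it is at least its
    square, which avoids a square root in the bound.\<close>
  have "1 - \<delta> \<le> \<bar>s\<bar> * \<bar>s\<bar>" using d(1) s2 by (simp add: power2_eq_square)
  also have "\<dots> \<le> \<bar>s\<bar> * 1" using s1 by (intro mult_left_mono) auto
  also have "\<dots> \<le> \<bar>s\<bar> / Ny" using Ny by (simp add: pos_le_divide_eq mult_left_le)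
  finally have abs: "real n * (1 - \<delta>) \<le> real n * (\<bar>s\<bar> / Ny)" using n by (intro mult_left_mono) auto
  have e1: "(l2_norm (x - z))\<^sup>2 = 2 * real n - 2 * (z \<bullet> x)"
    unfolding l2_norm_sq using xc xx zD comm_scalar_prod[OF xc zD(1)]
    by (simp add: minus_scalar_prod_distrib[of _ n] scalar_prod_minus_distrib[of _ n])
  have mz: "- z \<in> carrier_vec n" using zD(1) by simp
  have e2: "(l2_norm (x - (- z)))\<^sup>2 = 2 * real n + 2 * (z \<bullet> x)"
    unfolding l2_norm_sq minus_scalar_prod_distrib[OF xc mz minus_carrier_vec[OF xc mz]]
      scalar_prod_minus_distrib[OF xc xc mz] scalar_prod_minus_distrib[OF mz xc mz]
    using xc xx zD comm_scalar_prod[OF xc zD(1)] by simp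
  show "(l2_norm (x - z))\<^sup>2 \<le> 2 * real n * \<delta> \<or> (l2_norm (x - (- z)))\<^sup>2 \<le> 2 * real n * \<delta>"
  proof (cases "0 \<le> s")
    case True
    hence "real n * (1 - \<delta>) \<le> real n * s / Ny" using abs by simp
    hence "2 * real n - 2 * (real n * s / Ny) \<le> 2 * real n * \<delta>" by (simp add: right_diff_distrib)
    thus ?thesis unfolding e1 zx by blast
  next
    case False
    hence "real n * (1 - \<delta>) \<le> - (real n * s / Ny)" using abs by simp
    hence "2 * real n + 2 * (real n * s / Ny) \<le> 2 * real n * \<delta>" by (simp add: right_diff_distrib)
    thus ?thesis unfolding e2 zx by blast
  qed
qed

text \<open>\<open>rate\<close> provides the stretching hypothesis of \<open>Apow_close\<close> for
  every vector in the range of \<open>Y\<close> with nonzero image: its left side collects the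
  losses of Cramer's rule and the target growth \<open>r ^ N\<close>, its right side is the
  determinant bound. The same determinant yields injectivity and hence the existence of an
  execution.\<close>

lemma stage1_correct:
  fixes g :: "nat \<times> nat \<Rightarrow> real"
  assumes N: "0 < N" and r: "0 < r" and \<theta>: "0 < \<theta>"
    and bound: "\<And>i k. i < n \<Longrightarrow> k < 2 \<Longrightarrow> \<bar>g (i, k)\<bar> \<le> real n"
    and det: "\<theta> \<le> \<bar>\<Sum>i<n. \<Sum>j<n. g (i, 0) * g (j, 1) * minor N i j\<bar>"
    and rate: "4 * real n ^ 5 * (a + b + e) ^ N * r ^ N < \<theta>"
    and ba: "b < a"
  defines "\<tau> \<equiv> e / r"
  defines "\<kappa> \<equiv> (e + b * \<tau>\<^sup>2) / (a - b)"
  assumes small: "\<tau>\<^sup>2 + \<kappa> \<le> 1 / 2"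
    and gap: "b + 2 * e + a * \<kappa> < a * (1 - \<tau>\<^sup>2 - 2 * (\<kappa> + \<tau>\<^sup>2)\<^sup>2)"
  shows "\<exists>y. stage1_output n A (mat n 2 g) N y"
    and "stage1_output n A (mat n 2 g) N y \<Longrightarrow>
      (let x = (sqrt (real n) / l2_norm y) \<cdot>\<^sub>v y in
       y \<noteq> 0\<^sub>v n \<and> x \<in> carrier_vec n \<and> ones n \<bullet> x = 0 \<and> x \<bullet> x = real n \<and>
       ((l2_norm (x - z))\<^sup>2 \<le> 2 * real n * (\<tau>\<^sup>2 + \<kappa>) \<or> (l2_norm (x - (- z)))\<^sup>2 \<le> 2 * real n * (\<tau>\<^sup>2 + \<kappa>)))"
proof -
  define Y where "Y = mat n 2 g"
  have Y: "Y \<in> carrier_mat n 2" by (simp add: Y_def)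
  have cols: "col Y 0 \<in> carrier_vec n" "col Y 1 \<in> carrier_vec n" using Y by auto
  have colY: "col Y 0 $ i = g (i, 0)" "col Y 1 $ i = g (i, 1)" if "i < n" for i using that by (auto simp: Y_def)
  have det': "\<theta> \<le> \<bar>\<Sum>i<n. \<Sum>j<n. col Y 0 $ i * col Y 1 $ j * minor N i j\<bar>"
  proof -
    have "(\<Sum>i<n. \<Sum>j<n. col Y 0 $ i * col Y 1 $ j * minor N i j) = (\<Sum>i<n. \<Sum>j<n. g (i, 0) * g (j, 1) * minor N i j)"
      by (intro sum.cong refl) (simp only: colY lessThan_iff)
    thus ?thesis using det by simp
  qed
  have L0: "0 \<le> a + b + e" using b_nonneg b_le_a e_nonneg by linarith
  note low = Apow_gaussian_lower[OF cols _ _ less_imp_le[OF \<theta>] det']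
  have b1: "\<bar>col Y 0 $ i\<bar> \<le> real n" "\<bar>col Y 1 $ i\<bar> \<le> real n" if "i < n" for i
    using bound[OF that] colY[OF that] by auto
  have YC: "Y *\<^sub>v c \<in> carrier_vec n" if "c \<in> carrier_vec 2" for c using Y that by simp
  have inj: "c = 0\<^sub>v 2" if c: "c \<in> carrier_vec 2" "Apow N (Y *\<^sub>v c) = 0\<^sub>v n" for c
  proof -
    have "l2_norm (Apow N (c $ 0 \<cdot>\<^sub>v col Y 0 + c $ 1 \<cdot>\<^sub>v col Y 1)) = 0"
      using c l2_norm_zero_iff[of "0\<^sub>v n" n] by (simp add: mult_mat_two_vec[OF Y])
    hence "\<theta> * \<bar>c $ 0\<bar> \<le> 0" "\<theta> * \<bar>c $ 1\<bar> \<le> 0"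
      using low(1)[OF b1, of "c $ 0" "c $ 1"] low(2)[OF b1, of "c $ 1" "c $ 0"] by auto
    hence "c $ 0 = 0" "c $ 1 = 0" using \<theta> by (auto simp: mult_le_0_iff)
    hence "c $ i = 0" if "i < 2" for i using less_two_cases[OF that] by auto
    thus ?thesis using c(1) by (intro eq_vecI) auto
  qed
  have close: "l2_norm (res (Apow N (Y *\<^sub>v c))) \<le> \<tau> * l2_norm (Apow N (Y *\<^sub>v c))"
    if c: "c \<in> carrier_vec 2" "l2_norm (Apow N (Y *\<^sub>v c)) > 0" for c
    unfolding \<tau>_def
  proof (rule Apow_close[OF YC[OF c(1)] r N])
    have "\<theta> * l2_norm (Y *\<^sub>v c) \<le> 4 * real n ^ 5 * (a + b + e) ^ N * l2_norm (Apow N (Y *\<^sub>v c))"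
      unfolding mult_mat_two_vec[OF Y c(1)] by (rule low(3)[OF b1])
    hence "r ^ N * (\<theta> * l2_norm (Y *\<^sub>v c)) \<le> r ^ N * (4 * real n ^ 5 * (a + b + e) ^ N * l2_norm (Apow N (Y *\<^sub>v c)))"
      using r by (intro mult_left_mono) auto
    also have "\<dots> = (4 * real n ^ 5 * (a + b + e) ^ N * r ^ N) * l2_norm (Apow N (Y *\<^sub>v c))" by simp
    also have "\<dots> < \<theta> * l2_norm (Apow N (Y *\<^sub>v c))" using rate c(2) by (intro mult_strict_right_mono)
    finally have "\<theta> * (r ^ N * l2_norm (Y *\<^sub>v c)) < \<theta> * l2_norm (Apow N (Y *\<^sub>v c))" by (simp add: mult_ac)
    thus "r ^ N * l2_norm (Y *\<^sub>v c) < l2_norm (Apow N (Y *\<^sub>v c))" using \<theta> by simp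
  qed
  have orth: "Q N \<in> carrier_mat n 2" "transpose_mat (Q N) * Q N = 1\<^sub>m 2" if "orthogonal_iterations n A Y N Q" for Q
  proof -
    obtain m where m: "N = Suc m" using N by (cases N) auto
    show "Q N \<in> carrier_mat n 2" "transpose_mat (Q N) * Q N = 1\<^sub>m 2"
      using that by (auto simp: orthogonal_iterations_def m is_qr_decomposition_def)
  qed
  obtain Q where Q: "orthogonal_iterations n A Y N Q"
    using orthogonal_iterations_exist[OF Y inj order_refl] by blast
  have Tc: "transpose_mat (Q N) * A * Q N \<in> carrier_mat 2 2" using orth(1)[OF Q] A by simp
  have "transpose_mat (transpose_mat (Q N) * A * Q N) = transpose_mat (Q N) * A * Q N"
  proof -
    have QT: "transpose_mat (Q N) \<in> carrier_mat 2 n" using orth(1)[OF Q] by simp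
    show ?thesis
      unfolding transpose_mult[OF mult_carrier_mat[OF QT A] orth(1)[OF Q]] transpose_mult[OF QT A] sym transpose_transpose
      by (rule assoc_mult_mat[OF QT A orth(1)[OF Q], symmetric])
  qed
  then obtain H d where H: "is_eigendecomposition (transpose_mat (Q N) * A * Q N) H d"
    using eigendecomposition_exists[OF Tc] by blast
  have "\<exists>i. is_arg_min d (\<lambda>i. i < (2::nat)) i"
  proof -
    have "{i. i < (2::nat)} \<noteq> {}" using pos2 by blast
    from ex_is_arg_min_if_finite[OF _ this, of d] show ?thesis by simp
  qed
  then obtain i where i: "is_arg_min d (\<lambda>i. i < (2::nat)) i" by blast
  show "\<exists>y. stage1_output n A (mat n 2 g) N y"
    unfolding stage1_output_def Y_def[symmetric] Let_def using Q H i by blast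
  assume "stage1_output n A (mat n 2 g) N y"
  then obtain Q H d i where Q: "orthogonal_iterations n A Y N Q"
    and H: "is_eigendecomposition (transpose_mat (Q N) * A * Q N) H d"
    and i: "is_arg_min d (\<lambda>i. i < (2::nat)) i"
    and y: "y = col (Q N * H) i - ((ones n \<bullet> col (Q N * H) i) / real n) \<cdot>\<^sub>v ones n"
    unfolding stage1_output_def Y_def[symmetric] Let_def by blast
  note QN = orth[OF Q]
  have QT: "transpose_mat (Q N) \<in> carrier_mat 2 n" using QN by simp
  have Hc: "H \<in> carrier_mat 2 2" and HtH: "transpose_mat H * H = 1\<^sub>m 2"
    and M: "transpose_mat (Q N) * A * Q N = H * mat_diag 2 d * transpose_mat H"
    using H by (auto simp: is_eigendecomposition_def)
  have HT: "transpose_mat H \<in> carrier_mat 2 2" using Hc by simp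
  define P where "P = Q N * H"
  have P: "P \<in> carrier_mat n 2" using QN Hc by (simp add: P_def)
  have PT: "transpose_mat P = transpose_mat H * transpose_mat (Q N)" unfolding P_def by (rule transpose_mult[OF QN(1) Hc])
  have PtP: "transpose_mat P * P = 1\<^sub>m 2"
  proof -
    have "transpose_mat P * P = transpose_mat H * (transpose_mat (Q N) * (Q N * H))"
      unfolding PT unfolding P_def by (rule assoc_mult_mat[OF HT QT mult_carrier_mat[OF QN(1) Hc]])
    also have "transpose_mat (Q N) * (Q N * H) = H"
      using assoc_mult_mat[OF QT QN(1) Hc] QN(2) Hc by simp
    finally show ?thesis using HtH by simp
  qed
  have PAP: "transpose_mat P * (A * P) = mat_diag 2 d"
  proof -
    have "transpose_mat P * (A * P) = transpose_mat H * (transpose_mat (Q N) * (A * (Q N * H)))"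
      unfolding PT unfolding P_def by (rule assoc_mult_mat[OF HT QT]) (use A QN Hc in auto)
    also have "transpose_mat (Q N) * (A * (Q N * H)) = (transpose_mat (Q N) * A * Q N) * H"
      using assoc_mult_mat[OF A QN(1) Hc] assoc_mult_mat[OF QT mult_carrier_mat[OF A QN(1)] Hc] assoc_mult_mat[OF QT A QN(1)]
      by simp
    also have "\<dots> = H * mat_diag 2 d * (transpose_mat H * H)"
      unfolding M by (rule assoc_mult_mat[OF mult_carrier_mat[OF Hc mat_diag_dim] HT Hc])
    also have "\<dots> = H * mat_diag 2 d" using HtH Hc by (simp add: right_mult_one_mat[of _ 2])
    also have "transpose_mat H * \<dots> = (transpose_mat H * H) * mat_diag 2 d"
      by (rule assoc_mult_mat[OF HT Hc mat_diag_dim, symmetric])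
    also have "\<dots> = mat_diag 2 d" unfolding HtH by (rule left_mult_one_mat[OF mat_diag_dim])
    finally show ?thesis .
  qed
  have ip: "col P j \<bullet> col P k = (if j = k then 1 else 0)" if "j < 2" "k < 2" for j k
  proof -
    have "(transpose_mat P * P) $$ (j, k) = col P j \<bullet> col P k" using P that by simp
    thus ?thesis using PtP that by simp
  qed
  have iA: "col P j \<bullet> (A *\<^sub>v col P k) = (if j = k then d k else 0)" if "j < 2" "k < 2" for j k
  proof -
    have "(transpose_mat P * (A * P)) $$ (j, k) = col P j \<bullet> col (A * P) k" using P A that by simp
    also have "col (A * P) k = A *\<^sub>v col P k" using P that by (intro col_mult2[OF A]) auto
    finally show ?thesis using PAP that by (simp add: mat_diag_def)
  qed
  have Pc: "col P k \<in> carrier_vec n" for k using col_dim[of P k] carrier_matD(1)[OF P] by simp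
  from orthogonal_iterations_span[OF Y inj Q order_refl order_refl] obtain B where
    B: "B \<in> carrier_mat 2 2" "\<And>c. c \<in> carrier_vec 2 \<Longrightarrow> Q N *\<^sub>v c = Apow N (Y *\<^sub>v (B *\<^sub>v c))" by blast
  \<comment> \<open>The columns of \<open>P\<close> are unit vectors in the image of
    \<open>Apow N\<close> on the range of \<open>Y\<close>, so their residuals are small whatever
    \<open>H\<close> is.\<close>
  have rs: "l2_norm (res (col P k)) \<le> \<tau>" if "k < 2" for k
  proof -
    have Hk: "col H k \<in> carrier_vec 2" using col_dim[of H k] carrier_matD(1)[OF Hc] by simp
    have "col P k = Q N *\<^sub>v col H k" unfolding P_def by (rule col_mult2[OF QN(1) Hc that])
    also have "\<dots> = Apow N (Y *\<^sub>v (B *\<^sub>v col H k))" by (rule B(2)[OF Hk])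
    finally have e: "col P k = Apow N (Y *\<^sub>v (B *\<^sub>v col H k))" .
    have 1: "l2_norm (col P k) = 1" using ip[OF that that] by (simp add: l2_norm_def)
    show ?thesis using close[of "B *\<^sub>v col H k"] B(1) Hk 1 unfolding e[symmetric] by auto
  qed
  have i2: "i < 2" and imin: "\<And>j. j < 2 \<Longrightarrow> d i \<le> d j" using i by (auto simp: is_arg_min_linorder)
  \<comment> \<open>The other column index; truncated subtraction is exact because
    \<open>i < 2\<close>.\<close>
  define j where "j = 1 - i"
  have j: "j < 2" "i \<noteq> j" using i2 unfolding j_def by arith+
  have \<kappa>0: "0 \<le> \<kappa>" using e_nonneg b_nonneg ba by (simp add: \<kappa>_def)
  note rv = ritz_vector[of "col P i" "col P j" \<tau>, OF Pc Pc _ _ _ _ _ rs[OF i2] rs[OF j(1)] ba, folded \<kappa>_def, OF _ _ _ _ _ small gap]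
  have rv': "1 - (\<tau>\<^sup>2 + \<kappa>) \<le> (z \<bullet> col P i)\<^sup>2 / real n" "(ones n \<bullet> col P i)\<^sup>2 / real n + (z \<bullet> col P i)\<^sup>2 / real n \<le> 1"
    using rv(2,3) ip iA i2 j imin[OF j(1)] by (simp_all add: algebra_simps)
  show "let x = (sqrt (real n) / l2_norm y) \<cdot>\<^sub>v y in
       y \<noteq> 0\<^sub>v n \<and> x \<in> carrier_vec n \<and> ones n \<bullet> x = 0 \<and> x \<bullet> x = real n \<and>
       ((l2_norm (x - z))\<^sup>2 \<le> 2 * real n * (\<tau>\<^sup>2 + \<kappa>) \<or> (l2_norm (x - (- z)))\<^sup>2 \<le> 2 * real n * (\<tau>\<^sup>2 + \<kappa>))"
    unfolding Let_def y P_def[symmetric]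
    using centered_normalized[OF Pc _ rv'] ip[OF i2 i2] small \<kappa>0 by simp
qed

end

section \<open>Anticoncentration of the Gaussian start\<close>

abbreviation std_normal :: "real measure" where
  "std_normal \<equiv> density lborel std_normal_density"

lemma prob_space_std_normal: "prob_space std_normal"
  by (rule prob_space_normal_density) simp

lemma std_normal_density_le: "std_normal_density x \<le> 1 / 2"
proof -
  have "2 \<le> sqrt (2 * pi)" using pi_gt3 by (intro real_le_rsqrt) simp
  hence "1 / sqrt (2 * pi) \<le> 1 / 2" by (simp add: field_simps)
  moreover have "exp (- x\<^sup>2 / 2) \<le> 1" by simp
  ultimately have "1 / sqrt (2 * pi) * exp (- x\<^sup>2 / 2) \<le> 1 / 2 * 1" by (intro mult_mono) auto
  thus ?thesis by (simp add: std_normal_density_def)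
qed

text \<open>The event is contained in an interval of length \<open>2 * \<delta> / |h|\<close>, and
  the density is at most \<open>1 / 2\<close>.\<close>

lemma std_normal_affine:
  assumes h: "0 < \<tau>" "\<tau> \<le> \<bar>h\<bar>" and \<delta>: "0 \<le> \<delta>"
  shows "(\<integral>\<^sup>+ y. indicator {y. \<bar>y * h + k\<bar> < \<delta>} y \<partial>std_normal) \<le> ennreal (\<delta> / \<tau>)"
proof -
  have h0: "\<bar>h\<bar> > 0" "h \<noteq> 0" using h by auto
  define lo hi where "lo = - k / h - \<delta> / \<bar>h\<bar>" and "hi = - k / h + \<delta> / \<bar>h\<bar>"
  have sub: "y \<in> {lo..hi}" if "\<bar>y * h + k\<bar> < \<delta>" for y
  proof -
    have "y * h + k = (y + k / h) * h" using h0 by (simp add: field_simps)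
    hence "\<bar>y + k / h\<bar> * \<bar>h\<bar> < \<delta>" using that by (simp add: abs_mult)
    hence "\<bar>y + k / h\<bar> < \<delta> / \<bar>h\<bar>" using h0 by (simp add: pos_less_divide_eq)
    thus ?thesis unfolding lo_def hi_def by auto
  qed
  have "(\<integral>\<^sup>+ y. indicator {y. \<bar>y * h + k\<bar> < \<delta>} y \<partial>std_normal)
      = (\<integral>\<^sup>+ y. ennreal (std_normal_density y) * indicator {y. \<bar>y * h + k\<bar> < \<delta>} y \<partial>lborel)"
    by (rule nn_integral_density) measurable
  also have "\<dots> \<le> (\<integral>\<^sup>+ y. ennreal (1 / 2) * indicator {lo..hi} y \<partial>lborel)"
    by (intro nn_integral_mono mult_mono ennreal_leI std_normal_density_le)
       (use sub in \<open>auto simp: indicator_def\<close>)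
  also have "\<dots> = ennreal (1 / 2) * emeasure lborel {lo..hi}"
    by (rule nn_integral_cmult_indicator) simp
  also have "emeasure lborel {lo..hi} = ennreal (hi - lo)"
    using \<delta> h0 by (intro emeasure_lborel_Icc) (simp add: lo_def hi_def)
  also have "hi - lo = 2 * (\<delta> / \<bar>h\<bar>)" by (simp add: lo_def hi_def)
  also have "ennreal (1 / 2) * ennreal (2 * (\<delta> / \<bar>h\<bar>)) = ennreal (1 / 2 * (2 * (\<delta> / \<bar>h\<bar>)))"
    using \<delta> by (intro ennreal_mult[symmetric]) auto
  also have "\<dots> \<le> ennreal (\<delta> / \<tau>)"
    using \<delta> h by (intro ennreal_leI) (simp add: frac_le)
  finally show ?thesis .
qed

text \<open>Chebyshev's inequality. The second moment suffices, as it will be applied with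
  \<open>t = n\<close> to \<open>2 * n\<close> entries.\<close>

lemma std_normal_large:
  assumes "0 < t"
  shows "emeasure std_normal {y. t < \<bar>y\<bar>} \<le> ennreal (1 / t\<^sup>2)"
proof -
  have m: "has_bochner_integral lborel (\<lambda>x. std_normal_density x * x\<^sup>2) 1"
    using std_normal_moment_even[of 1] by simp
  have hb: "has_bochner_integral lborel (\<lambda>x. (1 / t\<^sup>2) * (std_normal_density x * x\<^sup>2)) ((1 / t\<^sup>2) * 1)"
    by (rule has_bochner_integral_mult_right) (rule m)
  have "emeasure std_normal {y. t < \<bar>y\<bar>} = (\<integral>\<^sup>+ y. ennreal (std_normal_density y) * indicator {y. t < \<bar>y\<bar>} y \<partial>lborel)"
    by (rule emeasure_density) measurable
  also have "\<dots> \<le> (\<integral>\<^sup>+ y. ennreal ((1 / t\<^sup>2) * (std_normal_density y * y\<^sup>2)) \<partial>lborel)"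
  proof (intro nn_integral_mono)
    fix y :: real
    show "ennreal (std_normal_density y) * indicator {y. t < \<bar>y\<bar>} y \<le> ennreal ((1 / t\<^sup>2) * (std_normal_density y * y\<^sup>2))"
    proof (cases "t < \<bar>y\<bar>")
      case True
      hence "t\<^sup>2 \<le> \<bar>y\<bar>\<^sup>2" using assms by (intro power_mono) auto
      hence "1 \<le> y\<^sup>2 / t\<^sup>2" using assms by simp
      hence "std_normal_density y * 1 \<le> std_normal_density y * (y\<^sup>2 / t\<^sup>2)" by (intro mult_left_mono) auto
      thus ?thesis using True by (simp add: ennreal_leI mult.commute)
    qed simp
  qed
  also have "\<dots> = ennreal ((1 / t\<^sup>2) * 1)"
    using hb by (subst nn_integral_eq_integral) (auto simp: has_bochner_integral_iff)
  finally show ?thesis by simp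
qed

text \<open>Fubini over the coordinate \<open>i\<close>: the other coordinates fix the slope
  \<open>h\<close> and the intercept \<open>k\<close>, and the one-dimensional bound applies
  wherever the slope is at least \<open>\<tau>\<close> in absolute value. That \<open>h\<close> and
  \<open>k\<close> do not depend on \<open>x i\<close> is expressed by invariance under
  updates.\<close>

lemma PiM_affine_anticoncentration:
  fixes h k :: "('i \<Rightarrow> real) \<Rightarrow> real"
  assumes I: "finite I" "i \<in> I"
  defines "M \<equiv> PiM I (\<lambda>_. std_normal)"
  assumes meas: "h \<in> borel_measurable M" "k \<in> borel_measurable M"
    and indep: "\<And>x y. h (x(i := y)) = h x" "\<And>x y. k (x(i := y)) = k x"
    and \<tau>: "0 < \<tau>" and \<delta>: "0 \<le> \<delta>"
  shows "{x \<in> space M. \<tau> \<le> \<bar>h x\<bar> \<and> \<bar>x i * h x + k x\<bar> < \<delta>} \<in> sets M" (is "?E \<in> _")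
    and "measure M {x \<in> space M. \<tau> \<le> \<bar>h x\<bar> \<and> \<bar>x i * h x + k x\<bar> < \<delta>} \<le> \<delta> / \<tau>"
proof -
  interpret P: product_sigma_finite "\<lambda>_::'i. std_normal"
    by (simp add: product_sigma_finite_def prob_space_std_normal prob_space_imp_sigma_finite)
  have ci: "(\<lambda>x. x i) \<in> borel_measurable M"
    using measurable_component_singleton[OF I(2), of "\<lambda>_. std_normal"] by (simp add: M_def)
  note [measurable] = meas ci
  show E: "?E \<in> sets M" by measurable
  define J where "J = I - {i}"
  have J: "finite J" "i \<notin> J" "I = insert i J" using I by (auto simp: J_def)
  have PJ: "prob_space (PiM J (\<lambda>_::'i. std_normal))"
    by (intro prob_space_PiM prob_space_std_normal)
  have "emeasure M ?E = (\<integral>\<^sup>+ x. indicator ?E x \<partial>M)" using E by simp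
  also have "\<dots> = (\<integral>\<^sup>+ x. (\<integral>\<^sup>+ y. indicator ?E (x(i := y)) \<partial>std_normal) \<partial>(PiM J (\<lambda>_. std_normal)))"
    unfolding M_def J(3) by (rule P.product_nn_integral_insert) (use J E in \<open>auto simp: M_def\<close>)
  also have "\<dots> \<le> (\<integral>\<^sup>+ x. ennreal (\<delta> / \<tau>) \<partial>(PiM J (\<lambda>_. std_normal)))"
  proof (intro nn_integral_mono)
    fix x :: "'i \<Rightarrow> real"
    have hx: "h (x(i := y)) = h x" "k (x(i := y)) = k x" for y by (rule indep)+
    have "(\<integral>\<^sup>+ y. indicator ?E (x(i := y)) \<partial>std_normal)
        \<le> (\<integral>\<^sup>+ y. (if \<tau> \<le> \<bar>h x\<bar> then indicator {y. \<bar>y * h x + k x\<bar> < \<delta>} y else 0) \<partial>std_normal)"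
      by (intro nn_integral_mono) (auto simp: indicator_def hx)
    also have "\<dots> \<le> ennreal (\<delta> / \<tau>)"
      using std_normal_affine[OF \<tau> _ \<delta>, of "h x" "k x"] by (cases "\<tau> \<le> \<bar>h x\<bar>") auto
    finally show "(\<integral>\<^sup>+ y. indicator ?E (x(i := y)) \<partial>std_normal) \<le> ennreal (\<delta> / \<tau>)" .
  qed
  also have "\<dots> = ennreal (\<delta> / \<tau>)" using prob_space.emeasure_space_1[OF PJ] by simp
  finally show "measure M ?E \<le> \<delta> / \<tau>"
    using \<delta> \<tau> by (simp add: measure_def enn2real_leI)
qed

text \<open>The bilinear form is affine in the single entry \<open>g (j0, 1)\<close> with slope
  \<open>h\<close>, and \<open>h\<close> is affine in \<open>g (i0, 0)\<close> with slope
  \<open>m i0 j0\<close>. Each of the two anticoncentration steps gives up a factor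
  \<open>1 / n\<close> in size and a probability \<open>1 / n\<close>; the event that one of the
  \<open>2 * n\<close> entries exceeds \<open>n\<close> costs \<open>2 / n\<close>.\<close>

lemma gaussian_entries_good:
  fixes m :: "nat \<Rightarrow> nat \<Rightarrow> real"
  assumes n: "0 < n" and ij: "i0 < n" "j0 < n" and \<mu>: "0 < \<mu>" "\<mu> \<le> \<bar>m i0 j0\<bar>"
  shows "\<exists>G \<in> sets (gaussian_entries n). 1 - 4 / real n \<le> measure (gaussian_entries n) G \<and>
    (\<forall>g \<in> G. (\<forall>i<n. \<forall>k<2. \<bar>g (i, k)\<bar> \<le> real n) \<and>
       \<mu> / (real n)\<^sup>2 \<le> \<bar>\<Sum>i<n. \<Sum>j<n. g (i, 0) * g (j, 1) * m i j\<bar>)"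
proof -
  define I :: "(nat \<times> nat) set" where "I = {..<n} \<times> {..<2}"
  define M where "M = PiM I (\<lambda>_. std_normal)"
  have M: "gaussian_entries n = M" by (simp add: gaussian_entries_def M_def I_def)
  have fI: "finite I" by (simp add: I_def)
  interpret prob_space M unfolding M_def by (intro prob_space_PiM prob_space_std_normal)
  have c: "(\<lambda>g. g e) \<in> borel_measurable M" if "e \<in> I" for e
    using measurable_component_singleton[OF that, of "\<lambda>_. std_normal"] by (simp add: M_def)
  have c0: "(\<lambda>g. g (i, 0)) \<in> borel_measurable M" "(\<lambda>g. g (i, 1)) \<in> borel_measurable M" if "i < n" for i
    using that by (auto intro!: c simp: I_def)
  define \<delta> where "\<delta> = 1 / real n"
  have \<delta>: "0 < \<delta>" using n by (simp add: \<delta>_def)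
  define h where "h = (\<lambda>g :: nat \<times> nat \<Rightarrow> real. \<Sum>i<n. g (i, 0) * m i j0)"
  define D where "D = (\<lambda>g :: nat \<times> nat \<Rightarrow> real. \<Sum>i<n. \<Sum>j<n. g (i, 0) * g (j, 1) * m i j)"
  define k1 where "k1 = (\<lambda>g :: nat \<times> nat \<Rightarrow> real. \<Sum>i\<in>{..<n} - {i0}. g (i, 0) * m i j0)"
  define k2 where "k2 = (\<lambda>g :: nat \<times> nat \<Rightarrow> real. \<Sum>j\<in>{..<n} - {j0}. \<Sum>i<n. g (i, 0) * g (j, 1) * m i j)"
  have h_eq: "h g = g (i0, 0) * m i0 j0 + k1 g" for g
    unfolding h_def k1_def using ij by (subst sum.remove[of _ i0]) auto
  have D_eq: "D g = g (j0, 1) * h g + k2 g" for g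
  proof -
    have "D g = (\<Sum>j<n. \<Sum>i<n. g (i, 0) * g (j, 1) * m i j)" unfolding D_def by (rule sum.swap)
    also have "\<dots> = (\<Sum>i<n. g (i, 0) * g (j0, 1) * m i j0) + k2 g"
      unfolding k2_def using ij by (subst sum.remove[of _ j0]) auto
    finally show ?thesis unfolding h_def by (simp add: sum_distrib_left mult_ac)
  qed
  have meas: "h \<in> borel_measurable M" "k1 \<in> borel_measurable M" "k2 \<in> borel_measurable M" "D \<in> borel_measurable M"
    unfolding h_def k1_def k2_def D_def using c0
    by (auto intro!: borel_measurable_sum borel_measurable_times)
  define E1 where "E1 = {g \<in> space M. \<bar>h g\<bar> < \<delta> * \<mu>}"
  define E2 where "E2 = {g \<in> space M. \<delta> * \<mu> \<le> \<bar>h g\<bar> \<and> \<bar>D g\<bar> < \<delta> * (\<delta> * \<mu>)}"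
  define B where "B = (\<lambda>e. {g \<in> space M. real n < \<bar>g e\<bar>})"
  have E1: "E1 \<in> sets M" "prob E1 \<le> \<delta>"
  proof -
    have eq: "E1 = {x \<in> space M. \<mu> \<le> \<bar>m i0 j0\<bar> \<and> \<bar>x (i0, 0) * m i0 j0 + k1 x\<bar> < \<delta> * \<mu>}"
      using \<mu> by (auto simp: E1_def h_eq)
    have i0: "(i0, 0) \<in> I" using ij by (simp add: I_def)
    have ind: "k1 (x((i0, 0) := y)) = k1 x" for x y
      unfolding k1_def by (intro sum.cong) auto
    note A = PiM_affine_anticoncentration[OF fI i0, of "\<lambda>_. m i0 j0" k1 \<mu> "\<delta> * \<mu>", folded M_def, OF _ meas(2) refl ind \<mu>(1)]
    show "E1 \<in> sets M" "prob E1 \<le> \<delta>" unfolding eq using A \<mu> \<delta> by auto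
  qed
  have E2: "E2 \<in> sets M" "prob E2 \<le> \<delta>"
  proof -
    have j0: "(j0, 1) \<in> I" using ij by (simp add: I_def)
    have ind: "h (x((j0, 1) := y)) = h x" "k2 (x((j0, 1) := y)) = k2 x" for x y
      unfolding h_def k2_def by (intro sum.cong, auto)+
    note A = PiM_affine_anticoncentration[OF fI j0, of h k2 "\<delta> * \<mu>" "\<delta> * (\<delta> * \<mu>)", folded M_def, OF meas(1,3) ind]
    show "E2 \<in> sets M" "prob E2 \<le> \<delta>" unfolding E2_def D_eq using A \<mu> \<delta> by auto
  qed
  have B: "B e \<in> sets M" "prob (B e) \<le> 1 / (real n)\<^sup>2" if e: "e \<in> I" for e
  proof -
    note [measurable] = c[OF e]
    show s: "B e \<in> sets M" unfolding B_def by measurable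
    have "B e = (\<lambda>g. g e) -` {y. real n < \<bar>y\<bar>} \<inter> space M" by (auto simp: B_def)
    hence "emeasure M (B e) = emeasure (distr M std_normal (\<lambda>g. g e)) {y. real n < \<bar>y\<bar>}"
      by (subst emeasure_distr)
         (use measurable_component_singleton[OF e, of "\<lambda>_. std_normal"] in \<open>simp_all add: M_def\<close>)
    also have "distr M std_normal (\<lambda>g. g e) = std_normal"
      unfolding M_def by (rule distr_PiM_component[OF prob_space_std_normal e])
    also have "emeasure std_normal {y. real n < \<bar>y\<bar>} \<le> ennreal (1 / (real n)\<^sup>2)"
      using n by (intro std_normal_large) simp
    finally show "prob (B e) \<le> 1 / (real n)\<^sup>2" by (simp add: measure_def enn2real_leI)
  qed
  have BU: "(\<Union>e\<in>I. B e) \<in> sets M" using B(1) fI by auto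
  have "prob (\<Union>e\<in>I. B e) \<le> (\<Sum>e\<in>I. prob (B e))"
    using B(1) fI by (intro finite_measure_subadditive_finite) auto
  also have "\<dots> \<le> (\<Sum>e\<in>I. 1 / (real n)\<^sup>2)" by (intro sum_mono B(2))
  also have "\<dots> = 2 * \<delta>" using n by (simp add: I_def \<delta>_def power2_eq_square)
  finally have PB: "prob (\<Union>e\<in>I. B e) \<le> 2 * \<delta>" .
  define Bad where "Bad = E1 \<union> E2 \<union> (\<Union>e\<in>I. B e)"
  have Bad: "Bad \<in> sets M" using E1 E2 BU by (auto simp: Bad_def)
  have "prob Bad \<le> prob (E1 \<union> E2) + prob (\<Union>e\<in>I. B e)"
    unfolding Bad_def using E1 E2 BU by (intro measure_Un_le) auto
  also have "prob (E1 \<union> E2) \<le> prob E1 + prob E2" using E1 E2 by (intro measure_Un_le) auto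
  finally have PBad: "prob Bad \<le> 4 * \<delta>" using E1(2) E2(2) PB by linarith
  define G where "G = space M - Bad"
  have G: "G \<in> sets M" using Bad by (auto simp: G_def)
  have "prob G = 1 - prob Bad" unfolding G_def using Bad by (rule prob_compl)
  hence PG: "1 - 4 / real n \<le> prob G" using PBad by (simp add: \<delta>_def)
  have good: "(\<forall>i<n. \<forall>k<2. \<bar>g (i, k)\<bar> \<le> real n) \<and> \<mu> / (real n)\<^sup>2 \<le> \<bar>\<Sum>i<n. \<Sum>j<n. g (i, 0) * g (j, 1) * m i j\<bar>"
    if "g \<in> G" for g
  proof -
    have g: "g \<in> space M" "g \<notin> E1" "g \<notin> E2" "\<And>e. e \<in> I \<Longrightarrow> g \<notin> B e" using that by (auto simp: G_def Bad_def)
    have "\<bar>g (i, k)\<bar> \<le> real n" if "i < n" "k < 2" for i k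
      using g(1) g(4)[of "(i, k)"] that by (auto simp: B_def I_def)
    moreover have "\<delta> * (\<delta> * \<mu>) \<le> \<bar>D g\<bar>" using g(1,2,3) by (auto simp: E1_def E2_def not_less)
    hence "\<mu> / (real n)\<^sup>2 \<le> \<bar>D g\<bar>" by (simp add: \<delta>_def power2_eq_square)
    ultimately show ?thesis unfolding D_def by blast
  qed
  show ?thesis unfolding M using G PG good by blast
qed

section \<open>Chernoff bounds for the adjacency matrix\<close>

text \<open>The parameter of the exponential moment is absorbed into the weights \<open>w\<close>,
  which may differ in size and sign; Markov's inequality and \<open>1 + y \<le> exp y\<close> for
  each factor do the rest.\<close>

lemma bernoulli_chernoff:
  fixes p w :: "'e \<Rightarrow> real"
  assumes I: "finite I" "J \<subseteq> I" and p: "\<And>e. e \<in> I \<Longrightarrow> 0 \<le> p e \<and> p e \<le> 1"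
  shows "measure_pmf.prob (Pi_pmf I False (\<lambda>e. bernoulli_pmf (p e))) {x. t \<le> (\<Sum>e\<in>J. w e * of_bool (x e))}
     \<le> exp (- t + (\<Sum>e\<in>J. p e * (exp (w e) - 1)))"
proof -
  define P where "P = Pi_pmf I False (\<lambda>e. bernoulli_pmf (p e))"
  \<comment> \<open>Weight 0 outside \<open>J\<close> lets the product formula run over the whole
    index set.\<close>
  define w' where "w' = (\<lambda>e. if e \<in> J then w e else 0)"
  define X where "X = (\<lambda>x :: 'e \<Rightarrow> bool. \<Sum>e\<in>I. w' e * of_bool (x e))"
  have X: "(\<Sum>e\<in>J. w e * of_bool (x e)) = X x" for x
    unfolding X_def w'_def using I by (intro sum.mono_neutral_cong_left) auto
  have "finite (set_pmf P)" unfolding P_def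
    by (rule finite_subset[OF set_Pi_pmf_subset'[OF I(1)]]) (auto intro!: finite_PiE_dflt I)
  hence int: "integrable (measure_pmf P) f" for f :: "_ \<Rightarrow> real" by (rule integrable_measure_pmf_finite)
  have "measure_pmf.prob P {x \<in> space (measure_pmf P). exp (X x) \<ge> exp t} \<le> measure_pmf.expectation P (\<lambda>x. exp (X x)) / exp t"
    by (rule integral_Markov_inequality_measure[where A = "{}"]) (auto simp: int)
  also have "measure_pmf.expectation P (\<lambda>x. exp (X x)) = measure_pmf.expectation P (\<lambda>x. \<Prod>e\<in>I. exp (w' e * of_bool (x e)))"
    unfolding X_def by (simp only: exp_sum[OF I(1)])
  also have "\<dots> = (\<Prod>e\<in>I. measure_pmf.expectation (bernoulli_pmf (p e)) (\<lambda>b. exp (w' e * of_bool b)))"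
    unfolding P_def by (rule expectation_prod_Pi_pmf[OF I(1)]) (auto intro!: integrable_measure_pmf_finite)
  also have "\<dots> \<le> (\<Prod>e\<in>I. exp (p e * (exp (w' e) - 1)))"
  proof (intro prod_mono conjI)
    fix e assume e: "e \<in> I"
    have "measure_pmf.expectation (bernoulli_pmf (p e)) (\<lambda>b. exp (w' e * of_bool b)) = 1 + p e * (exp (w' e) - 1)"
      using p[OF e] by (simp add: algebra_simps)
    thus "measure_pmf.expectation (bernoulli_pmf (p e)) (\<lambda>b. exp (w' e * of_bool b)) \<le> exp (p e * (exp (w' e) - 1))"
      using exp_ge_add_one_self[of "p e * (exp (w' e) - 1)"] by simp
  qed simp
  also have "\<dots> = exp (\<Sum>e\<in>I. p e * (exp (w' e) - 1))" using I(1) by (simp add: exp_sum)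
  also have "(\<Sum>e\<in>I. p e * (exp (w' e) - 1)) = (\<Sum>e\<in>J. p e * (exp (w e) - 1))"
    unfolding w'_def using I by (intro sum.mono_neutral_cong_right) auto
  finally show ?thesis by (simp add: P_def X exp_diff exp_minus exp_add field_simps divide_right_mono)
qed

text \<open>A second-order remainder with a crude constant, which follows from the tangent bound
  \<open>1 + x \<le> exp x\<close> alone.\<close>

lemma exp_minus_linear_le: "exp x - 1 - x \<le> x\<^sup>2 * exp \<bar>x\<bar>" for x :: real
proof -
  have up: "exp x - 1 \<le> x * exp x"
  proof -
    have "(1 - x) * exp x \<le> exp (- x) * exp x"
      using exp_ge_add_one_self[of "- x"] by (intro mult_right_mono) auto
    thus ?thesis by (simp add: exp_minus algebra_simps)
  qed
  show ?thesis
  proof (cases "0 \<le> x")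
    case True
    have "exp x - 1 - x \<le> x * (exp x - 1)" using up by (simp add: algebra_simps)
    also have "\<dots> \<le> x * (x * exp x)" using True up by (intro mult_left_mono)
    finally show ?thesis using True by (simp add: power2_eq_square)
  next
    case False
    have "exp x - 1 - x \<le> x * (exp x - 1)" using up by (simp add: algebra_simps)
    also have "\<dots> = (- x) * (1 - exp x)" by (simp add: algebra_simps)
    also have "\<dots> \<le> (- x) * (- x)"
    proof (rule mult_left_mono)
      show "1 - exp x \<le> - x" using exp_ge_add_one_self[of x] by linarith
    qed (use False in simp)
    also have "\<dots> = x\<^sup>2 * 1" by (simp add: power2_eq_square)
    also have "\<dots> \<le> x\<^sup>2 * exp \<bar>x\<bar>" by (intro mult_left_mono) auto
    finally show ?thesis .
  qed
qed

text \<open>Comparison with the generating function: for \<open>0 < x \<le> 1\<close>, the count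
  times \<open>x ^ t\<close> is at most the sum of \<open>x ^ card S\<close> over all subsets, which
  is \<open>(1 + x) ^ n\<close>. The choice \<open>x = t / n\<close> gives the familiar bound
  \<open>(e n / t)^t\<close>.\<close>

lemma card_subsets_le:
  assumes t: "0 < t" "t \<le> n"
  shows "real (card {S. S \<subseteq> {..<n} \<and> card S \<le> t}) \<le> exp (real t * (1 + ln (real n / real t)))"
proof -
  have pw: "(\<Sum>S\<in>Pow A. x ^ card S) = (1 + x) ^ card A" if "finite A" for A :: "nat set" and x :: real
    using that
  proof (induction A)
    case (insert i A)
    have inj: "inj_on (insert i) (Pow A)" using insert by (intro inj_onI) (auto dest: insert_ident[THEN iffD1, rotated 2])
    have "(\<Sum>S\<in>Pow (insert i A). x ^ card S) = (\<Sum>S\<in>Pow A. x ^ card S) + (\<Sum>S\<in>insert i ` Pow A. x ^ card S)"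
      unfolding Pow_insert using insert by (intro sum.union_disjoint) auto
    also have "(\<Sum>S\<in>insert i ` Pow A. x ^ card S) = (\<Sum>S\<in>Pow A. x ^ card (insert i S))"
      by (simp add: sum.reindex[OF inj])
    also have "\<dots> = (\<Sum>S\<in>Pow A. x * x ^ card S)"
    proof (intro sum.cong refl)
      fix S assume "S \<in> Pow A"
      hence "finite S" "i \<notin> S" using insert finite_subset by auto
      thus "x ^ card (insert i S) = x * x ^ card S" by simp
    qed
    finally show ?case using insert by (simp add: sum_distrib_left[symmetric] algebra_simps)
  qed simp
  define x where "x = real t / real n"
  have x: "0 < x" "x \<le> 1" using t by (auto simp: x_def)
  define F where "F = {S. S \<subseteq> {..<n} \<and> card S \<le> t}"
  have "real (card F) * x ^ t = (\<Sum>S\<in>F. x ^ t)" by simp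
  also have "\<dots> \<le> (\<Sum>S\<in>F. x ^ card S)"
    using x by (intro sum_mono power_decreasing) (auto simp: F_def)
  also have "\<dots> \<le> (\<Sum>S\<in>Pow {..<n}. x ^ card S)" using x by (intro sum_mono2) (auto simp: F_def)
  also have "\<dots> = (1 + x) ^ n" using pw by simp
  also have "\<dots> \<le> exp x ^ n" using x by (intro power_mono exp_ge_add_one_self) auto
  also have "\<dots> = exp (real t)" using t by (simp add: exp_of_nat_mult[symmetric] x_def)
  finally have "real (card F) \<le> exp (real t) / x ^ t" using x by (simp add: field_simps)
  also have "x ^ t = exp (- (real t * ln (real n / real t)))"
  proof -
    have "x = exp (- ln (real n / real t))" using t x by (simp add: x_def exp_minus)
    thus ?thesis by (metis exp_of_nat_mult mult_minus_right)
  qed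
  also have "exp (real t) / \<dots> = exp (real t * (1 + ln (real n / real t)))"
    by (simp add: exp_diff[symmetric] algebra_simps)
  finally show ?thesis by (simp add: F_def)
qed

text \<open>Even the smallest sets have entropy of at least \<open>ln n\<close>, so an exponentially
  small bound in the entropy is polynomially small in \<open>n\<close> uniformly in the size
  \<open>t\<close>.\<close>

lemma times_one_plus_ln_ratio_ge:
  assumes "0 < t" "t \<le> n"
  shows "ln (real n) \<le> real t * (1 + ln (real n / real t))"
proof -
  have a: "0 \<le> (real t - 1) * (ln (real n) - ln (real t))" using assms by (intro mult_nonneg_nonneg) auto
  have "ln (real t) \<le> real t - 1" using assms ln_le_minus_one[of "real t"] by simp
  moreover have eq: "ln (real n / real t) = ln (real n) - ln (real t)" using assms by (simp add: ln_div)
  ultimately show ?thesis using a unfolding eq by (simp add: algebra_simps)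
qed

section \<open>Centred adjacency entries and their tails\<close>

definition edges :: "nat \<Rightarrow> (nat \<times> nat) set" where
  "edges n = {(i, j). i \<le> j \<and> j < n}"

text \<open>Entries \<open>(i, j)\<close> and \<open>(j, i)\<close> of the matrix refer to the same
  independent variable, indexed by the sorted pair.\<close>

definition edge :: "nat \<Rightarrow> nat \<Rightarrow> nat \<times> nat" where
  "edge i j = (min i j, max i j)"

lemma finite_edges [simp]: "finite (edges n)"
  by (rule finite_subset[of _ "{..<n} \<times> {..<n}"]) (auto simp: edges_def)

lemma edge_commute: "edge i j = edge j i"
  by (simp add: edge_def min.commute max.commute)

lemma edge_in_edges: "i < n \<Longrightarrow> j < n \<Longrightarrow> edge i j \<in> edges n"
  by (auto simp: edge_def edges_def)

lemma edge_eq_iff: "edge i j = edge k l \<longleftrightarrow> (i = k \<and> j = l) \<or> (i = l \<and> j = k)"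
  by (auto simp: edge_def min_def max_def split: if_splits)

locale edge_model =
  fixes n :: nat and pr :: "nat \<times> nat \<Rightarrow> real" and pb :: real
  assumes pr: "\<And>e. e \<in> edges n \<Longrightarrow> 0 \<le> pr e \<and> pr e \<le> pb" and pb: "pb \<le> 1"
begin

definition model :: "(nat \<times> nat \<Rightarrow> bool) pmf" where
  "model = Pi_pmf (edges n) False (\<lambda>e. bernoulli_pmf (pr e))"

definition noise :: "(nat \<times> nat \<Rightarrow> bool) \<Rightarrow> nat \<Rightarrow> nat \<Rightarrow> real" where
  "noise a i j = of_bool (a (edge i j)) - pr (edge i j)"

text \<open>If \<open>S\<close> and \<open>T\<close> overlap, an edge may be hit twice; its
  multiplicity \<open>m e\<close> is 0, 1 or 2. The multiplicities become the Chernoff weights: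
  bounding them by 2 yields the factor 2 and \<open>exp (2 * \<nu>)\<close>, and their sum is the
  size of the rectangle.\<close>

lemma rectangle_tail:
  assumes S: "S \<subseteq> {..<n}" and T: "T \<subseteq> {..<n}" and \<sigma>: "\<sigma> \<in> {-1, 1}" and \<nu>: "0 \<le> \<nu>"
  shows "measure_pmf.prob model {a. \<tau> \<le> \<sigma> * (\<Sum>i\<in>S. \<Sum>j\<in>T. noise a i j)}
     \<le> exp (- (\<nu> * \<tau>) + 2 * pb * (real (card S) * real (card T)) * \<nu>\<^sup>2 * exp (2 * \<nu>))"
proof -
  define D where "D = S \<times> T"
  define ed where "ed = (\<lambda>(i, j). edge i j)"
  define m where "m = (\<lambda>e. real (card {x \<in> D. ed x = e}))"
  have fin: "finite S" "finite T" "finite D"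
    using finite_subset[OF S] finite_subset[OF T] by (auto simp: D_def)
  have sub: "ed ` D \<subseteq> edges n" using S T by (auto simp: ed_def D_def intro!: edge_in_edges)
  have grp: "(\<Sum>i\<in>S. \<Sum>j\<in>T. f (edge i j)) = (\<Sum>e\<in>edges n. m e * f e)" for f :: "_ \<Rightarrow> real"
  proof -
    have "(\<Sum>i\<in>S. \<Sum>j\<in>T. f (edge i j)) = (\<Sum>x\<in>D. f (ed x))"
      unfolding D_def ed_def by (subst sum.cartesian_product) (simp add: case_prod_unfold)
    also have "\<dots> = (\<Sum>e\<in>edges n. \<Sum>x\<in>{x \<in> D. ed x = e}. f (ed x))"
      by (rule sum.group[symmetric, OF fin(3) finite_edges sub])
    also have "\<dots> = (\<Sum>e\<in>edges n. m e * f e)"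
      unfolding m_def by (intro sum.cong refl) simp
    finally show ?thesis .
  qed
  have m2: "m e \<le> 2" for e
  proof -
    have "{x \<in> D. ed x = e} \<subseteq> {e, (snd e, fst e)}"
      by (auto simp: ed_def edge_def min_def max_def split: if_splits)
    hence "card {x \<in> D. ed x = e} \<le> card {e, (snd e, fst e)}" by (intro card_mono) auto
    also have "\<dots> \<le> 2" by (simp add: card_insert_if)
    finally show ?thesis by (simp add: m_def)
  qed
  have m0: "0 \<le> m e" for e by (simp add: m_def)
  have sm: "(\<Sum>e\<in>edges n. m e) = real (card S) * real (card T)" using grp[of "\<lambda>_. 1"] by simp
  have \<sigma>2: "\<sigma> * \<sigma> = 1" "\<bar>\<sigma>\<bar> = 1" using \<sigma> by auto
  define E where "E = (\<Sum>e\<in>edges n. m e * pr e)"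
  have sub2: "{a. \<tau> \<le> \<sigma> * (\<Sum>i\<in>S. \<Sum>j\<in>T. noise a i j)}
     \<subseteq> {a. \<nu> * \<tau> + \<sigma> * \<nu> * E \<le> (\<Sum>e\<in>edges n. (\<sigma> * \<nu> * m e) * of_bool (a e))}"
  proof
    fix a assume "a \<in> {a. \<tau> \<le> \<sigma> * (\<Sum>i\<in>S. \<Sum>j\<in>T. noise a i j)}"
    hence le: "\<tau> \<le> \<sigma> * (\<Sum>e\<in>edges n. m e * (of_bool (a e) - pr e))" unfolding noise_def grp[symmetric] by simp
    define s where "s = (\<Sum>e\<in>edges n. m e * of_bool (a e))"
    note le
    also have "\<sigma> * (\<Sum>e\<in>edges n. m e * (of_bool (a e) - pr e)) = \<sigma> * (s - E)"
      unfolding E_def s_def right_diff_distrib sum_subtractf ..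
    finally have "\<nu> * \<tau> \<le> \<nu> * (\<sigma> * (s - E))" using \<nu> by (intro mult_left_mono)
    moreover have "(\<Sum>e\<in>edges n. (\<sigma> * \<nu> * m e) * of_bool (a e)) = \<nu> * \<sigma> * s"
      unfolding s_def sum_distrib_left by (intro sum.cong refl) (simp only: mult_ac)
    ultimately show "a \<in> {a. \<nu> * \<tau> + \<sigma> * \<nu> * E \<le> (\<Sum>e\<in>edges n. (\<sigma> * \<nu> * m e) * of_bool (a e))}"
      by (simp only: mem_Collect_eq) (simp add: algebra_simps)
  qed
  have "measure_pmf.prob model {a. \<tau> \<le> \<sigma> * (\<Sum>i\<in>S. \<Sum>j\<in>T. noise a i j)}
     \<le> measure_pmf.prob model {a. \<nu> * \<tau> + \<sigma> * \<nu> * E \<le> (\<Sum>e\<in>edges n. (\<sigma> * \<nu> * m e) * of_bool (a e))}"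
    by (rule measure_pmf.finite_measure_mono[OF sub2]) simp
  also have "\<dots> \<le> exp (- (\<nu> * \<tau> + \<sigma> * \<nu> * E) + (\<Sum>e\<in>edges n. pr e * (exp (\<sigma> * \<nu> * m e) - 1)))"
    unfolding model_def by (rule bernoulli_chernoff) (use pr pb in \<open>force+\<close>)
  also have "- (\<nu> * \<tau> + \<sigma> * \<nu> * E) + (\<Sum>e\<in>edges n. pr e * (exp (\<sigma> * \<nu> * m e) - 1))
     = - (\<nu> * \<tau>) + (\<Sum>e\<in>edges n. pr e * (exp (\<sigma> * \<nu> * m e) - 1 - \<sigma> * \<nu> * m e))"
    unfolding E_def by (simp add: right_diff_distrib sum_subtractf sum_distrib_left mult_ac)
  also have "(\<Sum>e\<in>edges n. pr e * (exp (\<sigma> * \<nu> * m e) - 1 - \<sigma> * \<nu> * m e)) \<le> (\<Sum>e\<in>edges n. pb * (2 * m e * \<nu>\<^sup>2 * exp (2 * \<nu>)))"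
  proof (intro sum_mono mult_mono)
    fix e assume e: "e \<in> edges n"
    have "exp (\<sigma> * \<nu> * m e) - 1 - \<sigma> * \<nu> * m e \<le> (\<sigma> * \<nu> * m e)\<^sup>2 * exp \<bar>\<sigma> * \<nu> * m e\<bar>"
      by (rule exp_minus_linear_le)
    also have "\<bar>\<sigma> * \<nu> * m e\<bar> = \<nu> * m e" using \<sigma>2 \<nu> m0[of e] by (simp add: abs_mult)
    also have "(\<sigma> * \<nu> * m e)\<^sup>2 = (\<sigma> * \<sigma>) * (m e * m e * \<nu>\<^sup>2)"
      by (simp add: power2_eq_square mult_ac)
    also have "\<dots> = m e * m e * \<nu>\<^sup>2" by (simp only: \<sigma>2(1) mult_1_left)
    also have "m e * m e * \<nu>\<^sup>2 * exp (\<nu> * m e) \<le> 2 * m e * \<nu>\<^sup>2 * exp (2 * \<nu>)"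
    proof -
      have "m e * m e \<le> 2 * m e" by (rule mult_right_mono[OF m2 m0])
      hence 1: "m e * m e * \<nu>\<^sup>2 \<le> 2 * m e * \<nu>\<^sup>2" by (rule mult_right_mono) simp
      have 2: "exp (\<nu> * m e) \<le> exp (2 * \<nu>)"
        using mult_left_mono[OF m2[of e] \<nu>] by (simp add: mult.commute)
      show ?thesis using m0[of e] by (intro mult_mono[OF 1 2]) auto
    qed
    finally show "exp (\<sigma> * \<nu> * m e) - 1 - \<sigma> * \<nu> * m e \<le> 2 * m e * \<nu>\<^sup>2 * exp (2 * \<nu>)" .
    show "0 \<le> exp (\<sigma> * \<nu> * m e) - 1 - \<sigma> * \<nu> * m e" using exp_ge_add_one_self[of "\<sigma> * \<nu> * m e"] by linarith
    show "pr e \<le> pb" "0 \<le> pb" using pr[OF e] by auto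
  qed
  also have "\<dots> = 2 * pb * (real (card S) * real (card T)) * \<nu>\<^sup>2 * exp (2 * \<nu>)"
    unfolding sm[symmetric] by (simp add: sum_distrib_left sum_distrib_right mult_ac)
  finally show ?thesis by simp
qed

text \<open>Within one row no edge repeats. The exponent is kept as an explicit sum, without a
  quadratic estimate, because the sharp recovery threshold is read off from it.\<close>

lemma row_tail:
  assumes i: "i < n"
  shows "measure_pmf.prob model {a. t \<le> (\<Sum>j<n. \<gamma> j * of_bool (a (edge i j)))}
     \<le> exp (- t + (\<Sum>j<n. pr (edge i j) * (exp (\<gamma> j) - 1)))"
proof -
  define J where "J = edge i ` {..<n}"
  \<comment> \<open>The weight is indexed by the endpoint of \<open>e\<close> other than
    \<open>i\<close>; for the loop this is \<open>i\<close> itself.\<close>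
  define w where "w = (\<lambda>e. \<gamma> (if fst e = i then snd e else fst e))"
  have inj: "inj_on (edge i) {..<n}" by (auto intro!: inj_onI simp: edge_eq_iff)
  have J: "J \<subseteq> edges n" using i by (auto simp: J_def intro!: edge_in_edges)
  have w: "w (edge i j) = \<gamma> j" for j by (auto simp: w_def edge_def min_def max_def)
  have r: "(\<Sum>e\<in>J. f e) = (\<Sum>j<n. f (edge i j))" for f :: "_ \<Rightarrow> real"
    unfolding J_def by (simp add: sum.reindex[OF inj])
  have "measure_pmf.prob model {a. t \<le> (\<Sum>e\<in>J. w e * of_bool (a e))} \<le> exp (- t + (\<Sum>e\<in>J. pr e * (exp (w e) - 1)))"
    unfolding model_def by (rule bernoulli_chernoff[OF finite_edges J]) (use pr pb in force)
  thus ?thesis unfolding r w .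
qed

end

context edge_model
begin

lemma noise_commute: "noise a i j = noise a j i"
  by (simp add: noise_def edge_commute)

text \<open>Throughout, \<open>u\<close> stands for the fourth root of \<open>ln n\<close>. The exponent \<open>\<nu> = l / u\<^sup>2\<close> of the Chernoff bound
  is matched to the entropy \<open>t l\<close> of the choice of \<open>T\<close>. When \<open>T\<close> is much larger than \<open>S\<close> the
  entropy wins, and the bound on the row sums is used instead.\<close>
lemma rectangle_tail_log:
  assumes n: "0 < n" and u: "2 \<le> u" and \<alpha>: "0 \<le> \<alpha>" and pb_eq: "pb = \<alpha> * u ^ 4 / real n"
    and S: "S \<subseteq> {..<n}" and T: "T \<subseteq> {..<n}"
    and st: "card S \<le> card T" "0 < card T" "real (card T) \<le> u\<^sup>2 * real (card S)"
  defines "K \<equiv> 12 + 20 * \<alpha>"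
  shows "measure_pmf.prob model {a. K * u ^ 3 * sqrt (real (card S) * real (card T)) \<le> \<bar>\<Sum>i\<in>S. \<Sum>j\<in>T. noise a i j\<bar>}
     \<le> 2 * exp (- 6 * (real (card T) * (1 + ln (real n / real (card T)))))"
proof -
  define s t where "s = real (card S)" and "t = real (card T)"
  define q where "q = sqrt (s * t)"
  define l where "l = 1 + ln (real n / t)"
  define \<nu> where "\<nu> = l / u\<^sup>2"
  have u0: "u > 0" using u by simp
  have tn: "t \<le> real n" using card_mono[OF _ T] by (simp add: t_def)
  have t0: "t > 0" and s0: "0 \<le> s" and s_le: "s \<le> t" and tu: "t \<le> u\<^sup>2 * s" using st by (auto simp: t_def s_def)
  have l1: "1 \<le> l" using tn t0 by (simp add: l_def)
  have \<nu>0: "0 \<le> \<nu>" using l1 by (simp add: \<nu>_def)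
  have q2: "q * q = s * t" using s0 t0 by (simp add: q_def)
  have q0: "0 \<le> q" using s0 t0 by (simp add: q_def)
  have qt: "q \<le> t" unfolding q_def using s_le s0 t0 by (intro real_le_lsqrt) (auto simp: power2_eq_square mult_right_mono)
  \<comment> \<open>The entropy is measured in \<open>t\<close> and the deviation in
    \<open>q\<close>; the bounded imbalance of the rectangle relates them at the cost of a factor
    \<open>u\<close>.\<close>
  have uq: "t \<le> u * q"
  proof (rule power2_le_imp_le)
    have "t\<^sup>2 \<le> (u\<^sup>2 * s) * t" using tu t0 by (simp add: power2_eq_square)
    also have "\<dots> = (u * q)\<^sup>2" using q2 by (simp add: power2_eq_square mult_ac)
    finally show "t\<^sup>2 \<le> (u * q)\<^sup>2" .
  qed (use u0 q0 in simp)
  \<comment> \<open>The density \<open>t / n\<close> decays like \<open>exp (- l)\<close>, which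
    pays for \<open>exp (2 * \<nu>)\<close> and for the extra factor \<open>l\<close> in the
    variance term.\<close>
  have tn_exp: "t / real n = exp (1 - l)" using n t0 by (simp add: l_def ln_div exp_diff)
  have \<nu>l: "2 * \<nu> \<le> l / 2"
  proof -
    have "4 \<le> u\<^sup>2" using power_mono[OF u, of 2] by simp
    hence "l / u\<^sup>2 \<le> l / 4" using l1 by (intro divide_left_mono) auto
    thus ?thesis unfolding \<nu>_def by linarith
  qed
  have le: "l \<le> exp (l / 2)"
  proof -
    have "l / 2 \<le> exp (l / 2 - 1)" using exp_ge_add_one_self[of "l / 2 - 1"] by simp
    hence "2 * (l / 2) \<le> exp 1 * exp (l / 2 - 1)" using exp_ge_add_one_self[of 1] l1 by (intro mult_mono) auto
    thus ?thesis by (simp add: exp_add[symmetric])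
  qed
  have "2 * pb * (s * t) * \<nu>\<^sup>2 * exp (2 * \<nu>) = 2 * \<alpha> * (q * q) * l\<^sup>2 / real n * exp (2 * \<nu>)"
    unfolding pb_eq \<nu>_def q2 using u0 by (simp add: power_divide)
  also have "\<dots> = (l * q) * (2 * \<alpha>) * ((q / real n) * (l * exp (2 * \<nu>)))"
    by (simp add: power2_eq_square)
  also have "\<dots> \<le> (l * q) * (2 * \<alpha>) * 3"
  proof (intro mult_left_mono)
    have "(q / real n) * (l * exp (2 * \<nu>)) \<le> exp (1 - l) * (exp (l / 2) * exp (l / 2))"
      using qt \<nu>l l1 q0 le n unfolding tn_exp[symmetric] by (intro mult_mono) (auto intro: divide_right_mono)
    also have "\<dots> = exp 1" by (simp add: exp_add[symmetric])
    also have "\<dots> \<le> 3" by (rule exp_le)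
    finally show "(q / real n) * (l * exp (2 * \<nu>)) \<le> 3" .
  qed (use \<alpha> l1 q0 in auto)
  also have "\<dots> \<le> (l * (u * q)) * (6 * \<alpha>)"
    using u \<alpha> l1 q0 mult_right_mono[of 1 u q] by (simp add: mult_left_mono mult.commute mult.left_commute)
  finally have var: "2 * pb * (s * t) * \<nu>\<^sup>2 * exp (2 * \<nu>) \<le> (l * (u * q)) * (6 * \<alpha>)" .
  have dev: "\<nu> * (K * u ^ 3 * q) = K * (l * (u * q))" using u0 by (simp add: \<nu>_def power2_eq_square power3_eq_cube)
  have "- (\<nu> * (K * u ^ 3 * q)) + 2 * pb * (s * t) * \<nu>\<^sup>2 * exp (2 * \<nu>) \<le> - ((K - 6 * \<alpha>) * (l * (u * q)))"
    unfolding dev using var by (simp add: algebra_simps)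
  \<comment> \<open>The variance term takes \<open>6 * \<alpha>\<close> out of \<open>K\<close>, and
    at least 6 remains for the entropy.\<close>
  also have "\<dots> \<le> - (6 * (l * t))"
  proof -
    have "6 * (l * t) \<le> (K - 6 * \<alpha>) * (l * (u * q))"
      using \<alpha> l1 uq t0 by (intro mult_mono) (auto simp: K_def)
    thus ?thesis by simp
  qed
  finally have ex: "- (\<nu> * (K * u ^ 3 * q)) + 2 * pb * (s * t) * \<nu>\<^sup>2 * exp (2 * \<nu>) \<le> - 6 * (t * l)"
    by (simp add: mult.commute)
  have each: "measure_pmf.prob model {a. K * u ^ 3 * q \<le> \<sigma> * (\<Sum>i\<in>S. \<Sum>j\<in>T. noise a i j)} \<le> exp (- 6 * (t * l))"
    if "\<sigma> \<in> {-1, 1}" for \<sigma>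
    using rectangle_tail[OF S T that \<nu>0, of "K * u ^ 3 * q"] ex unfolding s_def[symmetric] t_def[symmetric]
    by (meson exp_le_cancel_iff order_trans)
  have "measure_pmf.prob model {a. K * u ^ 3 * q \<le> \<bar>\<Sum>i\<in>S. \<Sum>j\<in>T. noise a i j\<bar>}
     \<le> measure_pmf.prob model ({a. K * u ^ 3 * q \<le> 1 * (\<Sum>i\<in>S. \<Sum>j\<in>T. noise a i j)} \<union> {a. K * u ^ 3 * q \<le> (-1) * (\<Sum>i\<in>S. \<Sum>j\<in>T. noise a i j)})"
    by (intro measure_pmf.finite_measure_mono) auto
  also have "\<dots> \<le> exp (- 6 * (t * l)) + exp (- 6 * (t * l))"
    by (rule order_trans[OF measure_Un_le add_mono[OF each each]]) auto
  finally show ?thesis unfolding q_def s_def t_def l_def by simp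
qed

text \<open>Union bound over the larger size \<open>t\<close>. Since \<open>card S\<close> is at
  most \<open>t\<close>, there are at most \<open>exp (2 * L t)\<close> pairs, each of probability
  at most \<open>2 * exp (- 6 * L t)\<close>; what is left is at most \<open>2 / n^4\<close> for
  each \<open>t\<close>.\<close>

lemma discrepancy_prob:
  assumes n: "2 \<le> n" and u: "2 \<le> u" "u ^ 4 = ln (real n)" and \<alpha>: "0 \<le> \<alpha>" and pb_eq: "pb = \<alpha> * u ^ 4 / real n"
  defines "K \<equiv> 12 + 20 * \<alpha>"
  shows "measure_pmf.prob model {a. \<exists>S T. S \<subseteq> {..<n} \<and> T \<subseteq> {..<n} \<and> card S \<le> card T \<and> 0 < card T \<and>
      real (card T) \<le> u\<^sup>2 * real (card S) \<and>
      K * u ^ 3 * sqrt (real (card S) * real (card T)) \<le> \<bar>\<Sum>i\<in>S. \<Sum>j\<in>T. noise a i j\<bar>} \<le> 1 / real n"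
proof -
  define Bad where "Bad = (\<lambda>(S, T). {a. K * u ^ 3 * sqrt (real (card S) * real (card T)) \<le> \<bar>\<Sum>i\<in>S. \<Sum>j\<in>T. noise a i j\<bar>})"
  define R where "R = {(S, T). S \<subseteq> {..<n} \<and> T \<subseteq> {..<n} \<and> card S \<le> card T \<and> 0 < card T \<and> real (card T) \<le> u\<^sup>2 * real (card S)}"
  define L where "L = (\<lambda>t::nat. real t * (1 + ln (real n / real t)))"
  define F where "F = (\<lambda>t. {S. S \<subseteq> {..<n} \<and> card S \<le> t})"
  have fR: "finite R" by (rule finite_subset[of _ "Pow {..<n} \<times> Pow {..<n}"]) (auto simp: R_def)
  have fF: "finite (F t)" for t by (rule finite_subset[of _ "Pow {..<n}"]) (auto simp: F_def)
  have n0: "0 < n" using n by simp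
  have "measure_pmf.prob model (\<Union>x\<in>R. Bad x) \<le> (\<Sum>x\<in>R. measure_pmf.prob model (Bad x))"
    by (rule measure_UNION_le[OF fR]) simp
  also have "\<dots> \<le> (\<Sum>x\<in>R. 2 * exp (- 6 * L (card (snd x))))"
  proof (rule sum_mono)
    fix x assume "x \<in> R"
    thus "measure_pmf.prob model (Bad x) \<le> 2 * exp (- 6 * L (card (snd x)))"
      unfolding Bad_def R_def L_def K_def
      using rectangle_tail_log[OF n0 u(1) \<alpha> pb_eq, of "fst x" "snd x"] by (cases x) auto
  qed
  also have "\<dots> = (\<Sum>t\<in>{1..n}. \<Sum>x\<in>{x\<in>R. card (snd x) = t}. 2 * exp (- 6 * L (card (snd x))))"
  proof (rule sum.group[symmetric, OF fR])
    show "(\<lambda>x. card (snd x)) ` R \<subseteq> {1..n}"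
      using card_mono[of "{..<n}"] by (auto simp: R_def Suc_le_eq)
  qed simp
  also have "\<dots> = (\<Sum>t\<in>{1..n}. real (card {x\<in>R. card (snd x) = t}) * (2 * exp (- 6 * L t)))"
    by (intro sum.cong refl) simp
  also have "\<dots> \<le> (\<Sum>t\<in>{1..n}. 2 * exp (- 4 * u ^ 4))"
  proof (rule sum_mono)
    fix t assume t: "t \<in> {1..n}"
    have "card {x\<in>R. card (snd x) = t} \<le> card (F t \<times> F t)"
      using fF by (intro card_mono) (auto simp: R_def F_def)
    hence "real (card {x\<in>R. card (snd x) = t}) \<le> real (card (F t)) * real (card (F t))"
      by (simp add: card_cartesian_product flip: of_nat_mult)
    also have "\<dots> \<le> exp (L t) * exp (L t)"
      using card_subsets_le[of t n] t unfolding F_def L_def by (intro mult_mono) auto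
    finally have "real (card {x\<in>R. card (snd x) = t}) * (2 * exp (- 6 * L t)) \<le> exp (L t) * exp (L t) * (2 * exp (- 6 * L t))"
      by (intro mult_right_mono) auto
    also have "\<dots> = 2 * exp (- 4 * L t)" by (simp add: exp_add[symmetric])
    also have "\<dots> \<le> 2 * exp (- 4 * u ^ 4)"
      using times_one_plus_ln_ratio_ge[of t n] t unfolding u(2) L_def by simp
    finally show "real (card {x\<in>R. card (snd x) = t}) * (2 * exp (- 6 * L t)) \<le> 2 * exp (- 4 * u ^ 4)" .
  qed
  also have "\<dots> = real n * (2 * exp (- 4 * ln (real n)))" unfolding u(2) by simp
  also have "exp (- 4 * ln (real n)) = 1 / real n ^ 4"
  proof -
    have "exp (- 4 * ln (real n)) = inverse (exp (4 * ln (real n)))" by (simp add: exp_minus)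
    also have "exp (4 * ln (real n)) = real n ^ 4" using n0 exp_of_nat_mult[of 4 "ln (real n)"] by simp
    finally show ?thesis by (simp add: field_simps)
  qed
  also have "real n * (2 * (1 / real n ^ 4)) = (2 / (real n)\<^sup>2) * (1 / real n)"
    using n0 by (simp add: power2_eq_square power4_eq_xxxx)
  also have "\<dots> \<le> 1 * (1 / real n)"
  proof (rule mult_right_mono)
    have "2 \<le> real n * real n" using n mult_mono[of 1 "real n" 2 "real n"] by simp
    thus "2 / (real n)\<^sup>2 \<le> 1" using n0 by (simp add: power2_eq_square)
  qed simp
  finally have "measure_pmf.prob model (\<Union>x\<in>R. Bad x) \<le> 1 / real n" by simp
  moreover have "(\<Union>x\<in>R. Bad x) = {a. \<exists>S T. S \<subseteq> {..<n} \<and> T \<subseteq> {..<n} \<and> card S \<le> card T \<and> 0 < card T \<and>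
      real (card T) \<le> u\<^sup>2 * real (card S) \<and>
      K * u ^ 3 * sqrt (real (card S) * real (card T)) \<le> \<bar>\<Sum>i\<in>S. \<Sum>j\<in>T. noise a i j\<bar>}"
    unfolding R_def Bad_def by auto
  ultimately show ?thesis by simp
qed

text \<open>For an indicator \<open>X\<close> of mean \<open>p\<close>,
  \<open>|X - p| \<le> (X - p) + 2 p\<close> replaces the absolute sum by the signed one at a total
  cost of \<open>2 * \<alpha> * u ^ 4\<close>. A row is a rectangle, treated with
  \<open>\<nu> = 1\<close>; \<open>exp 2 \<le> 9\<close> makes the variance term
  \<open>18 * \<alpha>\<close>, and together they explain the \<open>20 * \<alpha>\<close> in the
  constant.\<close>

lemma row_prob:
  assumes n: "2 \<le> n" and u: "u ^ 4 = ln (real n)" and \<alpha>: "0 \<le> \<alpha>" and pb_eq: "pb = \<alpha> * u ^ 4 / real n"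
  shows "measure_pmf.prob model {a. \<exists>i<n. (12 + 20 * \<alpha>) * u ^ 4 < (\<Sum>j<n. \<bar>noise a i j\<bar>)} \<le> 1 / real n"
proof -
  define Bad where "Bad = (\<lambda>i. {a. (12 + 20 * \<alpha>) * u ^ 4 < (\<Sum>j<n. \<bar>noise a i j\<bar>)})"
  have n0: "0 < n" using n by simp
  have u4: "0 \<le> u ^ 4" by simp
  have each: "measure_pmf.prob model (Bad i) \<le> 1 / (real n)\<^sup>2" if i: "i < n" for i
  proof -
    have "Bad i \<subseteq> {a. (2 + 18 * \<alpha>) * u ^ 4 \<le> 1 * (\<Sum>i\<in>{i}. \<Sum>j<n. noise a i j)}"
    proof
      fix a assume a: "a \<in> Bad i"
      have "(\<Sum>j<n. \<bar>noise a i j\<bar>) \<le> (\<Sum>j<n. noise a i j + 2 * pb)"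
      proof (rule sum_mono)
        fix j assume "j \<in> {..<n}"
        hence "0 \<le> pr (edge i j) \<and> pr (edge i j) \<le> pb" using i by (intro pr edge_in_edges) auto
        thus "\<bar>noise a i j\<bar> \<le> noise a i j + 2 * pb" by (auto simp: noise_def)
      qed
      also have "\<dots> = (\<Sum>j<n. noise a i j) + 2 * \<alpha> * u ^ 4"
        using n0 by (simp add: sum.distrib pb_eq)
      finally have "(12 + 20 * \<alpha>) * u ^ 4 < (\<Sum>j<n. noise a i j) + 2 * \<alpha> * u ^ 4" using a by (simp add: Bad_def)
      moreover have "(12 + 20 * \<alpha>) * u ^ 4 = (2 + 18 * \<alpha>) * u ^ 4 + 2 * \<alpha> * u ^ 4 + 10 * u ^ 4"
        by (simp add: algebra_simps)
      ultimately have "(2 + 18 * \<alpha>) * u ^ 4 \<le> (\<Sum>j<n. noise a i j)" using u4 by linarith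
      thus "a \<in> {a. (2 + 18 * \<alpha>) * u ^ 4 \<le> 1 * (\<Sum>i\<in>{i}. \<Sum>j<n. noise a i j)}"
        by simp
    qed
    hence "measure_pmf.prob model (Bad i) \<le> measure_pmf.prob model {a. (2 + 18 * \<alpha>) * u ^ 4 \<le> 1 * (\<Sum>i\<in>{i}. \<Sum>j<n. noise a i j)}"
      by (intro measure_pmf.finite_measure_mono) auto
    also have "\<dots> \<le> exp (- (1 * ((2 + 18 * \<alpha>) * u ^ 4)) + 2 * pb * (real (card {i}) * real (card {..<n})) * 1\<^sup>2 * exp (2 * 1))"
      using i by (intro rectangle_tail) auto
    also have "\<dots> \<le> exp (- 2 * ln (real n))"
    proof -
      have "exp (2 * 1 :: real) = exp 1 * exp 1" by (simp add: exp_add[symmetric])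
      also have "\<dots> \<le> 3 * 3" by (intro mult_mono exp_le) auto
      finally have "2 * (\<alpha> * u ^ 4) * exp (2 * 1) \<le> 2 * (\<alpha> * u ^ 4) * 9" using \<alpha> u4 by (intro mult_left_mono) auto
      moreover have "2 * pb * (real (card {i}) * real (card {..<n})) * 1\<^sup>2 * exp (2 * 1) = 2 * (\<alpha> * u ^ 4) * exp (2 * 1)"
        using n0 by (simp add: pb_eq)
      moreover have "(2 + 18 * \<alpha>) * u ^ 4 = 2 * u ^ 4 + 2 * (\<alpha> * u ^ 4) * 9" by (simp add: algebra_simps)
      ultimately show ?thesis unfolding u[symmetric] exp_le_cancel_iff by linarith
    qed
    also have "\<dots> = 1 / (real n)\<^sup>2"
    proof -
      have "exp (- 2 * ln (real n)) = inverse (exp (2 * ln (real n)))" by (simp add: exp_minus)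
      also have "exp (2 * ln (real n)) = (real n)\<^sup>2" using n0 exp_of_nat_mult[of 2 "ln (real n)"] by simp
      finally show ?thesis by (simp add: field_simps)
    qed
    finally show ?thesis .
  qed
  have "{a. \<exists>i<n. (12 + 20 * \<alpha>) * u ^ 4 < (\<Sum>j<n. \<bar>noise a i j\<bar>)} = (\<Union>i\<in>{..<n}. Bad i)"
    by (auto simp: Bad_def)
  hence "measure_pmf.prob model {a. \<exists>i<n. (12 + 20 * \<alpha>) * u ^ 4 < (\<Sum>j<n. \<bar>noise a i j\<bar>)} \<le> (\<Sum>i<n. measure_pmf.prob model (Bad i))"
    using measure_UNION_le[of "{..<n}" Bad model] by simp
  also have "\<dots> \<le> (\<Sum>i<n. 1 / (real n)\<^sup>2)" by (intro sum_mono each) simp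
  also have "\<dots> = 1 / real n" using n0 by (simp add: power2_eq_square)
  finally show ?thesis .
qed

text \<open>Rectangles with \<open>t > u^2 * s\<close> satisfy the same bound by the row sums: these
  give \<open>K * u^4 * s\<close>, and \<open>u * s\<close> is at most \<open>sqrt (s * t)\<close>.
  Transposition covers the case that \<open>S\<close> is larger than \<open>T\<close>.\<close>

lemma discrepancy_all:
  assumes u: "0 < u" and K: "0 \<le> K"
    and disc: "\<not> (\<exists>S T. S \<subseteq> {..<n} \<and> T \<subseteq> {..<n} \<and> card S \<le> card T \<and> 0 < card T \<and>
      real (card T) \<le> u\<^sup>2 * real (card S) \<and>
      K * u ^ 3 * sqrt (real (card S) * real (card T)) \<le> \<bar>\<Sum>i\<in>S. \<Sum>j\<in>T. noise a i j\<bar>)"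
    and row: "\<And>i. i < n \<Longrightarrow> (\<Sum>j<n. \<bar>noise a i j\<bar>) \<le> K * u ^ 4"
    and ST: "S \<subseteq> {..<n}" "T \<subseteq> {..<n}"
  shows "\<bar>\<Sum>i\<in>S. \<Sum>j\<in>T. noise a i j\<bar> \<le> K * u ^ 3 * sqrt (real (card S) * real (card T))"
proof -
  have main: "\<bar>\<Sum>i\<in>S. \<Sum>j\<in>T. noise a i j\<bar> \<le> K * u ^ 3 * sqrt (real (card S) * real (card T))"
    if ST: "S \<subseteq> {..<n}" "T \<subseteq> {..<n}" and le: "card S \<le> card T" for S T
  proof (cases "card T = 0")
    case True
    hence "T = {}" using finite_subset[OF ST(2)] by simp
    thus ?thesis by simp
  next
    case False
    define s t where "s = real (card S)" and "t = real (card T)"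
    have s0: "0 \<le> s" by (simp add: s_def)
    show ?thesis
    proof (cases "t \<le> u\<^sup>2 * s")
      case True
      hence "\<not> K * u ^ 3 * sqrt (s * t) \<le> \<bar>\<Sum>i\<in>S. \<Sum>j\<in>T. noise a i j\<bar>"
        using disc ST le \<open>card T \<noteq> 0\<close> unfolding s_def t_def by blast
      thus ?thesis by (simp add: s_def t_def)
    next
      case False
      have "\<bar>\<Sum>i\<in>S. \<Sum>j\<in>T. noise a i j\<bar> \<le> (\<Sum>i\<in>S. \<Sum>j\<in>T. \<bar>noise a i j\<bar>)"
        by (rule order_trans[OF sum_abs]) (intro sum_mono sum_abs)
      also have "\<dots> \<le> (\<Sum>i\<in>S. \<Sum>j<n. \<bar>noise a i j\<bar>)"
        using ST by (intro sum_mono sum_mono2) auto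
      also have "\<dots> \<le> (\<Sum>i\<in>S. K * u ^ 4)" using ST by (intro sum_mono row) auto
      also have "\<dots> = K * u ^ 3 * (u * s)" by (simp add: s_def eval_nat_numeral)
      also have "\<dots> \<le> K * u ^ 3 * sqrt (s * t)"
      proof (intro mult_left_mono real_le_rsqrt)
        have "(u * s)\<^sup>2 = s * (u\<^sup>2 * s)" by (simp add: power2_eq_square)
        also have "\<dots> \<le> s * t" using False s0 by (intro mult_left_mono) auto
        finally show "(u * s)\<^sup>2 \<le> s * t" .
      qed (use K u in auto)
      finally show ?thesis by (simp add: s_def t_def)
    qed
  qed
  show ?thesis
  proof (cases "card S \<le> card T")
    case True
    thus ?thesis using main ST by blast
  next
    case False
    have "(\<Sum>i\<in>S. \<Sum>j\<in>T. noise a i j) = (\<Sum>j\<in>T. \<Sum>i\<in>S. noise a j i)"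
      by (subst sum.swap) (simp only: noise_commute)
    thus ?thesis using main[OF ST(2,1)] False by (simp add: mult.commute)
  qed
qed

end

text \<open>The exponent of the Chernoff bound, minimised at \<open>exp \<nu> = sqrt (\<alpha> / \<beta>)\<close>, is where
  the recovery threshold \<open>sqrt \<alpha> - sqrt \<beta> > sqrt 2\<close> enters.\<close>
lemma (in edge_model) signal_prob:
  assumes n: "0 < n" and z: "\<And>i. i < n \<Longrightarrow> z i = 1 \<or> z i = - 1" and zsum: "(\<Sum>i<n. z i) = 0"
    and \<beta>: "0 < \<beta>" "\<beta> \<le> \<alpha>"
    and pr_eq: "\<And>i j. i < n \<Longrightarrow> j < n \<Longrightarrow> pr (edge i j) = (if z i * z j = 1 then \<alpha> else \<beta>) * L / real n"
  shows "measure_pmf.prob model {a. \<exists>i<n. (\<Sum>j<n. z i * z j * of_bool (a (edge i j))) < \<epsilon> * L}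
    \<le> real n * exp (- (L * ((sqrt \<alpha> - sqrt \<beta>)\<^sup>2 / 2 - \<epsilon> * (ln (\<alpha> / \<beta>) / 2))))"
proof -
  define \<nu> where "\<nu> = ln (\<alpha> / \<beta>) / 2"
  have \<nu>0: "0 \<le> \<nu>" using \<beta> by (simp add: \<nu>_def)
  have e\<nu>: "exp \<nu> = sqrt \<alpha> / sqrt \<beta>"
  proof -
    have "(exp \<nu>)\<^sup>2 = \<alpha> / \<beta>" using \<beta> by (simp add: \<nu>_def power2_eq_square exp_add[symmetric])
    hence "exp \<nu> = sqrt (\<alpha> / \<beta>)" by (metis exp_ge_zero real_sqrt_unique)
    thus ?thesis by (simp add: real_sqrt_divide)
  qed
  \<comment> \<open>At the minimiser both exponential terms equal
    \<open>sqrt (\<alpha> * \<beta>)\<close>, and a complete square appears.\<close>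
  have es: "\<alpha> * (exp (- \<nu>) - 1) + \<beta> * (exp \<nu> - 1) = - (sqrt \<alpha> - sqrt \<beta>)\<^sup>2"
  proof -
    have s: "sqrt \<alpha> * sqrt \<alpha> = \<alpha>" "sqrt \<beta> * sqrt \<beta> = \<beta>" "0 < sqrt \<alpha>" "0 < sqrt \<beta>" using \<beta> by auto
    have cancel: "(x * x) * (y / x) = x * y" if "0 < x" for x y :: real using that by simp
    have "exp (- \<nu>) = sqrt \<beta> / sqrt \<alpha>" by (simp add: exp_minus e\<nu>)
    hence "\<alpha> * exp (- \<nu>) = sqrt \<alpha> * sqrt \<beta>" using cancel[OF s(3), of "sqrt \<beta>"] unfolding s(1) by simp
    moreover have "\<beta> * exp \<nu> = sqrt \<alpha> * sqrt \<beta>"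
      using cancel[OF s(4), of "sqrt \<alpha>"] unfolding s(2) e\<nu> by (simp add: mult.commute)
    ultimately show ?thesis using s(1,2) by (simp add: power2_eq_square algebra_simps)
  qed
  define Bad where "Bad = (\<lambda>i. {a. (\<Sum>j<n. z i * z j * of_bool (a (edge i j))) < \<epsilon> * L})"
  have each: "measure_pmf.prob model (Bad i) \<le> exp (- (L * ((sqrt \<alpha> - sqrt \<beta>)\<^sup>2 / 2 - \<epsilon> * \<nu>)))" if i: "i < n" for i
  proof -
    have "Bad i \<subseteq> {a. - (\<nu> * (\<epsilon> * L)) \<le> (\<Sum>j<n. - (\<nu> * (z i * z j)) * of_bool (a (edge i j)))}"
    proof
      fix a assume a: "a \<in> Bad i"
      define Z where "Z = (\<Sum>j<n. z i * z j * of_bool (a (edge i j)))"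
      have "(\<Sum>j<n. - (\<nu> * (z i * z j)) * of_bool (a (edge i j))) = - \<nu> * Z"
        unfolding Z_def sum_distrib_left by (intro sum.cong refl) (simp only: mult.assoc mult_minus_left)
      moreover have "\<nu> * Z \<le> \<nu> * (\<epsilon> * L)" using a \<nu>0 by (intro mult_left_mono) (auto simp: Bad_def Z_def)
      ultimately show "a \<in> {a. - (\<nu> * (\<epsilon> * L)) \<le> (\<Sum>j<n. - (\<nu> * (z i * z j)) * of_bool (a (edge i j)))}"
        by (simp only: mem_Collect_eq)
    qed
    hence "measure_pmf.prob model (Bad i) \<le> measure_pmf.prob model {a. - (\<nu> * (\<epsilon> * L)) \<le> (\<Sum>j<n. - (\<nu> * (z i * z j)) * of_bool (a (edge i j)))}"
      by (intro measure_pmf.finite_measure_mono) auto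
    also have "\<dots> \<le> exp (- (- (\<nu> * (\<epsilon> * L))) + (\<Sum>j<n. pr (edge i j) * (exp (- (\<nu> * (z i * z j))) - 1)))"
      by (rule row_tail[OF i])
    also have "(\<Sum>j<n. pr (edge i j) * (exp (- (\<nu> * (z i * z j))) - 1)) = - (L * ((sqrt \<alpha> - sqrt \<beta>)\<^sup>2 / 2))"
    proof -
      \<comment> \<open>The summand takes two values according to \<open>z i * z j\<close>, so it is
        affine in this product; the linear part \<open>Y\<close> cancels because the labels are
        balanced.\<close>
      define X Y where "X = L / real n * ((\<alpha> * (exp (- \<nu>) - 1) + \<beta> * (exp \<nu> - 1)) / 2)"
        and "Y = L / real n * ((\<alpha> * (exp (- \<nu>) - 1) - \<beta> * (exp \<nu> - 1)) / 2)"
      have "pr (edge i j) * (exp (- (\<nu> * (z i * z j))) - 1) = X + Y * z i * z j" if j: "j < n" for j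
      proof -
        have "X + Y = \<alpha> * L / real n * (exp (- \<nu>) - 1)" "X - Y = \<beta> * L / real n * (exp \<nu> - 1)"
        proof -
          have h: "c * ((x + y) / 2) + c * ((x - y) / 2) = c * x" "c * ((x + y) / 2) - c * ((x - y) / 2) = c * y" for c x y :: real
            by (simp_all add: field_simps)
          show "X + Y = \<alpha> * L / real n * (exp (- \<nu>) - 1)" "X - Y = \<beta> * L / real n * (exp \<nu> - 1)"
            unfolding X_def Y_def h by simp_all
        qed
        moreover have "z i * z j = 1 \<or> z i * z j = - 1" using z[OF i] z[OF j] by auto
        ultimately show ?thesis unfolding pr_eq[OF i j] mult.assoc[of Y] by auto
      qed
      hence "(\<Sum>j<n. pr (edge i j) * (exp (- (\<nu> * (z i * z j))) - 1)) = (\<Sum>j<n. X + Y * z i * z j)"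
        by (intro sum.cong) auto
      also have "\<dots> = real n * X" using zsum by (simp add: sum.distrib sum_distrib_left[symmetric])
      also have "\<dots> = - (L * ((sqrt \<alpha> - sqrt \<beta>)\<^sup>2 / 2))" unfolding X_def es using n by simp
      finally show ?thesis .
    qed
    finally show ?thesis by (simp add: algebra_simps)
  qed
  have "{a. \<exists>i<n. (\<Sum>j<n. z i * z j * of_bool (a (edge i j))) < \<epsilon> * L} = (\<Union>i\<in>{..<n}. Bad i)"
    by (auto simp: Bad_def)
  hence "measure_pmf.prob model {a. \<exists>i<n. (\<Sum>j<n. z i * z j * of_bool (a (edge i j))) < \<epsilon> * L} \<le> (\<Sum>i<n. measure_pmf.prob model (Bad i))"
    using measure_UNION_le[of "{..<n}" Bad model] by simp
  also have "\<dots> \<le> (\<Sum>i<n. exp (- (L * ((sqrt \<alpha> - sqrt \<beta>)\<^sup>2 / 2 - \<epsilon> * \<nu>))))" by (intro sum_mono each) simp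
  finally show ?thesis by (simp add: \<nu>_def)
qed

section \<open>The random graph is a noisy block matrix\<close>

lemma sum_lessThan_eq_scalar_prod:
  fixes x y :: "real vec"
  assumes "y \<in> carrier_vec n"
  shows "x \<bullet> y = (\<Sum>i<n. x $ i * y $ i)"
  using assms by (simp add: scalar_prod_def atLeast0LessThan)

definition adjacency :: "nat \<Rightarrow> (nat \<times> nat \<Rightarrow> bool) \<Rightarrow> real mat" where
  "adjacency n a = mat n n (\<lambda>(i, j). of_bool (a (edge i j)))"

definition sbm_param :: "real \<Rightarrow> real \<Rightarrow> real vec \<Rightarrow> nat \<times> nat \<Rightarrow> real" where
  "sbm_param p q z = (\<lambda>(i, j). if z $ i * z $ j = 1 then p else q)"

lemma sbm_param_edge:
  "sbm_param p q z (edge i j) = (if z $ i * z $ j = 1 then p else q)"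
  by (auto simp: sbm_param_def edge_def min_def max_def mult.commute)

lemma sbm_pmf_eq:
  "sbm_pmf n p q z = map_pmf (adjacency n) (Pi_pmf (edges n) False (\<lambda>e. bernoulli_pmf (sbm_param p q z e)))"
  unfolding sbm_pmf_def adjacency_def edges_def edge_def sbm_param_def
  by (intro arg_cong2[where f = map_pmf] arg_cong[where f = "Pi_pmf _ False"] ext) (auto split: prod.split)

lemma adjacency_mult:
  assumes "x \<in> carrier_vec n" "i < n"
  shows "(adjacency n a *\<^sub>v x) $ i = (\<Sum>j<n. of_bool (a (edge i j)) * x $ j)"
  using assms by (simp add: adjacency_def scalar_prod_def atLeast0LessThan)

text \<open>Self-loops have the within-community parameter too, so the mean is exactly the two-block
  matrix and the difference is the noise without a correction on the diagonal.\<close>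

lemma adjacency_block_matrix:
  fixes z :: "real vec"
  assumes n: "0 < n" and z: "z \<in> balanced_labels n" and \<beta>: "0 < \<beta>" "\<beta> \<le> \<alpha>" and L: "0 \<le> L"
    and em: "edge_model n (sbm_param (\<alpha> * L / real n) (\<beta> * L / real n) z) pb"
  defines "noise \<equiv> edge_model.noise (sbm_param (\<alpha> * L / real n) (\<beta> * L / real n) z)"
  assumes disc: "\<And>S T. S \<subseteq> {..<n} \<Longrightarrow> T \<subseteq> {..<n} \<Longrightarrow>
      \<bar>\<Sum>i\<in>S. \<Sum>j\<in>T. noise a i j\<bar> \<le> c * sqrt (real (card S) * real (card T))"
    and row: "\<And>i. i < n \<Longrightarrow> (\<Sum>j<n. \<bar>noise a i j\<bar>) \<le> d"
    and cd: "0 \<le> c" "0 \<le> d" and e: "4 * (2 * c * (2 * real g + 1) + (1/2)^g * d) \<le> e"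
  shows "block_matrix n (adjacency n a) z ((\<alpha> + \<beta>) / 2 * L) ((\<alpha> - \<beta>) / 2 * L) e"
proof -
  note zD = balanced_labelsD[OF z]
  show ?thesis
  proof
    show "0 < n" by (rule n)
    show "adjacency n a \<in> carrier_mat n n" by (simp add: adjacency_def)
    show "transpose_mat (adjacency n a) = adjacency n a"
      by (rule eq_matI) (auto simp: adjacency_def edge_commute)
    show "z \<in> balanced_labels n" by (rule z)
    show "0 \<le> (\<alpha> - \<beta>) / 2 * L" "(\<alpha> - \<beta>) / 2 * L \<le> (\<alpha> + \<beta>) / 2 * L"
      using \<beta> L by (auto intro: mult_right_mono)
    have "0 \<le> 4 * (2 * c * (2 * real g + 1) + (1/2)^g * d)" using cd by simp
    thus "0 \<le> e" using e by linarith
    fix x y :: "real vec"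
    assume x: "x \<in> carrier_vec n" and y: "y \<in> carrier_vec n"
    have entry: "of_bool (a (edge i j)) = noise a i j + ((\<alpha> + \<beta>) / 2 * L / real n + (\<alpha> - \<beta>) / 2 * L / real n * (z $ i * z $ j))"
      if "i < n" "j < n" for i j
    proof -
      have "z $ i * z $ j = 1 \<or> z $ i * z $ j = - 1" using zD(5)[OF that(1)] zD(5)[OF that(2)] by auto
      moreover have "(\<alpha> + \<beta>) / 2 * L / real n + (\<alpha> - \<beta>) / 2 * L / real n = \<alpha> * L / real n"
        "(\<alpha> + \<beta>) / 2 * L / real n - (\<alpha> - \<beta>) / 2 * L / real n = \<beta> * L / real n"
        unfolding add_divide_distrib[symmetric] diff_divide_distrib[symmetric] distrib_right[symmetric] left_diff_distrib[symmetric]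
        by simp_all
      ultimately show ?thesis unfolding noise_def edge_model.noise_def[OF em] sbm_param_edge by auto
    qed
    have "adjacency n a \<in> carrier_mat n n" by (simp add: adjacency_def)
    from mult_mat_vec_carrier[OF this x]
    have "y \<bullet> (adjacency n a *\<^sub>v x) = (\<Sum>i<n. y $ i * (adjacency n a *\<^sub>v x) $ i)"
      by (rule sum_lessThan_eq_scalar_prod)
    also have "\<dots> = (\<Sum>i<n. y $ i * (\<Sum>j<n. of_bool (a (edge i j)) * x $ j))"
      by (intro sum.cong refl) (simp only: adjacency_mult[OF x] lessThan_iff)
    also have "\<dots> = (\<Sum>i<n. \<Sum>j<n. y $ i * noise a i j * x $ j + ((\<alpha> + \<beta>) / 2 * L / real n * (x $ j * y $ i)
        + (\<alpha> - \<beta>) / 2 * L / real n * ((z $ j * x $ j) * (z $ i * y $ i))))"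
      unfolding sum_distrib_left
      by (intro sum.cong refl) (simp only: lessThan_iff entry, simp add: algebra_simps)
    also have "\<dots> = (\<Sum>i<n. \<Sum>j<n. y $ i * noise a i j * x $ j)
       + ((\<alpha> + \<beta>) / 2 * L / real n * ((\<Sum>j<n. x $ j) * (\<Sum>i<n. y $ i))
       + (\<alpha> - \<beta>) / 2 * L / real n * ((\<Sum>j<n. z $ j * x $ j) * (\<Sum>i<n. z $ i * y $ i)))"
    proof -
      have sp: "(\<Sum>i<n. \<Sum>j<n. f j * h i) = (\<Sum>j<n. f j) * (\<Sum>i<n. h i)" for f h :: "nat \<Rightarrow> real"
        by (subst sum.swap) (rule sum_product[symmetric])
      show ?thesis unfolding sum.distrib sum_distrib_left[symmetric] sp ..
    qed
    also have "(\<Sum>j<n. x $ j) = ones n \<bullet> x"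
      using x by (subst sum_lessThan_eq_scalar_prod[OF x]) (simp add: ones_def)
    also have "(\<Sum>j<n. y $ j) = ones n \<bullet> y"
      using y by (subst sum_lessThan_eq_scalar_prod[OF y]) (simp add: ones_def)
    also have "(\<Sum>j<n. z $ j * x $ j) = z \<bullet> x" by (rule sum_lessThan_eq_scalar_prod[OF x, symmetric])
    also have "(\<Sum>j<n. z $ j * y $ j) = z \<bullet> y" by (rule sum_lessThan_eq_scalar_prod[OF y, symmetric])
    finally have split: "y \<bullet> (adjacency n a *\<^sub>v x) - (\<alpha> + \<beta>) / 2 * L / real n * ((ones n \<bullet> x) * (ones n \<bullet> y))
       - (\<alpha> - \<beta>) / 2 * L / real n * ((z \<bullet> x) * (z \<bullet> y)) = (\<Sum>i<n. \<Sum>j<n. y $ i * noise a i j * x $ j)" by simp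
    have nx: "sqrt (\<Sum>i<n. (v $ i)\<^sup>2) = l2_norm v" if "v \<in> carrier_vec n" for v
      unfolding l2_norm_def sum_lessThan_eq_scalar_prod[OF that] power2_eq_square ..
    have "\<bar>\<Sum>i<n. \<Sum>j<n. y $ i * noise a i j * x $ j\<bar>
       \<le> 4 * (2 * c * (2 * real g + 1) + (1/2)^g * d) * (sqrt (\<Sum>i<n. (y $ i)\<^sup>2) * sqrt (\<Sum>j<n. (x $ j)\<^sup>2))"
      by (rule bilinear_le_discrepancy) (use cd disc row in \<open>auto simp: noise_def edge_model.noise_commute[OF em]\<close>)
    also have "\<dots> \<le> e * (sqrt (\<Sum>i<n. (y $ i)\<^sup>2) * sqrt (\<Sum>j<n. (x $ j)\<^sup>2))"
      using e by (intro mult_right_mono) (auto intro!: mult_nonneg_nonneg real_sqrt_ge_zero sum_nonneg)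
    also have "\<dots> = e * (l2_norm x * l2_norm y)" unfolding nx[OF x] nx[OF y] by (simp add: mult.commute)
    finally show "\<bar>y \<bullet> (adjacency n a *\<^sub>v x) - (\<alpha> + \<beta>) / 2 * L / real n * ((ones n \<bullet> x) * (ones n \<bullet> y))
       - (\<alpha> - \<beta>) / 2 * L / real n * ((z \<bullet> x) * (z \<bullet> y))\<bar> \<le> e * (l2_norm x * l2_norm y)"
      unfolding split .
  qed
qed

text \<open>The mean depends on \<open>z\<close> only through products of two of its entries. Stage
  2 can thus be analysed towards whichever sign stage 1 has produced.\<close>

lemma block_matrix_uminus:
  assumes "block_matrix n A z a b e"
  shows "block_matrix n A (- z) a b e"
proof -
  interpret block_matrix n A z a b e by fact
  show ?thesis
  proof
    show "- z \<in> balanced_labels n" by (rule balanced_labels_uminus[OF z])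
    fix x y :: "real vec"
    assume x: "x \<in> carrier_vec n" and y: "y \<in> carrier_vec n"
    have "(- z) \<bullet> x = - (z \<bullet> x)" "(- z) \<bullet> y = - (z \<bullet> y)" using x y zD(1) by auto
    thus "\<bar>y \<bullet> (A *\<^sub>v x) - a / real n * ((ones n \<bullet> x) * (ones n \<bullet> y)) - b / real n * ((- z \<bullet> x) * (- z \<bullet> y))\<bar> \<le> e * (l2_norm x * l2_norm y)"
      using approx[OF x y] by simp
  qed (use n_pos A sym b_nonneg b_le_a e_nonneg in auto)
qed

text \<open>\<open>start\<close> places the initial vector of stage 2 where a step contracts, and
  \<open>small\<close> bounds its distance to one of the two labels by \<open>sqrt n\<close>, so
  that the second condition on \<open>K\<close> brings the distance below 2.\<close>

lemma (in block_matrix) algorithm_correct: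
  fixes g :: "nat \<times> nat \<Rightarrow> real"
  assumes N: "0 < N" and r: "0 < r" and \<theta>: "0 < \<theta>"
    and bound: "\<And>i k. i < n \<Longrightarrow> k < 2 \<Longrightarrow> \<bar>g (i, k)\<bar> \<le> real n"
    and det: "\<theta> \<le> \<bar>\<Sum>i<n. \<Sum>j<n. g (i, 0) * g (j, 1) * minor N i j\<bar>"
    and rate: "4 * real n ^ 5 * (a + b + e) ^ N * r ^ N < \<theta>"
    and ba: "b < a"
  defines "\<tau> \<equiv> e / r"
  defines "\<kappa> \<equiv> (e + b * \<tau>\<^sup>2) / (a - b)"
  assumes small: "\<tau>\<^sup>2 + \<kappa> \<le> 1 / 2"
    and gap: "b + 2 * e + a * \<kappa> < a * (1 - \<tau>\<^sup>2 - 2 * (\<kappa> + \<tau>\<^sup>2)\<^sup>2)"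
    and eta: "0 < \<eta>" "\<And>i. i < n \<Longrightarrow> \<eta> \<le> z $ i * (A *\<^sub>v z) $ i"
    and start: "2 * b * (\<tau>\<^sup>2 + \<kappa>) \<le> \<eta>"
    and \<rho>: "4 * e / \<eta> < 1" and K: "1 \<le> K" "(4 * e / \<eta>) ^ K * sqrt (real n) < 2"
  shows "algorithm_outputs_within n A (mat n 2 g) N (real (Suc K)) {z, - z}"
proof -
  note s1 = stage1_correct[OF N r \<theta> _ det rate ba small[unfolded \<kappa>_def \<tau>_def] gap[unfolded \<kappa>_def \<tau>_def], folded \<tau>_def, folded \<kappa>_def]
  have ex: "\<exists>y. stage1_output n A (mat n 2 g) N y" by (rule s1(1)) (rule bound)
  have s1': "let x = (sqrt (real n) / l2_norm y) \<cdot>\<^sub>v y in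
       y \<noteq> 0\<^sub>v n \<and> x \<in> carrier_vec n \<and> ones n \<bullet> x = 0 \<and> x \<bullet> x = real n \<and>
       ((l2_norm (x - z))\<^sup>2 \<le> 2 * real n * (\<tau>\<^sup>2 + \<kappa>) \<or> (l2_norm (x - (- z)))\<^sup>2 \<le> 2 * real n * (\<tau>\<^sup>2 + \<kappa>))"
    if "stage1_output n A (mat n 2 g) N y" for y
    by (rule s1(2)[OF _ that]) (rule bound)
  have conv: "\<exists>k. terminates_at x k \<and> real k \<le> real (Suc K) \<and> x k \<in> {z, - z}"
    if y: "stage1_output n A (mat n 2 g) N y" and x: "projected_power_iterations n A y x" for y x
  proof -
    have x0: "x 0 = (sqrt (real n) / l2_norm y) \<cdot>\<^sub>v y" using x by (simp add: projected_power_iterations_def)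
    note s = s1'[OF y, unfolded Let_def, folded x0]
    have gen: "\<exists>k. terminates_at x k \<and> k \<le> Suc K \<and> x k = v"
      if v: "block_matrix n A v a b e" and ev: "\<And>i. i < n \<Longrightarrow> \<eta> \<le> v $ i * (A *\<^sub>v v) $ i"
        and close: "(l2_norm (x 0 - v))\<^sup>2 \<le> 2 * real n * (\<tau>\<^sup>2 + \<kappa>)" for v
    proof (rule block_matrix.projected_power_iterations_converge[OF v x _ _ _ eta(1) ev _ \<rho> K(1)])
      show "x 0 \<in> carrier_vec n" "ones n \<bullet> x 0 = 0" "x 0 \<bullet> x 0 = real n" using s by auto
      have "b * (l2_norm (x 0 - v))\<^sup>2 \<le> b * (2 * real n * (\<tau>\<^sup>2 + \<kappa>))" using close b_nonneg by (intro mult_left_mono)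
      also have "\<dots> = (2 * b * (\<tau>\<^sup>2 + \<kappa>)) * real n" by simp
      also have "\<dots> \<le> \<eta> * real n" using start by (intro mult_right_mono) auto
      finally show "b * (l2_norm (x 0 - v))\<^sup>2 \<le> \<eta> * real n" .
      have "2 * real n * (\<tau>\<^sup>2 + \<kappa>) \<le> 2 * real n * (1 / 2)" using small by (intro mult_left_mono) auto
      hence "(l2_norm (x 0 - v))\<^sup>2 \<le> (sqrt (real n))\<^sup>2" using close by simp
      hence "l2_norm (x 0 - v) \<le> sqrt (real n)" by (rule power2_le_imp_le) simp
      hence "(4 * e / \<eta>) ^ K * l2_norm (x 0 - v) \<le> (4 * e / \<eta>) ^ K * sqrt (real n)"
        using e_nonneg eta(1) by (intro mult_left_mono) auto
      thus "(4 * e / \<eta>) ^ K * l2_norm (x 0 - v) < 2" using K(2) by linarith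
    qed
    have mev: "\<eta> \<le> (- z) $ i * (A *\<^sub>v (- z)) $ i" if "i < n" for i
    proof -
      have "(A *\<^sub>v (- z)) $ i = - ((A *\<^sub>v z) $ i)" using A zD(1) that by simp
      thus ?thesis using eta(2)[OF that] zD(1) that by simp
    qed
    from s consider "(l2_norm (x 0 - z))\<^sup>2 \<le> 2 * real n * (\<tau>\<^sup>2 + \<kappa>)" | "(l2_norm (x 0 - (- z)))\<^sup>2 \<le> 2 * real n * (\<tau>\<^sup>2 + \<kappa>)"
      by blast
    thus ?thesis
    proof cases
      case 1
      from gen[OF block_matrix_axioms eta(2) 1] show ?thesis by (metis insertI1 of_nat_le_iff)
    next
      case 2
      from gen[OF block_matrix_uminus[OF block_matrix_axioms] mev 2] show ?thesis
        by (metis insertI1 insertI2 of_nat_le_iff)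
    qed
  qed
  show ?thesis
    unfolding algorithm_outputs_within_def
    using ex s1' conv projected_power_iterations_exist by (auto simp: Let_def)
qed

text \<open>The favourable event is assembled from finitely many rectangles
  \<open>{A} \<times> G A\<close>, with a Gaussian event that depends on the graph. This yields a
  measurable event inside the set of successful draws without a study of that set.\<close>

lemma pair_pmf_measure_ge:
  fixes p :: "'a pmf" and M :: "'b measure"
  assumes M: "prob_space M" and S: "finite S" and G: "\<And>A. A \<in> S \<Longrightarrow> G A \<in> sets M"
    and prob: "\<And>A. A \<in> S \<Longrightarrow> 1 - \<delta> \<le> measure M (G A)" and \<delta>: "0 \<le> \<delta>"
  shows "(\<Union>A\<in>S. {A} \<times> G A) \<in> sets (measure_pmf p \<Otimes>\<^sub>M M)"
    and "measure_pmf.prob p S - \<delta> \<le> measure (measure_pmf p \<Otimes>\<^sub>M M) (\<Union>A\<in>S. {A} \<times> G A)"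
proof -
  interpret M: prob_space M by (rule M)
  interpret P: pair_prob_space "measure_pmf p" M ..
  have rect: "{A} \<times> G A \<in> sets (measure_pmf p \<Otimes>\<^sub>M M)" if "A \<in> S" for A
    using G[OF that] by (intro pair_measureI) auto
  show "(\<Union>A\<in>S. {A} \<times> G A) \<in> sets (measure_pmf p \<Otimes>\<^sub>M M)" using rect S by auto
  have m: "measure (measure_pmf p \<Otimes>\<^sub>M M) ({A} \<times> G A) = pmf p A * measure M (G A)" if "A \<in> S" for A
  proof -
    have "emeasure (measure_pmf p \<Otimes>\<^sub>M M) ({A} \<times> G A) = emeasure (measure_pmf p) {A} * emeasure M (G A)"
      using G[OF that] by (intro M.emeasure_pair_measure_Times) auto
    thus ?thesis by (simp add: measure_def enn2real_mult pmf.rep_eq)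
  qed
  have "measure (measure_pmf p \<Otimes>\<^sub>M M) (\<Union>A\<in>S. {A} \<times> G A) = (\<Sum>A\<in>S. measure (measure_pmf p \<Otimes>\<^sub>M M) ({A} \<times> G A))"
    using rect S by (intro P.finite_measure_finite_Union) (auto simp: disjoint_family_on_def)
  also have "\<dots> = (\<Sum>A\<in>S. pmf p A * measure M (G A))" by (intro sum.cong refl m)
  also have "\<dots> \<ge> (\<Sum>A\<in>S. pmf p A * (1 - \<delta>))" by (intro sum_mono mult_left_mono prob) auto
  also have "(\<Sum>A\<in>S. pmf p A * (1 - \<delta>)) = measure_pmf.prob p S * (1 - \<delta>)"
    using S by (simp add: measure_measure_pmf_finite sum_distrib_right)
  finally have "measure_pmf.prob p S * (1 - \<delta>) \<le> measure (measure_pmf p \<Otimes>\<^sub>M M) (\<Union>A\<in>S. {A} \<times> G A)" .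
  moreover have "measure_pmf.prob p S * \<delta> \<le> 1 * \<delta>" using \<delta> by (intro mult_right_mono) auto
  ultimately show "measure_pmf.prob p S - \<delta> \<le> measure (measure_pmf p \<Otimes>\<^sub>M M) (\<Union>A\<in>S. {A} \<times> G A)"
    by (simp add: algebra_simps)
qed

lemma prob_Compl_Un3_ge:
  assumes "measure_pmf.prob p A1 \<le> d1" "measure_pmf.prob p A2 \<le> d2" "measure_pmf.prob p A3 \<le> d3"
  shows "1 - (d1 + d2 + d3) \<le> measure_pmf.prob p (- (A1 \<union> A2 \<union> A3))"
proof -
  have "measure_pmf.prob p (A1 \<union> A2 \<union> A3) \<le> measure_pmf.prob p (A1 \<union> A2) + measure_pmf.prob p A3"
    by (rule measure_Un_le) auto
  also have "measure_pmf.prob p (A1 \<union> A2) \<le> measure_pmf.prob p A1 + measure_pmf.prob p A2"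
    by (rule measure_Un_le) auto
  finally show ?thesis using assms measure_pmf.prob_compl[of "A1 \<union> A2 \<union> A3" p] by (simp add: Compl_eq_Diff_UNIV)
qed

text \<open>All demands on sizes enter as plain inequalities, and the choice of the parameters is
  deferred. Failure consists of the signal event, \<open>1 / n\<close> each for row sums and
  rectangles, and \<open>4 / n\<close> for the Gaussian start.\<close>

lemma sbm_recovery:
  fixes z :: "real vec" and n N K g :: nat and w \<alpha> \<beta> \<epsilon> e r :: real
  assumes n: "2 \<le> n" and w: "2 \<le> w" "w ^ 16 = ln (real n)" and \<beta>: "0 < \<beta>" "\<beta> < \<alpha>"
    and p1: "\<alpha> * ln (real n) / real n \<le> 1" and z: "z \<in> balanced_labels n" and \<epsilon>: "0 < \<epsilon>"
    and e: "4 * (2 * ((12 + 20 * \<alpha>) * w ^ 12) * (2 * real g + 1) + (1/2)^g * ((12 + 20 * \<alpha>) * w ^ 16)) \<le> e"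
  defines "a \<equiv> (\<alpha> + \<beta>) / 2 * w ^ 16" and "b \<equiv> (\<alpha> - \<beta>) / 2 * w ^ 16"
  defines "\<tau> \<equiv> e / r"
  defines "\<kappa> \<equiv> (e + b * \<tau>\<^sup>2) / (a - b)"
  assumes N: "0 < N" and r: "0 < r" and eb: "e < b"
    and rate: "4 * real n ^ 7 * (a + b + e) ^ N * r ^ N < (b - e) ^ (2 * N)"
    and small: "\<tau>\<^sup>2 + \<kappa> \<le> 1 / 2"
    and gap: "b + 2 * e + a * \<kappa> < a * (1 - \<tau>\<^sup>2 - 2 * (\<kappa> + \<tau>\<^sup>2)\<^sup>2)"
    and start: "2 * b * (\<tau>\<^sup>2 + \<kappa>) \<le> \<epsilon> * w ^ 16"
    and \<rho>: "4 * e / (\<epsilon> * w ^ 16) < 1" and K: "1 \<le> K" "(4 * e / (\<epsilon> * w ^ 16)) ^ K * sqrt (real n) < 2"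
  defines "M \<equiv> sbm_gaussian n (\<alpha> * ln (real n) / real n) (\<beta> * ln (real n) / real n) z"
  shows "\<exists>E \<in> sets M. 1 - (real n * exp (- (ln (real n) * ((sqrt \<alpha> - sqrt \<beta>)\<^sup>2 / 2 - \<epsilon> * (ln (\<alpha> / \<beta>) / 2)))) + 6 / real n)
      \<le> measure M E \<and>
    (\<forall>(A, g) \<in> E. algorithm_outputs_within n A (mat n 2 g) N (real (Suc K)) {z, - z})"
proof -
  define L where "L = ln (real n)"
  have n0: "0 < n" using n by simp
  have L0: "0 \<le> L" using n by (simp add: L_def)
  have w0: "0 < w" using w by simp
  have w16: "w ^ 16 = L" using w by (simp add: L_def)
  define u where "u = w ^ 4"
  have u4: "u ^ 4 = L" and u3: "u ^ 3 = w ^ 12" using w16 by (simp_all add: u_def power_mult[symmetric])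
  have "2 ^ 1 \<le> w ^ 4" using power_mono[OF w(1), of 4] by simp
  hence u: "2 \<le> u" by (simp add: u_def)
  define pb where "pb = \<alpha> * u ^ 4 / real n"
  define pr where "pr = sbm_param (\<alpha> * L / real n) (\<beta> * L / real n) z"
  have \<alpha>0: "0 \<le> \<alpha>" using \<beta> by simp
  have em: "edge_model n pr pb"
  proof
    show "pb \<le> 1" using p1 by (simp add: pb_def u4 L_def)
    fix ed assume "ed \<in> edges n"
    have "\<beta> * L / real n \<le> \<alpha> * L / real n" "0 \<le> \<beta> * L / real n"
      using \<beta> L0 by (auto intro!: divide_right_mono mult_right_mono)
    thus "0 \<le> pr ed \<and> pr ed \<le> pb" by (auto simp: pr_def sbm_param_def pb_def u4 split: prod.split)
  qed
  interpret edge_model n pr pb by (rule em)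
  define KK where "KK = 12 + 20 * \<alpha>"
  have KK0: "0 \<le> KK" using \<alpha>0 by (simp add: KK_def)
  note zD = balanced_labelsD[OF z]
  have zsum: "(\<Sum>i<n. z $ i) = 0"
    using zD(2) sum_lessThan_eq_scalar_prod[OF zD(1), of "ones n"] by (simp add: ones_def)
  define A1 where "A1 = {a. \<exists>i<n. (\<Sum>j<n. z $ i * z $ j * of_bool (a (edge i j))) < \<epsilon> * L}"
  define A2 where "A2 = {a. \<exists>i<n. KK * u ^ 4 < (\<Sum>j<n. \<bar>noise a i j\<bar>)}"
  define A3 where "A3 = {a. \<exists>S T. S \<subseteq> {..<n} \<and> T \<subseteq> {..<n} \<and> card S \<le> card T \<and> 0 < card T \<and>
      real (card T) \<le> u\<^sup>2 * real (card S) \<and>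
      KK * u ^ 3 * sqrt (real (card S) * real (card T)) \<le> \<bar>\<Sum>i\<in>S. \<Sum>j\<in>T. noise a i j\<bar>}"
  define d1 where "d1 = real n * exp (- (L * ((sqrt \<alpha> - sqrt \<beta>)\<^sup>2 / 2 - \<epsilon> * (ln (\<alpha> / \<beta>) / 2))))"
  have P1: "measure_pmf.prob model A1 \<le> d1"
    unfolding A1_def d1_def
  proof (rule signal_prob[OF n0 zD(5) zsum \<beta>(1) less_imp_le[OF \<beta>(2)]])
    show "pr (edge i j) = (if z $ i * z $ j = 1 then \<alpha> else \<beta>) * L / real n" if "i < n" "j < n" for i j
      unfolding pr_def sbm_param_edge by simp
  qed
  have P2: "measure_pmf.prob model A2 \<le> 1 / real n"
    unfolding A2_def KK_def by (rule row_prob[OF n _ \<alpha>0 pb_def]) (simp add: u4 L_def)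
  have P3: "measure_pmf.prob model A3 \<le> 1 / real n"
    unfolding A3_def KK_def by (rule discrepancy_prob[OF n u _ \<alpha>0 pb_def]) (simp add: u4 L_def)
  define GA where "GA = - (A1 \<union> A2 \<union> A3)"
  have PGA: "1 - (d1 + 1 / real n + 1 / real n) \<le> measure_pmf.prob model GA"
    unfolding GA_def by (rule prob_Compl_Un3_ge[OF P1 P2 P3])
  \<comment> \<open>The bound on the minor, reduced by the factor \<open>n^2\<close> lost in the two
    anticoncentration steps; hence \<open>n ^ 7\<close> in \<open>rate\<close> where stage 1 has
    \<open>n ^ 5\<close>.\<close>
  define \<theta> where "\<theta> = (b - e) ^ (2 * N) / (real n)\<^sup>2"
  have be0: "0 < (b - e) ^ (2 * N)" using eb by simp
  have good: "\<exists>G \<in> sets (gaussian_entries n). 1 - 4 / real n \<le> measure (gaussian_entries n) G \<and>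
     (\<forall>g \<in> G. algorithm_outputs_within n (adjacency n x) (mat n 2 g) N (real (Suc K)) {z, - z})" if x: "x \<in> GA" for x
  proof -
    have row: "(\<Sum>j<n. \<bar>noise x i j\<bar>) \<le> KK * u ^ 4" if "i < n" for i
    proof -
      have "x \<notin> A2" using x by (simp add: GA_def)
      thus ?thesis using that unfolding A2_def mem_Collect_eq by (meson not_less)
    qed
    have nA3: "\<not> (\<exists>S T. S \<subseteq> {..<n} \<and> T \<subseteq> {..<n} \<and> card S \<le> card T \<and> 0 < card T \<and>
      real (card T) \<le> u\<^sup>2 * real (card S) \<and>
      KK * u ^ 3 * sqrt (real (card S) * real (card T)) \<le> \<bar>\<Sum>i\<in>S. \<Sum>j\<in>T. noise x i j\<bar>)"
    proof -
      have "x \<notin> A3" using x by (simp add: GA_def)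
      thus ?thesis unfolding A3_def mem_Collect_eq .
    qed
    have u0: "0 < u" using u by simp
    have disc: "\<bar>\<Sum>i\<in>S. \<Sum>j\<in>T. noise x i j\<bar> \<le> KK * u ^ 3 * sqrt (real (card S) * real (card T))"
      if "S \<subseteq> {..<n}" "T \<subseteq> {..<n}" for S T
      by (rule discrepancy_all[OF u0 KK0 nA3 row that])
    have bm: "block_matrix n (adjacency n x) z ((\<alpha> + \<beta>) / 2 * L) ((\<alpha> - \<beta>) / 2 * L) e"
    proof (rule adjacency_block_matrix[OF n0 z \<beta>(1) less_imp_le[OF \<beta>(2)] L0, of pb x "KK * u ^ 3" "KK * u ^ 4" g])
      show "edge_model n (sbm_param (\<alpha> * L / real n) (\<beta> * L / real n) z) pb" using em by (simp add: pr_def)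
      show "4 * (2 * (KK * u ^ 3) * (2 * real g + 1) + (1 / 2) ^ g * (KK * u ^ 4)) \<le> e"
        using e unfolding KK_def u3 u4 w16 .
    qed (use disc row KK0 u0 in \<open>auto simp: pr_def\<close>)
    interpret B: block_matrix n "adjacency n x" z a b e
      using bm by (simp add: a_def b_def w16)
    obtain i0 j0 where ij: "i0 < n" "j0 < n" "(b - e) ^ (2 * N) \<le> \<bar>B.minor N i0 j0\<bar>"
      using B.minor_large[OF eb] by blast
    from gaussian_entries_good[where m = "B.minor N", OF n0 ij(1,2) be0 ij(3)] obtain G where
      G: "G \<in> sets (gaussian_entries n)" "1 - 4 / real n \<le> measure (gaussian_entries n) G"
      and gG: "\<And>g. g \<in> G \<Longrightarrow> (\<forall>i<n. \<forall>k<2. \<bar>g (i, k)\<bar> \<le> real n) \<and>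
         \<theta> \<le> \<bar>\<Sum>i<n. \<Sum>j<n. g (i, 0) * g (j, 1) * B.minor N i j\<bar>"
      unfolding \<theta>_def by blast
    have \<theta>0: "0 < \<theta>" using be0 n0 by (simp add: \<theta>_def)
    have rate': "4 * real n ^ 5 * (a + b + e) ^ N * r ^ N < \<theta>"
    proof -
      have eq: "4 * real n ^ 5 * (a + b + e) ^ N * r ^ N * (real n)\<^sup>2 = 4 * real n ^ 7 * (a + b + e) ^ N * r ^ N"
        by (simp add: eval_nat_numeral)
      have p2: "0 < (real n)\<^sup>2" using n0 by simp
      show ?thesis unfolding \<theta>_def pos_less_divide_eq[OF p2] eq by (rule rate)
    qed
    have ba: "b < a" using \<beta> w0 by (simp add: a_def b_def)
    have eta0: "0 < \<epsilon> * w ^ 16" using \<epsilon> w0 by simp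
    have eta: "\<epsilon> * w ^ 16 \<le> z $ i * (adjacency n x *\<^sub>v z) $ i" if i: "i < n" for i
    proof -
      have "z $ i * (adjacency n x *\<^sub>v z) $ i = (\<Sum>j<n. z $ i * z $ j * of_bool (x (edge i j)))"
        unfolding adjacency_mult[OF zD(1) i] sum_distrib_left by (intro sum.cong refl) (simp only: mult_ac)
      moreover have "x \<notin> A1" using x by (simp add: GA_def)
      ultimately show ?thesis using i unfolding A1_def w16 mem_Collect_eq by (metis not_less)
    qed
    have "algorithm_outputs_within n (adjacency n x) (mat n 2 g) N (real (Suc K)) {z, - z}" if g: "g \<in> G" for g
      by (rule B.algorithm_correct[OF N r \<theta>0 _ _ rate' ba small[unfolded \<kappa>_def \<tau>_def] gap[unfolded \<kappa>_def \<tau>_def]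
            eta0 eta start[unfolded \<kappa>_def \<tau>_def] \<rho> K]) (use gG[OF g] in auto)
    thus ?thesis using G by blast
  qed
  define pp where "pp = sbm_pmf n (\<alpha> * ln (real n) / real n) (\<beta> * ln (real n) / real n) z"
  have pp: "pp = map_pmf (adjacency n) model"
    unfolding model_def unfolding pp_def sbm_pmf_eq pr_def L_def ..
  \<comment> \<open>Intersecting with the support makes the set of graphs finite.\<close>
  define S where "S = set_pmf pp \<inter> adjacency n ` GA"
  have "finite (set_pmf model)" unfolding model_def
    by (rule finite_subset[OF set_Pi_pmf_subset']) (auto intro!: finite_PiE_dflt)
  hence fS: "finite S" by (simp add: S_def pp)
  have "\<forall>A\<in>S. \<exists>G. G \<in> sets (gaussian_entries n) \<and> 1 - 4 / real n \<le> measure (gaussian_entries n) G \<and>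
     (\<forall>g \<in> G. algorithm_outputs_within n A (mat n 2 g) N (real (Suc K)) {z, - z})"
    using good unfolding S_def by blast
  then obtain G where G: "\<And>A. A \<in> S \<Longrightarrow> G A \<in> sets (gaussian_entries n)"
    "\<And>A. A \<in> S \<Longrightarrow> 1 - 4 / real n \<le> measure (gaussian_entries n) (G A)"
    "\<And>A g. A \<in> S \<Longrightarrow> g \<in> G A \<Longrightarrow> algorithm_outputs_within n A (mat n 2 g) N (real (Suc K)) {z, - z}"
    by (metis (no_types, lifting))
  have ps: "prob_space (gaussian_entries n)"
    unfolding gaussian_entries_def by (intro prob_space_PiM prob_space_std_normal)
  define E where "E = (\<Union>A\<in>S. {A} \<times> G A)"
  have M: "M = measure_pmf pp \<Otimes>\<^sub>M gaussian_entries n" by (simp add: M_def sbm_gaussian_def pp_def)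
  have pm: "E \<in> sets M"
    unfolding E_def M by (rule pair_pmf_measure_ge(1)[where \<delta> = "4 / real n", OF ps fS]) (use G(1,2) in simp_all)
  have pm2: "measure_pmf.prob pp S - 4 / real n \<le> measure M E"
    unfolding E_def M by (rule pair_pmf_measure_ge(2)[OF ps fS]) (use G(1,2) in simp_all)
  have "measure_pmf.prob model GA \<le> measure_pmf.prob model (adjacency n -` (adjacency n ` GA))"
    by (intro measure_pmf.finite_measure_mono) auto
  also have "\<dots> = measure_pmf.prob pp (adjacency n ` GA)" by (simp add: pp)
  also have "\<dots> = measure_pmf.prob pp S" unfolding S_def by (subst Int_commute) (rule measure_Int_set_pmf[symmetric])
  finally have le: "measure_pmf.prob model GA \<le> measure_pmf.prob pp S" .
  have "1 - (d1 + 6 / real n) \<le> measure M E"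
  proof -
    have "1 / real n + 1 / real n + 4 / real n = 6 / real n" by simp
    thus ?thesis using PGA pm2 le by linarith
  qed
  moreover have "\<forall>(A, g) \<in> E. algorithm_outputs_within n A (mat n 2 g) N (real (Suc K)) {z, - z}"
    using G(3) by (auto simp: E_def)
  ultimately show ?thesis using pm unfolding d1_def L_def by auto
qed

section \<open>Choice of the parameters\<close>

text \<open>In terms of \<open>w\<close> alone the size conditions no longer mention
  \<open>n\<close>, so each is an asymptotic statement in one real variable.\<close>

lemma eventually_scale_conditions:
  fixes K a b c1 c2 \<epsilon> :: real
  assumes K: "0 < K" and a: "0 < a" and b: "0 < b" "b < a" and c: "0 < c1" "0 < c2" and \<epsilon>: "0 < \<epsilon>"
  shows "eventually (\<lambda>w::real. 2 \<le> w) at_top"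
   "eventually (\<lambda>w. 4 * (2 * (K * w ^ 12) * (2 * (4 * log 2 w + 1) + 1) + K * w ^ 12) \<le> w ^ 14) at_top"
   "eventually (\<lambda>w. 2 * w ^ 14 \<le> b * w ^ 16) at_top"
   "eventually (\<lambda>w. sqrt w \<le> c1 * w) at_top"
   "eventually (\<lambda>w. (1 + c2) / w\<^sup>2 \<le> 1 / 2) at_top"
   "eventually (\<lambda>w. b + 2 / w\<^sup>2 + a * c2 / w\<^sup>2 < a * (1 - 1 / w\<^sup>2 - 2 * ((1 + c2) / w\<^sup>2)\<^sup>2)) at_top"
   "eventually (\<lambda>w. 2 * b * ((1 + c2) / w\<^sup>2) \<le> \<epsilon>) at_top"
   "eventually (\<lambda>w. 4 / (\<epsilon> * w\<^sup>2) \<le> 1 / w) at_top"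
  subgoal by real_asymp
  subgoal using K by real_asymp
  subgoal using b by real_asymp
  subgoal using c by real_asymp
  subgoal using c by real_asymp
  subgoal using assms by real_asymp
  subgoal using assms by real_asymp
  subgoal using assms by real_asymp
  done

text \<open>\<open>c\<close> is at most half of either exponent; the spare power of \<open>n\<close>
  absorbs the constant 7.\<close>

lemma eventually_failure_bound:
  fixes c \<zeta> :: real
  assumes "0 < c" "2 * c \<le> \<zeta>" "2 * c \<le> 1"
  shows "eventually (\<lambda>n. real n powr (- \<zeta>) + 6 / real n \<le> real n powr (- c)) at_top"
proof -
  have "eventually (\<lambda>n. 7 \<le> real n powr c) at_top" using assms(1) by real_asymp
  moreover have "eventually (\<lambda>n::nat. 1 \<le> n) at_top" by (rule eventually_ge_at_top)
  ultimately show ?thesis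
  proof eventually_elim
    case (elim n)
    have n: "1 \<le> real n" using elim by simp
    have "real n powr (- \<zeta>) \<le> real n powr (- (2 * c))" using assms n by (intro powr_mono) auto
    moreover have "6 / real n \<le> 6 * real n powr (- (2 * c))"
    proof -
      have "real n powr (- 1) \<le> real n powr (- (2 * c))" using assms n by (intro powr_mono) auto
      thus ?thesis using n by (simp add: powr_minus_divide)
    qed
    moreover have "7 * real n powr (- (2 * c)) \<le> real n powr c * real n powr (- (2 * c))"
      using elim by (intro mult_right_mono) auto
    moreover have "real n powr c * real n powr (- (2 * c)) = real n powr (- c)"
      by (simp add: powr_add[symmetric])
    ultimately show ?case by linarith
  qed
qed

lemma eventually_n_conditions:
  fixes \<alpha> :: real
  shows "eventually (\<lambda>n::nat. \<alpha> * ln (real n) / real n \<le> 1) at_top"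
   "eventually (\<lambda>n::nat. 1 \<le> ln (real n) / ln (ln (real n))) at_top"
   "eventually (\<lambda>n::nat. 0 < ln (ln (real n))) at_top"
   "eventually (\<lambda>n::nat. 1 \<le> ln (real n)) at_top"
   "filterlim (\<lambda>n::nat. ln (real n) powr (1 / 16)) at_top at_top"
  by real_asymp+

lemma algorithm_outputs_within_mono:
  assumes "algorithm_outputs_within n A Y N K T" "K \<le> K'"
  shows "algorithm_outputs_within n A Y N K' T"
  using assms(1) order_trans[OF _ assms(2)] unfolding algorithm_outputs_within_def by blast

text \<open>With \<open>w\<close> the 16th root of \<open>ln n\<close>, all quantities of the proof become integer powers of \<open>w\<close>:
  \<open>e = w\<^sup>1\<^sup>4\<close>, \<open>r = w\<^sup>1\<^sup>5\<close> and \<open>\<tau> = 1 / w\<close>.\<close>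
lemma sbm_recovery_scaled:
  fixes z :: "real vec" and n N K :: nat and w \<alpha> \<beta> \<epsilon> :: real
  assumes n: "5 \<le> n" and w16: "w ^ 16 = ln (real n)" and \<beta>: "0 < \<beta>" "\<beta> < \<alpha>"
    and p1: "\<alpha> * ln (real n) / real n \<le> 1" and z: "z \<in> balanced_labels n" and \<epsilon>: "0 < \<epsilon>"
  defines "a' \<equiv> (\<alpha> + \<beta>) / 2" and "b' \<equiv> (\<alpha> - \<beta>) / 2"
  defines "c1 \<equiv> b'\<^sup>2 / (12 * a')" and "c2 \<equiv> (1 + b') / \<beta>"
  assumes w: "2 \<le> w"
    "4 * (2 * ((12 + 20 * \<alpha>) * w ^ 12) * (2 * (4 * log 2 w + 1) + 1) + (12 + 20 * \<alpha>) * w ^ 12) \<le> w ^ 14"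
    "2 * w ^ 14 \<le> b' * w ^ 16"
    "sqrt w \<le> c1 * w"
    "(1 + c2) / w\<^sup>2 \<le> 1 / 2"
    "b' + 2 / w\<^sup>2 + a' * c2 / w\<^sup>2 < a' * (1 - 1 / w\<^sup>2 - 2 * ((1 + c2) / w\<^sup>2)\<^sup>2)"
    "2 * b' * ((1 + c2) / w\<^sup>2) \<le> \<epsilon>"
    "4 / (\<epsilon> * w\<^sup>2) \<le> 1 / w"
    and N: "0 < N" "16 * ln (real n) \<le> real N * ln w"
    and K: "1 \<le> K" "ln (real n) / 2 \<le> real K * ln w"
  defines "M \<equiv> sbm_gaussian n (\<alpha> * ln (real n) / real n) (\<beta> * ln (real n) / real n) z"
  shows "\<exists>E \<in> sets M. 1 - (real n * exp (- (ln (real n) * ((sqrt \<alpha> - sqrt \<beta>)\<^sup>2 / 2 - \<epsilon> * (ln (\<alpha> / \<beta>) / 2)))) + 6 / real n)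
      \<le> measure M E \<and>
    (\<forall>(A, g) \<in> E. algorithm_outputs_within n A (mat n 2 g) N (real (Suc K)) {z, - z})"
proof -
  have w0: "0 < w" using w(1) by simp
  have ab: "0 < b'" "b' < a'" "0 < a'" "a' - b' = \<beta>" using \<beta> by (auto simp: a'_def b'_def field_simps)
  define a b where "a = a' * w ^ 16" and "b = b' * w ^ 16"
  define e r where "e = w ^ 14" and "r = w ^ 15"
  define \<tau> where "\<tau> = e / r"
  define \<kappa> where "\<kappa> = (e + b * \<tau>\<^sup>2) / (a - b)"
  \<comment> \<open>The choice ensures \<open>2 ^ g \<ge> w ^ 4\<close>, which brings the row-sum
    contribution \<open>w ^ 16\<close> down to the order \<open>w ^ 12\<close> of the discrepancy,
    while \<open>g\<close> is only logarithmic in \<open>w\<close>.\<close>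
  define g where "g = nat \<lceil>log 2 (w ^ 4)\<rceil>"
  have \<tau>: "\<tau> = 1 / w" unfolding \<tau>_def e_def r_def using w0 by (simp add: eval_nat_numeral)
  have \<tau>2: "\<tau>\<^sup>2 = 1 / w\<^sup>2" by (simp add: \<tau> power_divide)
  have \<kappa>: "\<kappa> = c2 / w\<^sup>2"
  proof -
    have ab': "a - b = \<beta> * w ^ 16" unfolding a_def b_def left_diff_distrib[symmetric] ab(4) ..
    have w': "w ^ 16 = w ^ 14 * w\<^sup>2" by (simp add: power_add[symmetric])
    have num: "e + b * \<tau>\<^sup>2 = (1 + b') * w ^ 14"
      unfolding e_def b_def \<tau>2 using w0 by (simp add: distrib_right power_add[symmetric] power_diff[symmetric] field_simps)
    have "x * t / (y * (t * v)) = x / y / v" if "0 < t" for x y t v :: real using that by simp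
    from this[of "w ^ 14" "1 + b'" \<beta> "w\<^sup>2"] show ?thesis
      unfolding \<kappa>_def c2_def num ab' w' using w0 by simp
  qed
  have \<tau>\<kappa>: "\<tau>\<^sup>2 + \<kappa> = (1 + c2) / w\<^sup>2" unfolding \<tau>2 \<kappa> by (simp add: add_divide_distrib)
  have g_hi: "real g \<le> 4 * log 2 w + 1"
  proof -
    have l: "log 2 (w ^ 4) = 4 * log 2 w" using w0 by (simp add: log_nat_power)
    have "0 \<le> log 2 w" using w(1) by simp
    thus ?thesis unfolding g_def l by linarith
  qed
  have g_lo: "(1 / 2) ^ g * w ^ 16 \<le> w ^ 12"
  proof -
    have "w ^ 4 = 2 powr log 2 (w ^ 4)" using w0 by simp
    also have "\<dots> \<le> 2 powr real g" unfolding g_def by (intro powr_mono) (linarith, simp)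
    also have "\<dots> = 2 ^ g" by (simp add: powr_realpow)
    finally have "(1 / 2) ^ g * w ^ 4 \<le> (1 / 2) ^ g * 2 ^ g" by (intro mult_left_mono) auto
    also have "(1 / 2) ^ g * 2 ^ g = (1::real)" by (simp add: power_mult_distrib[symmetric])
    finally have "((1 / 2) ^ g * w ^ 4) * w ^ 12 \<le> 1 * w ^ 12" using w0 by (intro mult_right_mono) auto
    thus ?thesis by (simp add: power_add[symmetric] mult.assoc)
  qed
  have KK: "0 \<le> 12 + 20 * \<alpha>" using \<beta> by simp
  have he: "4 * (2 * ((12 + 20 * \<alpha>) * w ^ 12) * (2 * real g + 1) + (1/2)^g * ((12 + 20 * \<alpha>) * w ^ 16)) \<le> e"
  proof -
    have s1: "2 * ((12 + 20 * \<alpha>) * w ^ 12) * (2 * real g + 1) \<le> 2 * ((12 + 20 * \<alpha>) * w ^ 12) * (2 * (4 * log 2 w + 1) + 1)"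
      using g_hi KK w0 by (intro mult_left_mono) auto
    have s2: "(1/2)^g * ((12 + 20 * \<alpha>) * w ^ 16) \<le> (12 + 20 * \<alpha>) * w ^ 12"
      using mult_left_mono[OF g_lo KK] by (simp add: mult_ac)
    show ?thesis unfolding e_def
      by (rule order_trans[OF mult_left_mono[OF add_mono[OF s1 s2]] w(2)]) simp
  qed
  have eb2: "2 * e \<le> b" using w(3) by (simp add: e_def b_def)
  have e0: "0 < e" and r0: "0 < r" and b0: "0 < b" and a0: "0 < a" and ba: "b < a"
    using w0 ab by (auto simp: e_def r_def a_def b_def)
  have eb: "e < b" using eb2 e0 by linarith
  have nn: "0 < real n" using n by simp
  have rate: "4 * real n ^ 7 * (a + b + e) ^ N * r ^ N < (b - e) ^ (2 * N)"
  proof -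
    \<comment> \<open>Eight powers of \<open>n\<close> cover \<open>4 * n ^ 7\<close> because
      \<open>n\<close> exceeds 4; each iteration gains \<open>sqrt w\<close>, hence the 16 in the
      hypothesis on \<open>N\<close>.\<close>
    have "real n ^ 8 = exp (8 * ln (real n))" using nn exp_of_nat_mult[of 8 "ln (real n)"] by simp
    also have "\<dots> \<le> exp (real N * ln (sqrt w))" using N(2) w0 by (simp add: ln_sqrt)
    also have "\<dots> = (sqrt w) ^ N" using w0 by (simp add: exp_of_nat_mult)
    finally have n8: "real n ^ 8 \<le> (sqrt w) ^ N" .
    have "4 * real n ^ 7 < real n * real n ^ 7" using n nn by (intro mult_strict_right_mono) auto
    also have "\<dots> = real n ^ 8" by (simp add: power_Suc[symmetric] del: power_Suc)
    finally have n7: "4 * real n ^ 7 < (sqrt w) ^ N" using n8 by linarith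
    \<comment> \<open>The sum \<open>a + b + e\<close> is at most \<open>3 * a\<close>, and
      \<open>c1\<close> is chosen so that the product becomes \<open>(b / 2)^2\<close>.\<close>
    have le: "(a + b + e) * r * sqrt w \<le> (b - e)\<^sup>2"
    proof -
      have "(a + b + e) * r * sqrt w \<le> (3 * a) * r * (c1 * w)"
        using eb2 ba e0 r0 w0 w(4) a0 b0 by (intro mult_mono) auto
      also have "\<dots> = (3 * a' * c1) * (w ^ 16 * w ^ 15 * w)" by (simp add: a_def r_def)
      also have "3 * a' * c1 = b'\<^sup>2 / 4" using ab(3) by (simp add: c1_def)
      also have "w ^ 16 * w ^ 15 * w = w ^ 16 * w ^ 16" by (simp add: eval_nat_numeral)
      also have "b'\<^sup>2 / 4 * (w ^ 16 * w ^ 16) = (b / 2)\<^sup>2" by (simp add: b_def power2_eq_square)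
      also have "\<dots> \<le> (b - e)\<^sup>2" using eb2 b0 by (intro power_mono) auto
      finally show ?thesis .
    qed
    have "4 * real n ^ 7 * (a + b + e) ^ N * r ^ N = 4 * real n ^ 7 * ((a + b + e) * r) ^ N" by (simp add: power_mult_distrib)
    also have "\<dots> < (sqrt w) ^ N * ((a + b + e) * r) ^ N"
      using a0 b0 e0 r0 by (intro mult_strict_right_mono n7) auto
    also have "\<dots> = ((a + b + e) * r * sqrt w) ^ N" by (simp add: power_mult_distrib mult_ac)
    also have "\<dots> \<le> ((b - e)\<^sup>2) ^ N" using le a0 b0 e0 r0 w0 by (intro power_mono) auto
    finally show ?thesis by (simp add: power_mult)
  qed
  have gap: "b + 2 * e + a * \<kappa> < a * (1 - \<tau>\<^sup>2 - 2 * (\<kappa> + \<tau>\<^sup>2)\<^sup>2)"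
  proof -
    have "e = w ^ 16 * (1 / w\<^sup>2)" unfolding e_def using w0 by (simp add: power_diff[symmetric])
    hence "b + 2 * e + a * \<kappa> = w ^ 16 * (b' + 2 / w\<^sup>2 + a' * c2 / w\<^sup>2)"
      unfolding a_def b_def \<kappa> by (simp add: algebra_simps)
    also have "\<dots> < w ^ 16 * (a' * (1 - 1 / w\<^sup>2 - 2 * ((1 + c2) / w\<^sup>2)\<^sup>2))"
      using w(6) w0 by (intro mult_strict_left_mono) auto
    also have "\<dots> = a * (1 - \<tau>\<^sup>2 - 2 * (\<tau>\<^sup>2 + \<kappa>)\<^sup>2)" unfolding \<tau>\<kappa> unfolding \<tau>2 a_def by (simp only: mult_ac)
    finally show ?thesis by (simp only: add.commute)
  qed
  have start: "2 * b * (\<tau>\<^sup>2 + \<kappa>) \<le> \<epsilon> * w ^ 16"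
  proof -
    have "2 * b * (\<tau>\<^sup>2 + \<kappa>) = (2 * b' * ((1 + c2) / w\<^sup>2)) * w ^ 16" unfolding \<tau>\<kappa> b_def by (simp only: mult_ac)
    also have "\<dots> \<le> \<epsilon> * w ^ 16" using w(7) w0 by (intro mult_right_mono) auto
    finally show ?thesis .
  qed
  have \<rho>_eq: "4 * e / (\<epsilon> * w ^ 16) = 4 / (\<epsilon> * w\<^sup>2)"
  proof -
    have w': "w ^ 16 = w\<^sup>2 * w ^ 14" by (simp add: power_add[symmetric])
    have "4 * t / (x * (v * t)) = 4 / (x * v)" if "0 < t" for x t v :: real using that by simp
    from this[of "w ^ 14" \<epsilon> "w\<^sup>2"] show ?thesis unfolding e_def w' using w0 by simp
  qed
  have \<rho>: "4 * e / (\<epsilon> * w ^ 16) \<le> 1 / w" unfolding \<rho>_eq by (rule w(8))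
  have \<rho>1: "4 * e / (\<epsilon> * w ^ 16) < 1"
  proof -
    have "1 / w < 1" using w(1) by simp
    thus ?thesis using \<rho> by linarith
  qed
  \<comment> \<open>The contraction factor is at most \<open>1 / w\<close>, and the hypothesis on
    \<open>K\<close> says \<open>w ^ K \<ge> sqrt n\<close>.\<close>
  have K2: "(4 * e / (\<epsilon> * w ^ 16)) ^ K * sqrt (real n) < 2"
  proof -
    have "(4 * e / (\<epsilon> * w ^ 16)) ^ K \<le> (1 / w) ^ K"
      using \<rho> e0 \<epsilon> w0 by (intro power_mono) auto
    also have "\<dots> = exp (- (real K * ln w))"
      using w0 by (simp add: exp_minus exp_of_nat_mult power_divide field_simps)
    also have "\<dots> \<le> exp (- (ln (real n) / 2))" using K(2) by simp
    finally have "(4 * e / (\<epsilon> * w ^ 16)) ^ K * sqrt (real n) \<le> exp (- (ln (real n) / 2)) * sqrt (real n)"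
      by (intro mult_right_mono) auto
    also have "exp (- (ln (real n) / 2)) * sqrt (real n) = 1"
    proof -
      have "sqrt (real n) = exp (ln (real n) / 2)" using nn by (simp add: ln_sqrt[symmetric])
      thus ?thesis by (simp add: exp_add[symmetric])
    qed
    finally show ?thesis by simp
  qed
  have n2: "2 \<le> n" using n by simp
  show ?thesis unfolding M_def
    by (rule sbm_recovery[OF n2 w(1) w16 \<beta> p1 z \<epsilon> he N(1) r0 _ _ _ _ _ \<rho>1 K(1) K2])
       (use eb rate w(5) gap start in \<open>simp_all only: a_def b_def a'_def b'_def \<tau>_def \<kappa>_def flip: \<tau>\<kappa>\<close>)
qed

theorem theorem1:
  fixes \<alpha> \<beta> :: real
  assumes "\<beta> > 0" and "\<alpha> > \<beta>" and "sqrt \<alpha> - sqrt \<beta> > sqrt 2"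
  shows "\<exists>(N :: nat \<Rightarrow> nat) (c :: real) (C1 :: real) (C2 :: real).
    c > 0 \<and> C1 > 0 \<and> C2 > 0 \<and> (\<forall>n. N n > 0) \<and>
    (\<lambda>n. real (N n)) \<in> \<Theta>(\<lambda>n. ln (real n) / ln (ln (real n))) \<and>
    (\<exists>n0. \<forall>n\<ge>n0. even n \<longrightarrow> (\<forall>xstar \<in> balanced_labels n.
       real (N n) \<le> C1 * (ln (real n) / ln (ln (real n))) \<and>
       (let M = sbm_gaussian n (\<alpha> * ln (real n) / real n) (\<beta> * ln (real n) / real n) xstar
        in \<exists>E \<in> sets M. measure M E \<ge> 1 - real n powr (- c) \<and>
             (\<forall>(A, g) \<in> E. algorithm_outputs_within n A (mat n 2 g) (N n)
                (C2 * (ln (real n) / ln (ln (real n)))) {xstar, - xstar}))))"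
proof -
  note \<beta> = assms(1) and \<alpha>\<beta> = assms(2)
  \<comment> \<open>The Chernoff exponent without margin; it has to exceed 1 for a union bound over
    the \<open>n\<close> vertices.\<close>
  define D where "D = (sqrt \<alpha> - sqrt \<beta>)\<^sup>2 / 2"
  have "(sqrt 2)\<^sup>2 < (sqrt \<alpha> - sqrt \<beta>)\<^sup>2" using assms(3) by (intro power_strict_mono) auto
  hence D: "1 < D" by (simp add: D_def)
  \<comment> \<open>Half of the excess over 1 is spent on the margin \<open>\<epsilon>\<close>; the
    other half remains as an exponent of the failure probability.\<close>
  define \<zeta> where "\<zeta> = (D - 1) / 2"
  have \<zeta>: "0 < \<zeta>" using D by (simp add: \<zeta>_def)
  define \<mu>0 where "\<mu>0 = ln (\<alpha> / \<beta>) / 2"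
  have \<mu>0: "0 < \<mu>0" using \<beta> \<alpha>\<beta> by (simp add: \<mu>0_def)
  define \<epsilon> where "\<epsilon> = \<zeta> / \<mu>0"
  have \<epsilon>: "0 < \<epsilon>" using \<zeta> \<mu>0 by (simp add: \<epsilon>_def)
  have D\<epsilon>: "D - \<epsilon> * (ln (\<alpha> / \<beta>) / 2) = 1 + \<zeta>"
    using \<mu>0 unfolding \<mu>0_def[symmetric] by (simp add: \<epsilon>_def) (simp add: \<zeta>_def field_simps)
  define c where "c = min \<zeta> 1 / 2"
  have c: "0 < c" "2 * c \<le> \<zeta>" "2 * c \<le> 1" using \<zeta> by (auto simp: c_def)
  define R where "R = (\<lambda>n::nat. ln (real n) / ln (ln (real n)))"
  \<comment> \<open>Since \<open>ln w\<close> is \<open>ln (ln n) / 16\<close>, the requirement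
    \<open>16 * ln n \<le> N * ln w\<close> becomes \<open>N \<ge> 256 * R n\<close>, and likewise
    \<open>K \<ge> 8 * R n\<close>. The successor keeps both positive for every \<open>n\<close>,
    also where \<open>R n\<close> is zero or negative.\<close>
  define N where "N = (\<lambda>n. Suc (nat \<lceil>256 * R n\<rceil>))"
  define K where "K = (\<lambda>n. Suc (nat \<lceil>8 * R n\<rceil>))"
  define w where "w = (\<lambda>n::nat. ln (real n) powr (1 / 16))"
  define a' b' where "a' = (\<alpha> + \<beta>) / 2" and "b' = (\<alpha> - \<beta>) / 2"
  have ab: "0 < a'" "0 < b'" "b' < a'" using \<beta> \<alpha>\<beta> by (auto simp: a'_def b'_def)
  define c1 c2 where "c1 = b'\<^sup>2 / (12 * a')" and "c2 = (1 + b') / \<beta>"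
  have c12: "0 < c1" "0 < c2" using ab \<beta> by (auto simp: c1_def c2_def)
  have K0: "0 < 12 + 20 * \<alpha>" using \<beta> \<alpha>\<beta> by simp
  have wlim: "filterlim w at_top at_top" unfolding w_def by (rule eventually_n_conditions(5))
  note ev = eventually_scale_conditions[OF K0 ab c12 \<epsilon>, THEN eventually_compose_filterlim[OF _ wlim]]
  have evR: "eventually (\<lambda>n. 1 \<le> R n) at_top" unfolding R_def by (rule eventually_n_conditions(2))
  \<comment> \<open>Rounding and the successor add at most 2 to \<open>N\<close> and at most 3 to
    \<open>Suc K\<close>, which \<open>1 \<le> R n\<close> absorbs into the constants 258 and
    11.\<close>
  have NR: "256 * R n \<le> real (N n) \<and> real (N n) \<le> 258 * R n" if "1 \<le> R n" for n
    using that unfolding N_def by linarith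
  have KR: "8 * R n \<le> real (K n) \<and> real (Suc (K n)) \<le> 11 * R n" if "1 \<le> R n" for n
    using that unfolding K_def by linarith
  have theta: "(\<lambda>n. real (N n)) \<in> \<Theta>(\<lambda>n. ln (real n) / ln (ln (real n)))"
  proof -
    have "(\<lambda>n. real (N n)) \<in> O(R)"
      by (rule bigoI[of _ 258], rule eventually_mono[OF evR]) (use NR in force)
    moreover have "R \<in> O(\<lambda>n. real (N n))"
      by (rule bigoI[of _ 1], rule eventually_mono[OF evR]) (use NR in force)
    ultimately have "(\<lambda>n. real (N n)) \<in> \<Theta>(R)" by (simp add: bigtheta_def bigomega_iff_bigo)
    thus ?thesis unfolding R_def .
  qed
  have "eventually (\<lambda>n. even n \<longrightarrow> (\<forall>xstar \<in> balanced_labels n.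
       real (N n) \<le> 258 * (ln (real n) / ln (ln (real n))) \<and>
       (let M = sbm_gaussian n (\<alpha> * ln (real n) / real n) (\<beta> * ln (real n) / real n) xstar
        in \<exists>E \<in> sets M. measure M E \<ge> 1 - real n powr (- c) \<and>
             (\<forall>(A, g) \<in> E. algorithm_outputs_within n A (mat n 2 g) (N n)
                (11 * (ln (real n) / ln (ln (real n)))) {xstar, - xstar})))) at_top"
    using ev evR eventually_n_conditions(1)[of \<alpha>] eventually_n_conditions(3,4) eventually_failure_bound[OF c] eventually_ge_at_top[of 5]
  proof eventually_elim
    case (elim n)
    note R1 = \<open>1 \<le> R n\<close> and L1 = \<open>1 \<le> ln (real n)\<close> and LL = \<open>0 < ln (ln (real n))\<close> and n5 = \<open>5 \<le> n\<close>
    have w16: "w n ^ 16 = ln (real n)"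
      using L1 by (simp add: w_def powr_realpow[symmetric] powr_powr)
    have lnw: "ln (w n) = ln (ln (real n)) / 16" using L1 by (simp add: w_def ln_powr)
    have RL: "R n * ln (ln (real n)) = ln (real n)" using LL by (simp add: R_def)
    have N2: "16 * ln (real n) \<le> real (N n) * ln (w n)"
    proof -
      have "(256 * R n) * (ln (ln (real n)) / 16) \<le> real (N n) * (ln (ln (real n)) / 16)"
        using NR[OF R1] LL by (intro mult_right_mono) auto
      thus ?thesis unfolding lnw using RL by simp
    qed
    have K2: "ln (real n) / 2 \<le> real (K n) * ln (w n)"
    proof -
      have "(8 * R n) * (ln (ln (real n)) / 16) \<le> real (K n) * (ln (ln (real n)) / 16)"
        using KR[OF R1] LL by (intro mult_right_mono) auto
      thus ?thesis unfolding lnw using RL by simp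
    qed
    have NK: "0 < N n" "1 \<le> K n" by (auto simp: N_def K_def)
    show ?case
    proof (intro impI ballI conjI)
      fix xstar assume x: "xstar \<in> balanced_labels n"
      show "real (N n) \<le> 258 * (ln (real n) / ln (ln (real n)))" using NR[OF R1] by (simp add: R_def)
      define M where "M = sbm_gaussian n (\<alpha> * ln (real n) / real n) (\<beta> * ln (real n) / real n) xstar"
      have exp_eq: "real n * exp (- (ln (real n) * ((sqrt \<alpha> - sqrt \<beta>)\<^sup>2 / 2 - \<epsilon> * (ln (\<alpha> / \<beta>) / 2)))) = real n powr (- \<zeta>)"
      proof -
        have "real n powr (- \<zeta>) = real n powr 1 * real n powr (- (1 + \<zeta>))"
          unfolding powr_add[symmetric] by simp
        also have "\<dots> = real n * exp (- (ln (real n) * (1 + \<zeta>)))" using n5 by (simp add: powr_def algebra_simps)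
        finally show ?thesis unfolding D_def[symmetric] D\<epsilon> ..
      qed
      obtain E where E: "E \<in> sets M"
        "1 - (real n powr (- \<zeta>) + 6 / real n) \<le> measure M E"
        "\<forall>(A, g) \<in> E. algorithm_outputs_within n A (mat n 2 g) (N n) (real (Suc (K n))) {xstar, - xstar}"
        using sbm_recovery_scaled[OF n5 w16 \<beta> \<alpha>\<beta> \<open>\<alpha> * ln (real n) / real n \<le> 1\<close> x \<epsilon>
            elim(1-8)[unfolded c1_def c2_def a'_def b'_def] NK(1) N2 NK(2) K2]
        unfolding exp_eq M_def by blast
      have "real (Suc (K n)) \<le> 11 * (ln (real n) / ln (ln (real n)))" using KR[OF R1] by (simp add: R_def)
      hence "\<forall>(A, g) \<in> E. algorithm_outputs_within n A (mat n 2 g) (N n) (11 * (ln (real n) / ln (ln (real n)))) {xstar, - xstar}"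
        using E(3) algorithm_outputs_within_mono by blast
      moreover have "1 - real n powr (- c) \<le> measure M E" using E(2) elim by linarith
      ultimately show "let M = sbm_gaussian n (\<alpha> * ln (real n) / real n) (\<beta> * ln (real n) / real n) xstar
        in \<exists>E \<in> sets M. measure M E \<ge> 1 - real n powr (- c) \<and>
             (\<forall>(A, g) \<in> E. algorithm_outputs_within n A (mat n 2 g) (N n)
                (11 * (ln (real n) / ln (ln (real n)))) {xstar, - xstar})"
        unfolding Let_def M_def[symmetric] using E(1) by blast
    qed
  qed
  then obtain n0 where n0: "\<And>n. n \<ge> n0 \<Longrightarrow> even n \<longrightarrow> (\<forall>xstar \<in> balanced_labels n.
       real (N n) \<le> 258 * (ln (real n) / ln (ln (real n))) \<and>
       (let M = sbm_gaussian n (\<alpha> * ln (real n) / real n) (\<beta> * ln (real n) / real n) xstar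
        in \<exists>E \<in> sets M. measure M E \<ge> 1 - real n powr (- c) \<and>
             (\<forall>(A, g) \<in> E. algorithm_outputs_within n A (mat n 2 g) (N n)
                (11 * (ln (real n) / ln (ln (real n)))) {xstar, - xstar})))"
    unfolding eventually_at_top_linorder by blast
  show ?thesis
    using c(1) theta n0 by (intro exI[of _ N] exI[of _ c] exI[of _ "258::real"] exI[of _ "11::real"]) (auto simp: N_def)
qed

end
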